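(* Let $\chi$ be a quadratic Dirichlet character of conductor $d$, and let $\eta\in\{-1,1\}$. Then, as $x\to\infty$, \[ \frac{\#\{ pq\leq x:\ \chi(p)=\chi(q)=\eta\}}{\frac 14 \#\{ pq\leq x:\ (pq,d)=1\}} = 1+\eta\, \frac{\mathcal{L}_\chi +o(1)}{\log\log x}, \qquad \text{where} \quad \mathcal{L}_\chi := \sum_{p} \frac{\chi(p)}{p}. \]
   Context: Throughout, $p$ and $q$ denote prime numbers. The notation $\#\{pq\le x:\ \text{condition}\}$ denotes the number of integers $n\le x$ of the form $n=pq$ with $p,q$ primes (not necessarily distinct) satisfying the stated condition. The sum $\mathcal{L}_\chi=\sum_p \chi(p)/p$ runs over all primes $p$ in increasing order (it converges). The $o(1)$ term tends to $0$ as $x\to\infty$ (for fixed $\chi$). *)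

theory Defs
  imports Complex_Main "HOL-Computational_Algebra.Primes"
begin

definition dirichlet_character :: "nat \<Rightarrow> (int \<Rightarrow> complex) \<Rightarrow> bool" where
  "dirichlet_character m \<chi> \<longleftrightarrow>
     m > 0 \<and>
     (\<forall>a b. \<chi> (a * b) = \<chi> a * \<chi> b) \<and>
     (\<forall>a. \<chi> (a + int m) = \<chi> a) \<and>
     (\<forall>a. \<chi> a \<noteq> 0 \<longleftrightarrow> coprime a (int m))"

definition principal_character :: "nat \<Rightarrow> int \<Rightarrow> complex" where
  "principal_character m a = (if coprime a (int m) then 1 else 0)"

text \<open>Quadratic means of order exactly two in the group of characters modulo \<open>m\<close>.\<close>

definition quadratic_character :: "nat \<Rightarrow> (int \<Rightarrow> complex) \<Rightarrow> bool" where
  "quadratic_character m \<chi> \<longleftrightarrow>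
     dirichlet_character m \<chi> \<and>
     \<chi> \<noteq> principal_character m \<and>
     (\<lambda>a. \<chi> a ^ 2) = principal_character m"

text \<open>The conductor of a character \<open>\<chi>\<close> modulo \<open>m\<close> is the least divisor \<open>f\<close> of \<open>m\<close> such that
  \<open>\<chi>\<close> is induced by a character modulo \<open>f\<close>.\<close>

definition conductor :: "nat \<Rightarrow> (int \<Rightarrow> complex) \<Rightarrow> nat" where
  "conductor m \<chi> =
     (LEAST f. f > 0 \<and> f dvd m \<and>
        (\<exists>\<psi>. dirichlet_character f \<psi> \<and> (\<forall>a. coprime a (int m) \<longrightarrow> \<chi> a = \<psi> a)))"

text \<open>The number of integers \<open>n \<le> x\<close> (not of pairs) having the form \<open>n = p q\<close>, with possibly
  equal primes \<open>p\<close> and \<open>q\<close> satisfying \<open>P p q\<close>.\<close>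

definition count_pq :: "real \<Rightarrow> (nat \<Rightarrow> nat \<Rightarrow> bool) \<Rightarrow> nat" where
  "count_pq x P =
     card {n :: nat. real n \<le> x \<and> (\<exists>p q. prime p \<and> prime q \<and> n = p * q \<and> P p q)}"

text \<open>The series over the primes converges only conditionally; \<open>suminf\<close> over \<open>nat\<close> takes the
  primes in increasing order.\<close>

definition prime_sum :: "(int \<Rightarrow> complex) \<Rightarrow> complex" where
  "prime_sum \<chi> = (\<Sum>n::nat. if prime n then \<chi> (int n) / of_nat n else 0)"

end

theory Submission
  imports Defs "HOL-Complex_Analysis.Complex_Analysis" "HOL-Number_Theory.Prime_Powers"
    "HOL-Probability.Sinc_Integral" "HOL-Real_Asymp.Real_Asymp"
begin

text \<open>
  For a prime \<open>p\<close> not dividing \<open>d\<close>, the indicator of \<open>\<chi> p = \<eta>\<close> is \<open>(1 + \<eta> \<chi> p) / 2\<close>. Expanding the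
  product over ordered pairs \<open>p q \<le> x\<close>, four times the count is the number of coprime pairs plus
  \<open>2 \<eta> \<Sum> \<chi> p\<close> plus \<open>\<Sum> \<chi> (p q)\<close>, so it suffices that the first sum is \<open>(L + o(1)) x / ln x\<close>, the
  second \<open>o(x / ln x)\<close>, and the number of coprime pairs \<open>\<sim> 2 x ln ln x / ln x\<close>. By the hyperbola
  method all three follow from the prime number theorem and its analogue
  \<open>\<Sum> \<chi> p = O(x / (ln x) powr (1 + \<epsilon>))\<close> over \<open>p \<le> x\<close>; some \<open>\<epsilon> > 0\<close> is essential here,
  because the sum over the small prime costs a factor \<open>ln ln x\<close>.

  Such a saving comes from polynomial bounds on the line \<open>Re s = 1\<close>. The 3-4-1 inequality is used
  quantitatively to bound \<open>\<zeta>\<close> and \<open>L\<close> from below by \<open>(1 + \<bar>t\<bar>)\<close> to the power \<open>-4\<close>, uniformly for \<open>Re s > 1\<close>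
  (near \<open>s = 1\<close> one needs \<open>L(1) \<noteq> 0\<close>), hence \<open>L'/L\<close> and its derivative grow at most polynomially in
  the height. Perron's formula then bounds the Riesz means of order 11 of \<open>\<Lambda> - 1\<close> and of
  \<open>(1 + \<chi>) \<Lambda> - 1\<close>, with a saving of \<open>ln x\<close>, and since these sequences are at least \<open>-1\<close>, passing from
  order \<open>k + 1\<close> to order \<open>k\<close> only halves the exponent of the saving. No analytic continuation
  beyond \<open>Re s > 1\<close> is used.
\<close>

(* HOL-Analysis declares the letter chi as the binder for vectors. *)
unbundle no vec_syntax

section \<open>Dirichlet series\<close>

text \<open>Only the half-plane \<open>Re s > 1\<close> ever matters, so absolute convergence is required for every
  exponent above 1 at once.\<close>

definition abs_conv :: "(nat \<Rightarrow> real) \<Rightarrow> bool" where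
  "abs_conv a \<longleftrightarrow> (\<forall>\<sigma>>1. summable (\<lambda>n. \<bar>a n\<bar> * real n powr (-\<sigma>)))"

definition dirichlet_series :: "(nat \<Rightarrow> real) \<Rightarrow> complex \<Rightarrow> complex" where
  "dirichlet_series a s = (\<Sum>n. of_real (a n) * of_nat n powr (-s))"

lemma norm_dirichlet_term:
  "norm (of_real (a n) * of_nat n powr (-s) :: complex) = \<bar>a n\<bar> * real n powr (-Re s)"
  by (simp add: norm_mult norm_powr_real_powr)

lemma abs_conv_mono:
  assumes "abs_conv b" "\<And>n. \<bar>a n\<bar> \<le> \<bar>b n\<bar>"
  shows "abs_conv a"
  unfolding abs_conv_def
proof safe
  fix \<sigma> :: real assume "\<sigma> > 1"
  then have "summable (\<lambda>n. \<bar>b n\<bar> * real n powr (-\<sigma>))"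
    using assms(1) by (simp add: abs_conv_def)
  then show "summable (\<lambda>n. \<bar>a n\<bar> * real n powr (-\<sigma>))"
    by (rule summable_comparison_test') (auto intro!: mult_right_mono assms(2) simp: abs_mult)
qed

lemma abs_conv_const: "abs_conv (\<lambda>_. x)"
  unfolding abs_conv_def by (auto intro!: summable_mult simp: summable_real_powr_iff)

lemma abs_conv_add:
  assumes "abs_conv a" "abs_conv b"
  shows "abs_conv (\<lambda>n. a n + b n)"
  unfolding abs_conv_def
proof safe
  fix \<sigma> :: real assume "\<sigma> > 1"
  then have "summable (\<lambda>n. \<bar>a n\<bar> * real n powr (-\<sigma>) + \<bar>b n\<bar> * real n powr (-\<sigma>))"
    using assms by (intro summable_add) (simp_all add: abs_conv_def)
  then show "summable (\<lambda>n. \<bar>a n + b n\<bar> * real n powr (-\<sigma>))"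
    by (rule summable_comparison_test')
       (auto simp: abs_mult abs_triangle_ineq mult_right_mono simp flip: distrib_right)
qed

lemma abs_conv_diff:
  assumes "abs_conv a" "abs_conv b"
  shows "abs_conv (\<lambda>n. a n - b n)"
proof -
  have "abs_conv (\<lambda>n. - b n)"
    by (rule abs_conv_mono[OF assms(2)]) simp
  from abs_conv_add[OF assms(1) this] show ?thesis by simp
qed

lemma abs_conv_mult_ln:
  assumes "abs_conv a"
  shows "abs_conv (\<lambda>n. a n * ln (real n))"
  unfolding abs_conv_def
proof safe
  fix \<sigma> :: real assume "\<sigma> > 1"
  define \<delta> where "\<delta> = (\<sigma> - 1) / 2"
  have "\<delta> > 0" "\<sigma> - \<delta> > 1" using \<open>\<sigma> > 1\<close> by (auto simp: \<delta>_def field_simps)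
  then have "summable (\<lambda>n. 1 / \<delta> * (\<bar>a n\<bar> * real n powr (-(\<sigma> - \<delta>))))"
    using assms[unfolded abs_conv_def] by (intro summable_mult) auto
  then show "summable (\<lambda>n. \<bar>a n * ln (real n)\<bar> * real n powr (-\<sigma>))"
  proof (rule summable_comparison_test'[where N = 1])
    fix n :: nat assume n: "n \<ge> 1"
    have "ln (real n) \<le> real n powr \<delta> / \<delta>"
      using n \<open>\<delta> > 0\<close> by (intro ln_powr_bound) auto
    then have "\<bar>a n\<bar> * ln (real n) * real n powr (-\<sigma>) \<le>
        \<bar>a n\<bar> * (real n powr \<delta> / \<delta>) * real n powr (-\<sigma>)"
      by (intro mult_right_mono mult_left_mono) auto
    also have "\<dots> = 1 / \<delta> * (\<bar>a n\<bar> * real n powr (-(\<sigma> - \<delta>)))"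
      by (simp add: powr_add[symmetric] field_simps powr_diff powr_minus)
    finally show "norm (\<bar>a n * ln (real n)\<bar> * real n powr (-\<sigma>)) \<le>
        1 / \<delta> * (\<bar>a n\<bar> * real n powr (-(\<sigma> - \<delta>)))"
      using n by (simp add: abs_mult)
  qed
qed

lemma abs_conv_mult_ln_power: "abs_conv a \<Longrightarrow> abs_conv (\<lambda>n. a n * ln (real n) ^ k)"
  by (induction k)
     (auto simp: mult.assoc[symmetric] power_Suc2 simp del: power_Suc intro!: abs_conv_mult_ln)

lemma summable_norm_dirichlet_series:
  assumes "abs_conv a" "Re s > 1"
  shows "summable (\<lambda>n. norm (of_real (a n) * of_nat n powr (-s) :: complex))"
  using assms by (simp add: norm_dirichlet_term abs_conv_def)

lemma dirichlet_series_sums: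
  assumes "abs_conv a" "Re s > 1"
  shows "(\<lambda>n. of_real (a n) * of_nat n powr (-s)) sums dirichlet_series a s"
  unfolding dirichlet_series_def
  using summable_norm_cancel[OF summable_norm_dirichlet_series[OF assms]] by (rule summable_sums)

lemma dirichlet_series_sums_Suc:
  assumes "abs_conv a" "Re s > 1"
  shows "(\<lambda>n. of_real (a (Suc n)) * of_nat (Suc n) powr (-s)) sums dirichlet_series a s"
  using dirichlet_series_sums[OF assms] by (subst sums_Suc_iff) simp

lemma dirichlet_series_has_sum:
  assumes "abs_conv a" "Re s > 1"
  shows "((\<lambda>n. of_real (a n) * of_nat n powr (-s)) has_sum dirichlet_series a s) {0<..}"
proof -
  have "((\<lambda>n. of_real (a n) * of_nat n powr (-s)) has_sum dirichlet_series a s) UNIV"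
    by (intro norm_summable_imp_has_sum summable_norm_dirichlet_series dirichlet_series_sums assms)
  also have "?this \<longleftrightarrow> ?thesis"
    by (intro has_sum_cong_neutral) auto
  finally show ?thesis .
qed

lemma dirichlet_series_abs_summable_on:
  assumes "abs_conv a" "Re s > 1"
  shows "(\<lambda>n. norm (of_real (a n) * of_nat n powr (-s) :: complex)) summable_on {0<..}"
proof (rule summable_on_subset_banach)
  show "(\<lambda>n. norm (of_real (a n) * of_nat n powr (-s) :: complex)) summable_on UNIV"
    using norm_summable_imp_summable_on[of "\<lambda>n. norm (of_real (a n) * of_nat n powr (-s) :: complex)"]
      summable_norm_dirichlet_series[OF assms] by simp
qed simp

lemma dirichlet_series_add:
  assumes "abs_conv a" "abs_conv b" "Re s > 1"
  shows "dirichlet_series (\<lambda>n. a n + b n) s = dirichlet_series a s + dirichlet_series b s"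
proof -
  have "(\<lambda>n. of_real (a n) * of_nat n powr (-s) + of_real (b n) * of_nat n powr (-s)) sums
          (dirichlet_series a s + dirichlet_series b s)"
    by (intro sums_add dirichlet_series_sums assms)
  then show ?thesis
    unfolding dirichlet_series_def[of "\<lambda>n. a n + b n"] by (simp add: sums_iff algebra_simps)
qed

lemma dirichlet_series_diff:
  assumes "abs_conv a" "abs_conv b" "Re s > 1"
  shows "dirichlet_series (\<lambda>n. a n - b n) s = dirichlet_series a s - dirichlet_series b s"
proof -
  have "(\<lambda>n. of_real (a n) * of_nat n powr (-s) - of_real (b n) * of_nat n powr (-s)) sums
          (dirichlet_series a s - dirichlet_series b s)"
    by (intro sums_diff dirichlet_series_sums assms)
  then show ?thesis
    unfolding dirichlet_series_def[of "\<lambda>n. a n - b n"] by (simp add: sums_iff algebra_simps)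
qed

lemma has_field_derivative_dirichlet_term:
  "((\<lambda>s. of_real (a n) * of_nat n powr (-s) :: complex) has_field_derivative
     - (of_real (a n * ln (real n)) * of_nat n powr (-z))) (at z)"
proof (cases "n = 0")
  case False
  have "((\<lambda>s. of_real (a n) * of_nat n powr (-s)) has_field_derivative
      of_real (a n) * (Ln (of_nat n) * of_nat n powr (-z) * (-1))) (at z)"
    using False
    by (intro DERIV_cmult DERIV_chain2[where g = uminus, OF has_field_derivative_powr_right])
       (auto intro!: derivative_eq_intros)
  then show ?thesis using False by (simp add: mult_ac)
qed auto

lemma has_field_derivative_dirichlet_series:
  assumes "abs_conv a" "Re s > 1"
  shows "(dirichlet_series a has_field_derivative
           - dirichlet_series (\<lambda>n. a n * ln (real n)) s) (at s)"
proof -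
  define \<sigma> where "\<sigma> = (1 + Re s) / 2"
  have \<sigma>: "\<sigma> > 1" "\<sigma> < Re s" using assms(2) by (auto simp: \<sigma>_def field_simps)
  define S where "S = {z. Re z > \<sigma>}"
  let ?f' = "\<lambda>n s. - (of_real (a n * ln (real n)) * of_nat n powr (-s)) :: complex"
  have "open S" "convex S" "s \<in> S"
    using \<sigma> by (auto simp: S_def open_halfspace_Re_gt convex_halfspace_Re_gt)
  then have "s \<in> interior S" by (simp add: interior_open)
  have termwise: "((\<lambda>s. of_real (a n) * of_nat n powr (-s)) has_field_derivative ?f' n z)
      (at z within S)" for n z
    by (rule has_field_derivative_at_within[OF has_field_derivative_dirichlet_term])
  have uniform: "uniformly_convergent_on S (\<lambda>n x. \<Sum>i<n. ?f' i x)"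
  proof (rule Weierstrass_m_test')
    show "summable (\<lambda>n. \<bar>a n * ln (real n)\<bar> * real n powr (-\<sigma>))"
      using abs_conv_mult_ln[OF assms(1)] \<sigma>(1) by (simp add: abs_conv_def)
    fix n z assume "z \<in> S"
    then have "real n powr (-Re z) \<le> real n powr (-\<sigma>)"
      by (cases "n = 0") (auto simp: S_def intro!: powr_mono)
    then show "norm (?f' n z) \<le> \<bar>a n * ln (real n)\<bar> * real n powr (-\<sigma>)"
      unfolding norm_minus_cancel norm_dirichlet_term[of "\<lambda>n. a n * ln (real n)"]
      by (rule mult_left_mono) simp
  qed
  have "((\<lambda>s. \<Sum>n. of_real (a n) * of_nat n powr (-s)) has_field_derivative (\<Sum>n. ?f' n s)) (at s)"
    by (rule has_field_derivative_series'(2)[OF \<open>convex S\<close> termwise uniform \<open>s \<in> S\<close>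
          sums_summable[OF dirichlet_series_sums[OF assms]] \<open>s \<in> interior S\<close>])
  moreover have "(\<Sum>n. ?f' n s) = - dirichlet_series (\<lambda>n. a n * ln (real n)) s"
    unfolding dirichlet_series_def
    using sums_summable[OF dirichlet_series_sums[OF abs_conv_mult_ln[OF assms(1)] assms(2)]]
    by (rule suminf_minus)
  ultimately show ?thesis
    by (simp add: dirichlet_series_def[abs_def])
qed

lemma has_sum_divisors:
  fixes h :: "nat \<Rightarrow> nat \<Rightarrow> 'a :: {topological_comm_monoid_add, t3_space}"
  assumes "((\<lambda>(m, k). h m k) has_sum S) ({0<..} \<times> {0<..})"
  shows "((\<lambda>n. \<Sum>d | d dvd n. h d (n div d)) has_sum S) {0<..}"
proof (rule has_sum_SigmaD)
  have "((\<lambda>(m, k). h m k) has_sum S) ({0<..} \<times> {0<..}) \<longleftrightarrow>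
      ((\<lambda>(n, d). h d (n div d)) has_sum S) (SIGMA n:{0<..}. {d. d dvd n})"
    by (rule has_sum_reindex_bij_witness[of _ "\<lambda>(n, d). (d, n div d)" "\<lambda>(m, k). (m * k, m)"])
       (auto elim!: dvdE)
  then show "((\<lambda>(n, d). h d (n div d)) has_sum S) (SIGMA n:{0<..}. {d. d dvd n})"
    using assms by simp
qed (auto intro!: has_sum_finite)

lemma has_sum_product:
  fixes f g :: "'b \<Rightarrow> 'a :: {real_normed_field, banach}"
  assumes f: "(f has_sum S) A" "(\<lambda>x. norm (f x)) summable_on A"
    and g: "(g has_sum T) B" "(\<lambda>y. norm (g y)) summable_on B"
  shows "((\<lambda>(x, y). f x * g y) has_sum (S * T)) (A \<times> B)"
proof (rule has_sum_SigmaI[where g = "\<lambda>x. f x * T"])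
  have "(\<lambda>(x, y). norm (f x) * norm (g y)) summable_on A \<times> B"
  proof (rule summable_on_SigmaI)
    show "((\<lambda>y. case (x, y) of (x, y) \<Rightarrow> norm (f x) * norm (g y)) has_sum
        norm (f x) * (\<Sum>\<^sub>\<infinity>y\<in>B. norm (g y))) B" for x
      unfolding prod.case by (intro has_sum_cmult_right has_sum_infsum g)
    show "(\<lambda>x. norm (f x) * (\<Sum>\<^sub>\<infinity>y\<in>B. norm (g y))) summable_on A"
      by (intro summable_on_cmult_left f)
  qed auto
  then have "(\<lambda>z. norm (case z of (x, y) \<Rightarrow> f x * g y)) summable_on A \<times> B"
    by (simp add: case_prod_unfold norm_mult)
  then show "(\<lambda>(x, y). f x * g y) summable_on A \<times> B"
    by (rule abs_summable_summable)
  show "((\<lambda>x. f x * T) has_sum (S * T)) A"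
    by (intro has_sum_cmult_left f)
  show "((\<lambda>y. case (x, y) of (x, y) \<Rightarrow> f x * g y) has_sum f x * T) B" for x
    unfolding prod.case by (intro has_sum_cmult_right g)
qed

lemma dirichlet_series_mult:
  assumes "abs_conv a" "abs_conv b" "Re s > 1"
    and conv: "\<And>n. n > 0 \<Longrightarrow> c n = (\<Sum>d | d dvd n. a d * b (n div d))"
  shows "dirichlet_series c s = dirichlet_series a s * dirichlet_series b s"
proof -
  define f where "f n = (of_real (a n) * of_nat n powr (-s) :: complex)" for n
  define g where "g n = (of_real (b n) * of_nat n powr (-s) :: complex)" for n
  let ?P = "dirichlet_series a s * dirichlet_series b s"
  have "((\<lambda>(m, k). f m * g k) has_sum ?P) ({0<..} \<times> {0<..})"
    unfolding f_def g_def
    by (intro has_sum_product dirichlet_series_has_sum dirichlet_series_abs_summable_on assms)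
  then have "((\<lambda>n. \<Sum>d | d dvd n. f d * g (n div d)) has_sum ?P) {0<..}"
    by (rule has_sum_divisors)
  also have "?this \<longleftrightarrow> ((\<lambda>n. of_real (c n) * of_nat n powr (-s)) has_sum ?P) UNIV"
  proof (intro has_sum_cong_neutral)
    fix n :: nat assume n: "n \<in> {0<..} \<inter> UNIV"
    have "f d * g (n div d) = of_real (a d * b (n div d)) * of_nat n powr (-s)" if "d dvd n" for d
    proof -
      from that obtain k where k: "n = d * k" by (elim dvdE)
      have "(of_nat n :: complex) powr (-s) = of_nat d powr (-s) * of_nat k powr (-s)"
        using n unfolding k of_nat_mult by (intro powr_times_real) auto
      then show ?thesis using n k by (simp add: f_def g_def)
    qed
    then show "(\<Sum>d | d dvd n. f d * g (n div d)) = of_real (c n) * of_nat n powr (-s)"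
      using n conv[of n] by (simp add: sum_distrib_right)
  qed (auto simp: not_less)
  finally show ?thesis
    by (auto dest!: has_sum_imp_sums simp: dirichlet_series_def sums_iff)
qed

lemma dirichlet_series_tendsto_at_infinity:
  assumes "abs_conv a"
  shows "((\<lambda>\<sigma>. dirichlet_series a (Complex \<sigma> t)) \<longlongrightarrow> of_real (a 1)) at_top"
proof -
  have termwise: "((\<lambda>\<sigma>. of_real (a n) * of_nat n powr (- Complex \<sigma> t)) \<longlongrightarrow>
      (if n = 1 then of_real (a 1) else 0)) at_top" for n
  proof (cases "n \<le> 1")
    case False
    have "((\<lambda>\<sigma>. \<bar>a n\<bar> * real n powr (-\<sigma>)) \<longlongrightarrow> 0) at_top"
      using False by real_asymp
    then show ?thesis using False
      by (auto simp: norm_dirichlet_term intro!: Lim_null_comparison[of _ "\<lambda>\<sigma>. \<bar>a n\<bar> * real n powr (-\<sigma>)"])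
  qed (cases n; auto)
  have "eventually (\<lambda>(n,\<sigma>). norm (of_real (a n) * of_nat n powr (- Complex \<sigma> t)) \<le>
        \<bar>a n\<bar> * real n powr (-2)) (at_top \<times>\<^sub>F at_top)"
    unfolding eventually_prod_filter
  proof (intro exI conjI allI impI)
    show "eventually (\<lambda>n::nat. n > 0) at_top" by (rule eventually_gt_at_top)
    show "eventually (\<lambda>\<sigma>::real. \<sigma> \<ge> 2) at_top" by (rule eventually_ge_at_top)
    fix n :: nat and \<sigma> :: real assume "n > 0" "\<sigma> \<ge> 2"
    then show "case (n, \<sigma>) of (n,\<sigma>) \<Rightarrow> norm (of_real (a n) * of_nat n powr (- Complex \<sigma> t)) \<le>
        \<bar>a n\<bar> * real n powr (-2)"
      unfolding prod.case norm_dirichlet_term by (auto intro!: mult_left_mono powr_mono)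
  qed
  moreover have "summable (\<lambda>n. \<bar>a n\<bar> * real n powr (-2))"
    using assms by (auto simp: abs_conv_def)
  ultimately have "((\<lambda>\<sigma>. \<Sum>n. of_real (a n) * of_nat n powr (- Complex \<sigma> t)) \<longlongrightarrow>
       (\<Sum>n. if n = 1 then of_real (a 1) else 0)) at_top"
    using tannerys_theorem[OF termwise] by auto
  moreover have "(\<Sum>n. if n = 1 then of_real (a 1) else 0) = (of_real (a 1) :: complex)"
    using sums_single[of 1 "\<lambda>_. of_real (a 1) :: complex"] by (simp add: sums_iff)
  ultimately show ?thesis by (simp add: dirichlet_series_def)
qed

section \<open>Completely multiplicative sign functions\<close>

lemma mangoldt_le_ln: "mangoldt n \<le> ln (real n)"
  by (cases "n = 0") (auto intro: mangoldt_le)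

lemma abs_conv_mangoldt: "abs_conv mangoldt"
proof (rule abs_conv_mono)
  show "abs_conv (\<lambda>n. 1 * ln (real n))"
    by (intro abs_conv_mult_ln abs_conv_const)
  show "\<bar>mangoldt n\<bar> \<le> \<bar>1 * ln (real n)\<bar>" for n
    using mangoldt_le_ln[of n] mangoldt_nonneg[of n] by simp
qed

lemma Re_of_nat_powr:
  assumes "n > 0"
  shows "Re (of_nat n powr (- Complex \<sigma> t)) = real n powr (-\<sigma>) * cos (t * ln (real n))"
proof -
  have "of_nat n powr (- Complex \<sigma> t) = exp (Complex (- \<sigma> * ln (real n)) (- t * ln (real n)))"
    using assms by (simp add: powr_def complex_eq_iff Re_exp Im_exp)
  then show ?thesis
    using assms by (simp add: Re_exp powr_def)
qed

locale sign_character =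
  fixes \<chi> :: "nat \<Rightarrow> real"
  assumes chi_mult: "\<chi> (m * n) = \<chi> m * \<chi> n"
    and chi_one: "\<chi> 1 = 1"
    and chi_values: "\<chi> n \<in> {-1, 0, 1}"
begin

lemma abs_chi_le_1: "\<bar>\<chi> n\<bar> \<le> 1"
  using chi_values[of n] by auto

lemma chi_dvd_mult_div: "d dvd n \<Longrightarrow> n > 0 \<Longrightarrow> \<chi> d * \<chi> (n div d) = \<chi> n"
  by (auto simp: chi_mult[symmetric] elim!: dvdE)

lemma abs_conv_chi: "abs_conv \<chi>"
  by (rule abs_conv_mono[OF abs_conv_const[of 1]]) (use abs_chi_le_1 in auto)

lemma abs_conv_chi_mult:
  assumes "abs_conv a"
  shows "abs_conv (\<lambda>n. \<chi> n * a n)"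
proof (rule abs_conv_mono[OF assms])
  show "\<bar>\<chi> n * a n\<bar> \<le> \<bar>a n\<bar>" for n
    unfolding abs_mult using abs_chi_le_1[of n] by (intro mult_left_le_one_le) auto
qed

lemma abs_conv_chi_mangoldt: "abs_conv (\<lambda>n. \<chi> n * mangoldt n)"
  by (rule abs_conv_chi_mult[OF abs_conv_mangoldt])

lemma dirichlet_series_chi_ln:
  assumes "Re s > 1"
  shows "dirichlet_series (\<lambda>n. \<chi> n * ln (real n)) s =
         dirichlet_series (\<lambda>n. \<chi> n * mangoldt n) s * dirichlet_series \<chi> s"
proof (rule dirichlet_series_mult[OF abs_conv_chi_mangoldt abs_conv_chi assms])
  fix n :: nat assume n: "n > 0"
  have "(\<Sum>d | d dvd n. \<chi> d * mangoldt d * \<chi> (n div d)) = (\<Sum>d | d dvd n. \<chi> n * mangoldt d)"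
    using n by (intro sum.cong) (auto simp flip: chi_dvd_mult_div)
  also have "\<dots> = \<chi> n * ln (real n)"
    using n mangoldt_sum[of n, where ?'a = real] by (simp flip: sum_distrib_left)
  finally show "\<chi> n * ln (real n) = (\<Sum>d | d dvd n. \<chi> d * mangoldt d * \<chi> (n div d))" ..
qed

lemma dirichlet_series_chi_ln_square:
  assumes s: "Re s > 1"
  shows "dirichlet_series (\<lambda>n. \<chi> n * ln (real n) ^ 2) s =
         dirichlet_series (\<lambda>n. \<chi> n * mangoldt n) s * dirichlet_series (\<lambda>n. \<chi> n * ln (real n)) s +
         dirichlet_series (\<lambda>n. \<chi> n * mangoldt n * ln (real n)) s * dirichlet_series \<chi> s"
proof -
  let ?L = "dirichlet_series \<chi>" and ?F = "dirichlet_series (\<lambda>n. \<chi> n * mangoldt n)"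
  have "((\<lambda>w. ?F w * ?L w) has_field_derivative
      ?F s * - dirichlet_series (\<lambda>n. \<chi> n * ln (real n)) s +
      - dirichlet_series (\<lambda>n. \<chi> n * mangoldt n * ln (real n)) s * ?L s) (at s)"
    by (intro DERIV_mult' has_field_derivative_dirichlet_series
        abs_conv_chi abs_conv_chi_mangoldt s)
  then have "(dirichlet_series (\<lambda>n. \<chi> n * ln (real n)) has_field_derivative
      ?F s * - dirichlet_series (\<lambda>n. \<chi> n * ln (real n)) s +
      - dirichlet_series (\<lambda>n. \<chi> n * mangoldt n * ln (real n)) s * ?L s) (at s)"
    by (rule has_field_derivative_transform_within_open[of _ _ _ "{w. Re w > 1}"])
       (use s in \<open>auto simp: open_halfspace_Re_gt dirichlet_series_chi_ln\<close>)
  moreover have "(dirichlet_series (\<lambda>n. \<chi> n * ln (real n)) has_field_derivative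
      - dirichlet_series (\<lambda>n. \<chi> n * ln (real n) * ln (real n)) s) (at s)"
    by (intro has_field_derivative_dirichlet_series abs_conv_mult_ln abs_conv_chi s)
  ultimately have "- dirichlet_series (\<lambda>n. \<chi> n * ln (real n) * ln (real n)) s =
      ?F s * - dirichlet_series (\<lambda>n. \<chi> n * ln (real n)) s +
      - dirichlet_series (\<lambda>n. \<chi> n * mangoldt n * ln (real n)) s * ?L s"
    by (rule DERIV_unique[rotated])
  then show ?thesis
    by (simp add: power2_eq_square mult.assoc algebra_simps)
qed

definition log_series :: "complex \<Rightarrow> complex" where
  "log_series = dirichlet_series (\<lambda>n. \<chi> n * (mangoldt n / ln (real n)))"

lemma abs_conv_log_series: "abs_conv (\<lambda>n. \<chi> n * (mangoldt n / ln (real n)))"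
proof (rule abs_conv_chi_mult, rule abs_conv_mono[OF abs_conv_const[of 1]])
  fix n :: nat
  show "\<bar>mangoldt n / ln (real n)\<bar> \<le> \<bar>1\<bar>"
    using mangoldt_le_ln[of n] mangoldt_nonneg[of n]
    by (cases "n \<le> 1") (auto simp: divide_le_eq le_Suc_eq)
qed

lemma has_field_derivative_log_series:
  assumes "Re s > 1"
  shows "(log_series has_field_derivative - dirichlet_series (\<lambda>n. \<chi> n * mangoldt n) s) (at s)"
proof -
  have "\<chi> n * (mangoldt n / ln (real n)) * ln (real n) = \<chi> n * mangoldt n" for n
    by (cases "n \<le> 1") (auto simp: le_Suc_eq)
  then show ?thesis
    using has_field_derivative_dirichlet_series[OF abs_conv_log_series assms]
    by (simp only: log_series_def)
qed

lemma exp_log_series: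
  assumes "Re s > 1"
  shows "exp (log_series s) = dirichlet_series \<chi> s"
proof -
  define quot where "quot w = dirichlet_series \<chi> w * exp (- log_series w)" for w
  have "(quot has_field_derivative 0) (at w)" if "Re w > 1" for w
    unfolding quot_def[abs_def] using that dirichlet_series_chi_ln[OF that]
    by (auto intro!: derivative_eq_intros has_field_derivative_dirichlet_series abs_conv_chi
        has_field_derivative_log_series)
  then have "\<exists>k. \<forall>w\<in>{w. Re w > 1}. quot w = k"
    by (intro has_field_derivative_zero_constant)
       (auto intro: has_field_derivative_at_within convex_halfspace_Re_gt)
  then obtain k where const: "\<And>w. Re w > 1 \<Longrightarrow> quot w = k"
    by auto
  have "((\<lambda>\<sigma>. quot (Complex \<sigma> 0)) \<longlongrightarrow>
      of_real (\<chi> 1) * exp (- of_real (\<chi> 1 * (mangoldt 1 / ln (real 1))))) at_top"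
    unfolding quot_def log_series_def
    by (intro tendsto_intros dirichlet_series_tendsto_at_infinity
        dirichlet_series_tendsto_at_infinity[OF abs_conv_log_series, of 0] abs_conv_chi)
  then have "((\<lambda>\<sigma>. quot (Complex \<sigma> 0)) \<longlongrightarrow> 1) at_top"
    using chi_one by simp
  moreover have "((\<lambda>\<sigma>. quot (Complex \<sigma> 0)) \<longlongrightarrow> k) at_top"
    by (intro tendsto_eventually eventually_mono[OF eventually_gt_at_top[of 1]] const) simp
  ultimately have "k = 1"
    using tendsto_unique trivial_limit_at_top_linorder by blast
  then show ?thesis
    using const[OF assms] by (simp add: quot_def exp_minus field_simps)
qed

lemma dirichlet_series_chi_nonzero:
  assumes "Re s > 1"
  shows "dirichlet_series \<chi> s \<noteq> 0"
  using exp_log_series[OF assms] by (metis exp_not_eq_zero)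

lemma Re_log_series_sums:
  assumes "\<sigma> > 1"
  shows "(\<lambda>n. mangoldt n / ln (real n) * real n powr (-\<sigma>) * (\<chi> n * cos (t * ln (real n)))) sums
           Re (log_series (Complex \<sigma> t))"
proof -
  have "(\<lambda>n. Re (of_real (\<chi> n * (mangoldt n / ln (real n))) * of_nat n powr (- Complex \<sigma> t))) sums
      Re (log_series (Complex \<sigma> t))"
    unfolding log_series_def
    by (intro sums_Re dirichlet_series_sums abs_conv_log_series) (use assms in simp)
  moreover have "Re (of_real (\<chi> n * (mangoldt n / ln (real n))) * of_nat n powr (- Complex \<sigma> t)) =
      mangoldt n / ln (real n) * real n powr (-\<sigma>) * (\<chi> n * cos (t * ln (real n)))" for n
    by (cases "n = 0") (simp_all add: Re_of_nat_powr)
  ultimately show ?thesis by (simp only:)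
qed

end

abbreviation zeta_series :: "complex \<Rightarrow> complex" where
  "zeta_series \<equiv> dirichlet_series (\<lambda>_. 1)"

interpretation zeta: sign_character "\<lambda>_. 1"
  by unfold_locales auto

text \<open>For \<open>a = 0\<close> the usual trigonometric polynomial becomes \<open>3 + cos (2 \<theta>) \<ge> 0\<close>, so that the zeta
  function can replace the series of the principal character in the 3-4-1 inequality.\<close>

lemma three_four_cos_nonneg:
  fixes a \<theta> :: real
  assumes "\<bar>a\<bar> \<le> 1"
  shows "3 + 4 * (a * cos \<theta>) + cos (2 * \<theta>) \<ge> 0"
proof -
  have "3 + 4 * (a * cos \<theta>) + cos (2 * \<theta>) = 2 * (1 - a\<^sup>2) + 2 * (a + cos \<theta>)\<^sup>2"
    using cos_double_cos[of \<theta>] by (simp add: power2_eq_square algebra_simps)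
  also have "\<dots> \<ge> 0"
    using assms by (simp add: abs_square_le_1)
  finally show ?thesis .
qed

lemma (in sign_character) three_four_one:
  assumes "\<sigma> > 1"
  shows "norm (zeta_series (Complex \<sigma> 0)) ^ 3 * norm (dirichlet_series \<chi> (Complex \<sigma> t)) ^ 4 *
           norm (zeta_series (Complex \<sigma> (2 * t))) \<ge> 1"
proof -
  let ?w = "\<lambda>n. mangoldt n / ln (real n) * real n powr (-\<sigma>)"
  let ?\<theta> = "\<lambda>n. t * ln (real n)"
  define S where "S = 3 * Re (zeta.log_series (Complex \<sigma> 0)) + 4 * Re (log_series (Complex \<sigma> t)) +
      Re (zeta.log_series (Complex \<sigma> (2 * t)))"
  have "(\<lambda>n. 3 * (?w n * (1 * cos (0 * ln (real n)))) + 4 * (?w n * (\<chi> n * cos (?\<theta> n))) +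
      ?w n * (1 * cos (2 * t * ln (real n)))) sums S"
    unfolding S_def
    by (intro sums_add sums_mult zeta.Re_log_series_sums Re_log_series_sums assms)
  also have "(\<lambda>n. 3 * (?w n * (1 * cos (0 * ln (real n)))) + 4 * (?w n * (\<chi> n * cos (?\<theta> n))) +
      ?w n * (1 * cos (2 * t * ln (real n)))) =
      (\<lambda>n. ?w n * (3 + 4 * (\<chi> n * cos (?\<theta> n)) + cos (2 * ?\<theta> n)))"
    by (intro ext) (simp add: distrib_left mult_ac)
  finally have "(\<lambda>n. ?w n * (3 + 4 * (\<chi> n * cos (?\<theta> n)) + cos (2 * ?\<theta> n))) sums S" .
  moreover have "0 \<le> ?w n * (3 + 4 * (\<chi> n * cos (?\<theta> n)) + cos (2 * ?\<theta> n))" for n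
  proof (cases "n = 0")
    case False
    then have "?w n \<ge> 0" using mangoldt_nonneg[of n] by simp
    then show ?thesis
      by (rule mult_nonneg_nonneg[OF _ three_four_cos_nonneg[OF abs_chi_le_1]])
  qed simp
  ultimately have "0 \<le> S"
    by (rule sums_le[OF _ sums_zero, rotated])
  then have "1 \<le> exp S" by simp
  also have "\<dots> = norm (zeta_series (Complex \<sigma> 0)) ^ 3 * norm (dirichlet_series \<chi> (Complex \<sigma> t)) ^ 4 *
           norm (zeta_series (Complex \<sigma> (2 * t)))"
    using exp_of_nat_mult[of 3 "Re (zeta.log_series (Complex \<sigma> 0))"]
      exp_of_nat_mult[of 4 "Re (log_series (Complex \<sigma> t))"] assms
    by (simp add: S_def exp_add exp_log_series[symmetric] zeta.exp_log_series[symmetric])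
  finally show ?thesis .
qed

section \<open>Partial summation\<close>

lemma sum_mult_by_parts:
  fixes a b :: "nat \<Rightarrow> 'a :: comm_ring"
  shows "(\<Sum>n<N. a n * b n) = (\<Sum>n<N. a n) * b N + (\<Sum>n<N. (\<Sum>k<Suc n. a k) * (b n - b (Suc n)))"
  by (induction N) (simp_all add: algebra_simps)

lemma sum_mult_by_parts_ivl:
  fixes a b :: "nat \<Rightarrow> 'a :: comm_ring"
  shows "(\<Sum>n=m..N. a n * b n) =
    (\<Sum>n=m..N. a n) * b (Suc N) + (\<Sum>n=m..N. (\<Sum>k=m..n. a k) * (b n - b (Suc n)))"
proof (induction N)
  case 0
  show ?case by (cases "m = 0") (simp_all add: algebra_simps)
qed (simp add: algebra_simps)

lemma norm_sum_mult_le_variation: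
  fixes a b :: "nat \<Rightarrow> 'a :: real_normed_field"
  assumes "\<And>N. norm (\<Sum>n<N. a n) \<le> D"
  shows "norm (\<Sum>n<N. a n * b n) \<le> D * (norm (b N) + (\<Sum>n<N. norm (b n - b (Suc n))))"
proof -
  have "D \<ge> 0" using assms[of 0] by simp
  have "norm (\<Sum>n<N. a n * b n) \<le> norm ((\<Sum>n<N. a n) * b N) +
      (\<Sum>n<N. norm ((\<Sum>k<Suc n. a k) * (b n - b (Suc n))))"
    unfolding sum_mult_by_parts[of a b]
    by (intro order_trans[OF norm_triangle_ineq] add_mono norm_sum order_refl)
  also have "\<dots> \<le> D * norm (b N) + (\<Sum>n<N. D * norm (b n - b (Suc n)))"
    unfolding norm_mult using \<open>D \<ge> 0\<close> by (intro add_mono sum_mono mult_mono assms) auto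
  finally show ?thesis by (simp add: distrib_left sum_distrib_left)
qed

lemma norm_sum_mult_le_total_variation:
  fixes a b :: "nat \<Rightarrow> 'a :: {real_normed_field, banach}"
  assumes partial_sums: "\<And>N. norm (\<Sum>n<N. a n) \<le> D"
    and b: "b \<longlonglongrightarrow> 0" "summable (\<lambda>n. norm (b n - b (Suc n)))"
  shows "norm (\<Sum>n<N. a n * b n) \<le> D * (\<Sum>n. norm (b n - b (Suc n)))"
proof -
  have "(\<lambda>n. b (n + N)) \<longlonglongrightarrow> 0" using b(1) by (rule LIMSEQ_ignore_initial_segment)
  then have "(\<lambda>n. b (n + N) - b (Suc n + N)) sums (b (0 + N) - 0)" by (rule telescope_sums')
  then have "b N = (\<Sum>n. b (n + N) - b (Suc (n + N)))" by (simp add: sums_iff)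
  also have "norm \<dots> \<le> (\<Sum>n. norm (b (n + N) - b (Suc (n + N))))"
    using summable_ignore_initial_segment[OF b(2), of N] by (rule summable_norm)
  finally have "norm (b N) + (\<Sum>n<N. norm (b n - b (Suc n))) \<le> (\<Sum>n. norm (b n - b (Suc n)))"
    unfolding suminf_split_initial_segment[OF b(2), of N] by simp
  moreover have "D \<ge> 0" using partial_sums[of 0] by simp
  ultimately show ?thesis
    using norm_sum_mult_le_variation[where b = b and N = N, OF partial_sums]
    by (meson mult_left_mono order_trans)
qed

lemma summable_mult_by_parts:
  fixes a b :: "nat \<Rightarrow> 'a :: {real_normed_field, banach}"
  assumes "convergent (\<lambda>N. (\<Sum>n<N. a n) * b N)"
    and "summable (\<lambda>n. (\<Sum>k<Suc n. a k) * (b n - b (Suc n)))"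
  shows "summable (\<lambda>n. a n * b n)"
proof -
  obtain l where "(\<lambda>N. (\<Sum>n<N. a n) * b N) \<longlonglongrightarrow> l"
    using assms(1) by (auto simp: convergent_def)
  then have "(\<lambda>N. (\<Sum>n<N. a n) * b N + (\<Sum>n<N. (\<Sum>k<Suc n. a k) * (b n - b (Suc n)))) \<longlonglongrightarrow>
      l + (\<Sum>n. (\<Sum>k<Suc n. a k) * (b n - b (Suc n)))"
    by (intro tendsto_add summable_LIMSEQ assms(2))
  then show ?thesis
    unfolding sum_mult_by_parts[of a b, symmetric] summable_def sums_def by blast
qed

lemma summable_mult_bounded_variation:
  fixes a b :: "nat \<Rightarrow> 'a :: {real_normed_field, banach}"
  assumes partial_sums: "\<And>N. norm (\<Sum>n<N. a n) \<le> D"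
    and b: "b \<longlonglongrightarrow> 0" "summable (\<lambda>n. norm (b n - b (Suc n)))"
  shows "summable (\<lambda>n. a n * b n)"
proof (rule summable_mult_by_parts)
  show "summable (\<lambda>n. (\<Sum>k<Suc n. a k) * (b n - b (Suc n)))"
  proof (rule summable_comparison_test')
    show "summable (\<lambda>n. D * norm (b n - b (Suc n)))" by (intro summable_mult b)
    show "norm ((\<Sum>k<Suc n. a k) * (b n - b (Suc n))) \<le> D * norm (b n - b (Suc n))" for n
      unfolding norm_mult by (intro mult_right_mono partial_sums) auto
  qed
  have "(\<lambda>N. (\<Sum>n<N. a n) * b N) \<longlonglongrightarrow> 0"
  proof (rule Lim_null_comparison)
    show "(\<lambda>N. D * norm (b N)) \<longlonglongrightarrow> 0" using b(1) by (intro tendsto_mult_right_zero tendsto_norm_zero)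
    show "eventually (\<lambda>N. norm ((\<Sum>n<N. a n) * b N) \<le> D * norm (b N)) sequentially"
      unfolding norm_mult by (intro always_eventually allI mult_right_mono partial_sums) auto
  qed
  then show "convergent (\<lambda>N. (\<Sum>n<N. a n) * b N)" by (rule convergentI)
qed

lemma abs_sum_mult_decseq_le:
  fixes a b :: "nat \<Rightarrow> real"
  assumes "\<And>N. \<bar>\<Sum>n<N. a n\<bar> \<le> D" "decseq b" "b \<longlonglongrightarrow> 0"
  shows "\<bar>\<Sum>n<N. a n * b n\<bar> \<le> D * b 0"
proof -
  have "(\<lambda>n. b n - b (Suc n)) sums (b 0 - 0)" using assms(3) by (rule telescope_sums')
  moreover have "\<bar>b n - b (Suc n)\<bar> = b n - b (Suc n)" for n
    using decseq_SucD[OF assms(2), of n] by simp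
  ultimately show ?thesis
    using norm_sum_mult_le_total_variation[where a = a and D = D and b = b and N = N] assms
    by (simp add: sums_iff)
qed

lemma abs_sum_mult_incseq_le:
  fixes a b :: "nat \<Rightarrow> real"
  assumes partial_sums: "\<And>N. \<bar>\<Sum>n=m..N. a n\<bar> \<le> D"
    and increasing: "\<And>n. m \<le> n \<Longrightarrow> n < N \<Longrightarrow> b n \<le> b (Suc n)" "0 \<le> b m" and "m \<le> N"
  shows "\<bar>\<Sum>n=m..N. a n * b n\<bar> \<le> 2 * D * b N"
proof -
  define c where "c n = b (min n N)" for n
  have c_mono: "c n \<le> c (Suc n)" if "m \<le> n" for n
    using increasing(1)[of n] that by (cases "n < N") (auto simp: c_def min_def)
  have "0 \<le> c n" if "m \<le> n" for n
    using that by (induction n rule: dec_induct)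
       (use increasing(2) \<open>m \<le> N\<close> c_mono in \<open>force simp: c_def\<close>)+
  then have "0 \<le> c (Suc N)" using \<open>m \<le> N\<close> by simp
  have "(\<Sum>n=m..N. a n * b n) = (\<Sum>n=m..N. a n * c n)"
    by (intro sum.cong) (auto simp: c_def)
  also have "\<bar>\<dots>\<bar> \<le> \<bar>(\<Sum>n=m..N. a n) * c (Suc N)\<bar> +
      (\<Sum>n=m..N. \<bar>(\<Sum>k=m..n. a k) * (c n - c (Suc n))\<bar>)"
    unfolding sum_mult_by_parts_ivl[of a c]
    by (intro order_trans[OF abs_triangle_ineq] add_mono sum_abs order_refl)
  also have "\<dots> \<le> D * c (Suc N) + (\<Sum>n=m..N. D * (c (Suc n) - c n))"
    using \<open>0 \<le> c (Suc N)\<close> c_mono unfolding abs_mult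
    by (intro add_mono sum_mono mult_mono partial_sums order_trans[OF abs_ge_zero partial_sums]) auto
  also have "(\<Sum>n=m..N. D * (c (Suc n) - c n)) = D * (c (Suc N) - c m)"
    using \<open>m \<le> N\<close> by (simp add: sum_Suc_diff flip: sum_distrib_left)
  also have "D * c (Suc N) + D * (c (Suc N) - c m) = D * (2 * c (Suc N) - c m)"
    by (simp add: algebra_simps)
  also have "\<dots> \<le> D * (2 * c (Suc N))"
    using increasing(2) \<open>m \<le> N\<close> order_trans[OF abs_ge_zero partial_sums]
    by (intro mult_left_mono) (auto simp: c_def)
  finally show ?thesis by (simp add: c_def)
qed

section \<open>Approximation near the line \<open>Re s = 1\<close>\<close>

definition ln_powr :: "nat \<Rightarrow> complex \<Rightarrow> complex \<Rightarrow> complex" where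
  "ln_powr k s w = Ln w ^ k * w powr (-s)"

fun ln_powr_primitive :: "nat \<Rightarrow> complex \<Rightarrow> complex \<Rightarrow> complex" where
  "ln_powr_primitive 0 s w = - (w powr (1 - s)) / (s - 1)"
| "ln_powr_primitive (Suc k) s w = - (Ln w ^ Suc k * w powr (1 - s)) / (s - 1) +
     of_nat (Suc k) / (s - 1) * ln_powr_primitive k s w"

text \<open>Up to the factor \<open>\<bar>s\<bar>\<close>, this bounds the derivative of \<open>ln_powr k s\<close> on \<open>[n, n + 1]\<close>.\<close>

definition ln_powr_variation :: "nat \<Rightarrow> nat \<Rightarrow> real" where
  "ln_powr_variation k n = (real k + 1) * (1 + ln (real n + 1)) ^ k / real n ^ 2"

lemma ln_powr_variation_nonneg: "ln_powr_variation k n \<ge> 0"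
  by (simp add: ln_powr_variation_def)

lemma ln_powr_variation_mono: "k \<le> l \<Longrightarrow> ln_powr_variation k n \<le> ln_powr_variation l n"
  unfolding ln_powr_variation_def by (intro divide_right_mono mult_mono power_increasing) auto

lemma summable_ln_powr_variation: "summable (ln_powr_variation k)"
proof (rule summable_comparison_test_bigo)
  show "summable (\<lambda>n. norm (real n powr (-3/2)))"
    by (simp add: summable_real_powr_iff)
  show "ln_powr_variation k \<in> O(\<lambda>n. real n powr (-3/2))"
    unfolding ln_powr_variation_def by real_asymp
qed

lemma summable_ln_powr_variation_Suc: "summable (\<lambda>n. ln_powr_variation k (Suc n))"
  by (subst summable_Suc_iff) (rule summable_ln_powr_variation)

lemma suminf_ln_powr_variation_Suc:
  "(\<Sum>n. ln_powr_variation k (Suc n)) = suminf (ln_powr_variation k)"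
  by (subst suminf_split_head[OF summable_ln_powr_variation]) (simp add: ln_powr_variation_def)

lemma suminf_ln_powr_variation_mono:
  "k \<le> l \<Longrightarrow> suminf (ln_powr_variation k) \<le> suminf (ln_powr_variation l)"
  by (intro suminf_le ln_powr_variation_mono summable_ln_powr_variation)

lemma suminf_ln_powr_variation_nonneg: "suminf (ln_powr_variation k) \<ge> 0"
  by (intro suminf_nonneg summable_ln_powr_variation ln_powr_variation_nonneg)

lemma ln_powr_of_nat:
  assumes "n > 0"
  shows "ln_powr k s (of_nat n) = of_real (ln (real n) ^ k) * of_nat n powr (-s)"
  using assms by (simp add: ln_powr_def)

lemma has_field_derivative_ln_powr:
  assumes "w \<notin> \<real>\<^sub>\<le>\<^sub>0"
  shows "(ln_powr k s has_field_derivative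
           (of_nat k * Ln w ^ (k - 1) - s * Ln w ^ k) * w powr (-s - 1)) (at w)"
proof -
  have "w \<noteq> 0" using assms by auto
  have "((\<lambda>w. Ln w ^ k * w powr (-s)) has_field_derivative
      (of_nat k * (inverse w * Ln w ^ (k - Suc 0))) * w powr (-s) +
      (-s * w powr (-s - 1)) * Ln w ^ k) (at w)"
    using assms by (intro DERIV_mult has_field_derivative_powr DERIV_power has_field_derivative_Ln)
  moreover have "w powr (-s) = w powr (-s - 1) * w"
    using \<open>w \<noteq> 0\<close> by (simp add: powr_diff)
  ultimately show ?thesis
    using \<open>w \<noteq> 0\<close> unfolding ln_powr_def[abs_def] by (simp add: field_simps)
qed

lemma has_field_derivative_ln_powr_primitive:
  assumes "w \<notin> \<real>\<^sub>\<le>\<^sub>0" "s \<noteq> 1"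
  shows "(ln_powr_primitive k s has_field_derivative ln_powr k s w) (at w)"
proof (induction k)
  case 0
  have "((\<lambda>w. - (w powr (1 - s)) / (s - 1)) has_field_derivative
      - ((1 - s) * w powr (1 - s - 1)) / (s - 1)) (at w)"
    using assms by (intro DERIV_cdivide DERIV_minus has_field_derivative_powr)
  moreover have "- ((1 - s) * w powr (1 - s - 1)) / (s - 1) = w powr (-s)"
    using assms by (simp add: divide_simps algebra_simps)
  ultimately show ?case
    by (simp add: ln_powr_def)
next
  case (Suc k)
  have "w \<noteq> 0" using assms by auto
  let ?D = "(of_nat (Suc k) * (inverse w * Ln w ^ (Suc k - Suc 0))) * w powr (1 - s) +
      ((1 - s) * w powr (1 - s - 1)) * Ln w ^ Suc k"
  have "((\<lambda>w. Ln w ^ Suc k * w powr (1 - s)) has_field_derivative ?D) (at w)"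
    using assms by (intro DERIV_mult has_field_derivative_powr DERIV_power has_field_derivative_Ln)
  then have "((\<lambda>w. - (Ln w ^ Suc k * w powr (1 - s)) / (s - 1) +
      of_nat (Suc k) / (s - 1) * ln_powr_primitive k s w) has_field_derivative
      - ?D / (s - 1) + of_nat (Suc k) / (s - 1) * ln_powr k s w) (at w)"
    by (intro DERIV_add DERIV_cdivide DERIV_minus DERIV_cmult Suc.IH)
  moreover have "- ?D / (s - 1) + of_nat (Suc k) / (s - 1) * ln_powr k s w = ln_powr (Suc k) s w"
  proof -
    have "w powr (1 - s) = w powr (-s) * w"
      using \<open>w \<noteq> 0\<close> by (simp add: powr_diff powr_minus field_simps)
    then have "?D = of_nat (Suc k) * ln_powr k s w + (1 - s) * ln_powr (Suc k) s w"
      using \<open>w \<noteq> 0\<close> by (simp add: ln_powr_def)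
    then show ?thesis
      using assms(2) by (simp add: divide_simps) (simp add: algebra_simps)
  qed
  ultimately show ?case by simp
qed

lemma ln_powr_primitive_1: "ln_powr_primitive k s 1 = - fact k / (s - 1) ^ Suc k"
  by (induction k) (simp_all add: divide_simps)

lemma tendsto_ln_power_mult_powr_0:
  assumes "Re z < 0"
  shows "(\<lambda>n. Ln (of_nat n) ^ k * of_nat n powr z) \<longlonglongrightarrow> 0"
proof (rule Lim_null_comparison)
  show "(\<lambda>n. ln (real n) ^ k * real n powr Re z) \<longlonglongrightarrow> 0"
    using assms by real_asymp
  show "eventually (\<lambda>n. norm (Ln (of_nat n) ^ k * of_nat n powr z) \<le>
      ln (real n) ^ k * real n powr Re z) sequentially"
    using eventually_ge_at_top[of 1]
    by eventually_elim (simp add: norm_mult norm_power norm_powr_real_powr)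
qed

lemma ln_powr_tendsto_0:
  assumes "Re s > 0"
  shows "(\<lambda>n. ln_powr k s (of_nat (Suc n))) \<longlonglongrightarrow> 0"
  using LIMSEQ_Suc[OF tendsto_ln_power_mult_powr_0[of "-s" k]] assms by (simp add: ln_powr_def)

lemma ln_powr_primitive_tendsto_0:
  assumes "Re s > 1"
  shows "(\<lambda>n. ln_powr_primitive k s (of_nat n)) \<longlonglongrightarrow> 0"
proof (induction k)
  case 0
  have "(\<lambda>n. - (Ln (of_nat n) ^ 0 * of_nat n powr (1 - s)) / (s - 1)) \<longlonglongrightarrow> - 0 / (s - 1)"
    using assms by (intro tendsto_intros tendsto_ln_power_mult_powr_0) auto
  then show ?case by simp
next
  case (Suc k)
  have "(\<lambda>n. - (Ln (of_nat n) ^ Suc k * of_nat n powr (1 - s)) / (s - 1) +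
      of_nat (Suc k) / (s - 1) * ln_powr_primitive k s (of_nat n)) \<longlonglongrightarrow>
      - 0 / (s - 1) + of_nat (Suc k) / (s - 1) * 0"
    using assms by (intro tendsto_intros tendsto_ln_power_mult_powr_0 Suc.IH) auto
  then show ?case by simp
qed

lemma norm_ln_powr_deriv_le:
  assumes "1 \<le> Re s" "n \<ge> 1" "real n \<le> x" "x \<le> real n + 1"
  shows "norm ((of_nat k * Ln (of_real x) ^ (k - 1) - s * Ln (of_real x) ^ k) *
           of_real x powr (-s - 1)) \<le> norm s * ln_powr_variation k n"
proof -
  have x: "x \<ge> 1" using assms by linarith
  define y where "y = 1 + ln (real n + 1)"
  have "ln x \<le> ln (real n + 1)" "ln x \<ge> 0" "ln (real n + 1) \<ge> 0" using assms x by simp_all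
  then have y: "1 \<le> y" "ln x \<le> y" "0 \<le> ln x" unfolding y_def by linarith+
  have ln_power_le: "ln x ^ j \<le> y ^ k" if "j \<le> k" for j
    using y that by (meson power_increasing power_mono order_trans)
  have "norm s \<ge> 1" using assms(1) complex_Re_le_cmod[of s] by linarith
  have "norm (of_nat k * Ln (of_real x) ^ (k - 1) - s * Ln (of_real x) ^ k :: complex) \<le>
      real k * ln x ^ (k - 1) + norm s * ln x ^ k"
    using norm_triangle_ineq4[of "of_nat k * Ln (of_real x) ^ (k - 1)" "s * Ln (of_real x) ^ k"] x y
    by (simp add: Ln_of_real norm_mult norm_power)
  also have "\<dots> \<le> real k * y ^ k + norm s * y ^ k"
    by (intro add_mono mult_left_mono ln_power_le) auto
  also have "\<dots> \<le> (real k * norm s) * y ^ k + norm s * y ^ k"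
    using \<open>norm s \<ge> 1\<close> y mult_left_mono[of 1 "norm s" "real k"]
    by (intro add_mono mult_right_mono) auto
  also have "\<dots> = norm s * ((real k + 1) * y ^ k)"
    by (simp add: algebra_simps)
  finally have linear_factor: "norm (of_nat k * Ln (of_real x) ^ (k - 1) - s * Ln (of_real x) ^ k :: complex)
      \<le> norm s * ((real k + 1) * y ^ k)" .
  have "norm ((of_real x :: complex) powr (-s - 1)) = x powr (- Re s - 1)"
    using x by (simp add: norm_powr_real_powr)
  also have "\<dots> \<le> x powr (- 2)"
    using x assms(1) by (intro powr_mono) auto
  also have "\<dots> \<le> real n powr (- 2)"
    using assms by (intro powr_mono2') auto
  also have "\<dots> = 1 / real n ^ 2"
    using assms by (simp add: powr_minus divide_inverse)
  finally have "norm ((of_real x :: complex) powr (-s - 1)) \<le> 1 / real n ^ 2" .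
  with linear_factor have "norm ((of_nat k * Ln (of_real x) ^ (k - 1) - s * Ln (of_real x) ^ k) *
      of_real x powr (-s - 1)) \<le> norm s * ((real k + 1) * y ^ k) * (1 / real n ^ 2)"
    unfolding norm_mult using y by (intro mult_mono) auto
  then show ?thesis by (simp add: ln_powr_variation_def y_def)
qed

lemma unit_closed_segmentE:
  fixes n :: nat
  assumes "w \<in> closed_segment (of_nat n) (of_nat n + 1 :: complex)"
  obtains x where "w = of_real x" "real n \<le> x" "x \<le> real n + 1"
proof -
  from assms obtain u where "0 \<le> u" "u \<le> 1" "w = (1 - u) *\<^sub>R of_nat n + u *\<^sub>R (of_nat n + 1)"
    by (auto simp: in_segment)
  then show ?thesis
    by (intro that[of "real n + u"]) (auto simp: scaleR_conv_of_real algebra_simps)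
qed

lemma unit_closed_segment_not_nonpos_Reals:
  fixes n :: nat
  assumes "w \<in> closed_segment (of_nat n) (of_nat n + 1 :: complex)" "n \<ge> 1"
  shows "w \<notin> \<real>\<^sub>\<le>\<^sub>0"
proof -
  obtain x where "w = of_real x" "real n \<le> x" "x \<le> real n + 1"
    using assms(1) by (rule unit_closed_segmentE)
  then show ?thesis using assms(2) by (auto simp: complex_nonpos_Reals_iff)
qed

lemma norm_ln_powr_diff_le:
  assumes "1 \<le> Re s" "n \<ge> 1" "w \<in> closed_segment (of_nat n) (of_nat n + 1)"
  shows "norm (ln_powr k s w - ln_powr k s (of_nat n)) \<le> norm s * ln_powr_variation k n"
proof -
  let ?S = "closed_segment (of_nat n) (of_nat n + 1 :: complex)"
  have "norm (ln_powr k s w - ln_powr k s (of_nat n)) \<le>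
      norm s * ln_powr_variation k n * norm (w - of_nat n)"
  proof (rule field_differentiable_bound[where S = ?S])
    fix z assume z: "z \<in> ?S"
    show "(ln_powr k s has_field_derivative
        (of_nat k * Ln z ^ (k - 1) - s * Ln z ^ k) * z powr (-s - 1)) (at z within ?S)"
      using unit_closed_segment_not_nonpos_Reals[OF z assms(2)]
      by (rule has_field_derivative_at_within[OF has_field_derivative_ln_powr])
    obtain x where "z = of_real x" "real n \<le> x" "x \<le> real n + 1"
      using z by (rule unit_closed_segmentE)
    then show "norm ((of_nat k * Ln z ^ (k - 1) - s * Ln z ^ k) * z powr (-s - 1)) \<le>
        norm s * ln_powr_variation k n"
      using norm_ln_powr_deriv_le[OF assms(1,2)] by blast
  qed (use assms in auto)
  also have "\<dots> \<le> norm s * ln_powr_variation k n * 1"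
  proof (intro mult_left_mono mult_nonneg_nonneg ln_powr_variation_nonneg)
    obtain x where x: "w = of_real x" "real n \<le> x" "x \<le> real n + 1"
      using assms(3) by (rule unit_closed_segmentE)
    then have "w - of_nat n = of_real (x - real n)" by simp
    then show "norm (w - of_nat n) \<le> 1" using x by (simp only: norm_of_real)
  qed auto
  finally show ?thesis by simp
qed

lemma norm_ln_powr_primitive_diff_le:
  assumes "1 < Re s" "n \<ge> 1"
  shows "norm (ln_powr_primitive k s (of_nat n + 1) - ln_powr_primitive k s (of_nat n) -
           ln_powr k s (of_nat n)) \<le> norm s * ln_powr_variation k n"
proof -
  let ?S = "closed_segment (of_nat n) (of_nat n + 1 :: complex)"
  let ?g = "\<lambda>w. ln_powr_primitive k s w - ln_powr k s (of_nat n) * w"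
  have "s \<noteq> 1" using assms(1) by auto
  have "norm (?g (of_nat n + 1) - ?g (of_nat n)) \<le>
      norm s * ln_powr_variation k n * norm ((of_nat n + 1) - of_nat n :: complex)"
  proof (rule field_differentiable_bound[where S = ?S])
    show "(?g has_field_derivative ln_powr k s z - ln_powr k s (of_nat n)) (at z within ?S)"
      if "z \<in> ?S" for z
      using unit_closed_segment_not_nonpos_Reals[OF that assms(2)] \<open>s \<noteq> 1\<close>
      by (auto intro!: derivative_eq_intros
          has_field_derivative_at_within[OF has_field_derivative_ln_powr_primitive])
    show "norm (ln_powr k s z - ln_powr k s (of_nat n)) \<le> norm s * ln_powr_variation k n"
      if "z \<in> ?S" for z
      using assms that by (intro norm_ln_powr_diff_le) auto
  qed auto
  then show ?thesis by (simp add: algebra_simps)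
qed

theorem norm_zeta_ln_power_diff_le:
  assumes "Re s > 1"
  shows "norm (dirichlet_series (\<lambda>n. ln (real n) ^ k) s - fact k / (s - 1) ^ Suc k) \<le>
           suminf (ln_powr_variation k) * norm s"
proof -
  define error where "error n = ln_powr k s (of_nat (Suc n)) -
      (ln_powr_primitive k s (of_nat (Suc (Suc n))) - ln_powr_primitive k s (of_nat (Suc n)))" for n
  have "(\<lambda>n. of_real (ln (real (Suc n)) ^ k) * of_nat (Suc n) powr (-s)) sums
      dirichlet_series (\<lambda>n. ln (real n) ^ k) s"
    using dirichlet_series_sums_Suc[OF abs_conv_mult_ln_power[OF abs_conv_const] assms, of 1 k] by simp
  then have "(\<lambda>n. ln_powr k s (of_nat (Suc n))) sums dirichlet_series (\<lambda>n. ln (real n) ^ k) s"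
    by (simp only: ln_powr_of_nat zero_less_Suc)
  moreover have "(\<lambda>n. ln_powr_primitive k s (of_nat (Suc (Suc n))) - ln_powr_primitive k s (of_nat (Suc n)))
      sums (0 - ln_powr_primitive k s (of_nat (Suc 0)))"
    by (intro telescope_sums LIMSEQ_Suc ln_powr_primitive_tendsto_0 assms)
  ultimately have "error sums
      (dirichlet_series (\<lambda>n. ln (real n) ^ k) s - (0 - ln_powr_primitive k s (of_nat (Suc 0))))"
    unfolding error_def by (rule sums_diff)
  then have error_sums: "error sums
      (dirichlet_series (\<lambda>n. ln (real n) ^ k) s - fact k / (s - 1) ^ Suc k)"
    by (simp add: ln_powr_primitive_1)
  have bound: "norm (error n) \<le> norm s * ln_powr_variation k (Suc n)" for n
    using norm_ln_powr_primitive_diff_le[OF assms, of "Suc n" k]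
    by (simp add: error_def norm_minus_commute add_ac diff_diff_eq2)
  have summable: "summable (\<lambda>n. norm s * ln_powr_variation k (Suc n))"
    by (intro summable_mult summable_ln_powr_variation_Suc)
  have "norm (dirichlet_series (\<lambda>n. ln (real n) ^ k) s - fact k / (s - 1) ^ Suc k) \<le>
      (\<Sum>n. norm s * ln_powr_variation k (Suc n))"
    using norm_suminf_le[OF bound summable] error_sums by (simp add: sums_iff)
  also have "\<dots> = norm s * suminf (ln_powr_variation k)"
    by (simp add: suminf_mult[OF summable_ln_powr_variation_Suc] suminf_ln_powr_variation_Suc)
  finally show ?thesis by (simp add: mult.commute)
qed

lemma
  assumes "1 \<le> Re s"
  shows summable_norm_ln_powr_diff:
      "summable (\<lambda>n. norm (ln_powr k s (of_nat (Suc n)) - ln_powr k s (of_nat (Suc (Suc n)))))"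
    and suminf_norm_ln_powr_diff_le:
      "(\<Sum>n. norm (ln_powr k s (of_nat (Suc n)) - ln_powr k s (of_nat (Suc (Suc n))))) \<le>
         suminf (ln_powr_variation k) * norm s"
proof -
  have variation_le: "norm (ln_powr k s (of_nat (Suc n)) - ln_powr k s (of_nat (Suc (Suc n)))) \<le>
      ln_powr_variation k (Suc n) * norm s" for n
    using norm_ln_powr_diff_le[OF assms, of "Suc n" "of_nat (Suc n) + 1" k]
    by (simp add: norm_minus_commute add_ac mult.commute)
  have summable_bound: "summable (\<lambda>n. ln_powr_variation k (Suc n) * norm s)"
    by (intro summable_mult2 summable_ln_powr_variation_Suc)
  then show summable: "summable (\<lambda>n. norm (ln_powr k s (of_nat (Suc n)) - ln_powr k s (of_nat (Suc (Suc n)))))"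
    by (rule summable_comparison_test') (use variation_le in simp)
  have "(\<Sum>n. norm (ln_powr k s (of_nat (Suc n)) - ln_powr k s (of_nat (Suc (Suc n))))) \<le>
      (\<Sum>n. ln_powr_variation k (Suc n) * norm s)"
    by (intro suminf_le variation_le summable summable_bound)
  then show "(\<Sum>n. norm (ln_powr k s (of_nat (Suc n)) - ln_powr k s (of_nat (Suc (Suc n))))) \<le>
         suminf (ln_powr_variation k) * norm s"
    by (simp add: suminf_mult2[OF summable_ln_powr_variation_Suc, symmetric] suminf_ln_powr_variation_Suc)
qed

text \<open>With bounded partial sums the series converges on the closed half-plane \<open>Re s \<ge> 1\<close>, which gives
  meaning to its value at 1.\<close>

locale bounded_partial_sums =
  fixes c :: "nat \<Rightarrow> real" and D :: real
  assumes abs_partial_sum_le: "\<And>N. \<bar>\<Sum>n<N. c (Suc n)\<bar> \<le> D"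
begin

lemma bound_nonneg: "D \<ge> 0"
  using abs_partial_sum_le[of 0] by simp

lemma norm_partial_sum_le: "norm (\<Sum>n<N. complex_of_real (c (Suc n))) \<le> D"
  using abs_partial_sum_le[of N] by (simp flip: of_real_sum)

lemma norm_sum_ln_powr_le:
  assumes "1 \<le> Re s"
  shows "norm (\<Sum>n<N. of_real (c (Suc n)) * ln_powr k s (of_nat (Suc n))) \<le>
           D * suminf (ln_powr_variation k) * norm s"
proof -
  have "norm (\<Sum>n<N. of_real (c (Suc n)) * ln_powr k s (of_nat (Suc n))) \<le>
      D * (\<Sum>n. norm (ln_powr k s (of_nat (Suc n)) - ln_powr k s (of_nat (Suc (Suc n)))))"
    using assms
    by (intro norm_sum_mult_le_total_variation norm_partial_sum_le ln_powr_tendsto_0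
        summable_norm_ln_powr_diff) auto
  also have "\<dots> \<le> D * (suminf (ln_powr_variation k) * norm s)"
    by (intro mult_left_mono suminf_norm_ln_powr_diff_le assms bound_nonneg)
  finally show ?thesis by (simp add: mult.assoc)
qed

lemma dirichlet_series_ln_power_sums:
  assumes "1 \<le> Re s"
  shows "(\<lambda>n. of_real (c (Suc n)) * ln_powr k s (of_nat (Suc n))) sums
           dirichlet_series (\<lambda>n. c n * ln (real n) ^ k) s"
proof -
  let ?f = "\<lambda>n. of_real (c n * ln (real n) ^ k) * of_nat n powr (-s) :: complex"
  have term_eq: "of_real (c (Suc n)) * ln_powr k s (of_nat (Suc n)) = ?f (Suc n)" for n
    by (simp only: ln_powr_of_nat zero_less_Suc of_real_mult mult.assoc)
  have "summable (\<lambda>n. of_real (c (Suc n)) * ln_powr k s (of_nat (Suc n)))"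
    using assms
    by (intro summable_mult_bounded_variation[OF norm_partial_sum_le] ln_powr_tendsto_0
        summable_norm_ln_powr_diff) auto
  then have "summable ?f"
    unfolding term_eq by (subst (asm) summable_Suc_iff)
  then have "?f sums dirichlet_series (\<lambda>n. c n * ln (real n) ^ k) s"
    unfolding dirichlet_series_def by (rule summable_sums)
  then show ?thesis
    unfolding term_eq by (subst sums_Suc_iff) simp
qed

lemma norm_dirichlet_series_ln_power_le:
  assumes "1 \<le> Re s"
  shows "norm (dirichlet_series (\<lambda>n. c n * ln (real n) ^ k) s) \<le>
           D * suminf (ln_powr_variation k) * norm s"
proof (rule LIMSEQ_le_const2)
  show "(\<lambda>N. norm (\<Sum>n<N. of_real (c (Suc n)) * ln_powr k s (of_nat (Suc n)))) \<longlonglongrightarrow>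
      norm (dirichlet_series (\<lambda>n. c n * ln (real n) ^ k) s)"
    using dirichlet_series_ln_power_sums[OF assms] unfolding sums_def by (rule tendsto_norm)
qed (use norm_sum_ln_powr_le[OF assms] in auto)

lemma dirichlet_series_lipschitz:
  assumes s: "1 \<le> Re s" "norm s \<le> R" and w: "1 \<le> Re w" "norm w \<le> R"
  shows "norm (dirichlet_series c s - dirichlet_series c w) \<le>
           D * suminf (ln_powr_variation 1) * R * norm (s - w)"
proof (rule LIMSEQ_le_const2)
  let ?P = "\<lambda>N z. \<Sum>n<N. of_real (c (Suc n)) * of_nat (Suc n) powr (-z) :: complex"
  have "?P N z = (\<Sum>n<N. of_real (c (Suc n)) * ln_powr 0 z (of_nat (Suc n)))" for N z
    by (simp add: ln_powr_def del: of_nat_Suc)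
  then have "(\<lambda>N. ?P N z) \<longlonglongrightarrow> dirichlet_series c z" if "1 \<le> Re z" for z
    using dirichlet_series_ln_power_sums[OF that, of 0] by (simp add: sums_def)
  then show "(\<lambda>N. norm (?P N s - ?P N w)) \<longlonglongrightarrow> norm (dirichlet_series c s - dirichlet_series c w)"
    using s w by (intro tendsto_intros)
  let ?H = "{z. 1 \<le> Re z} \<inter> cball 0 R"
  have "norm (?P N s - ?P N w) \<le> D * suminf (ln_powr_variation 1) * R * norm (s - w)" for N
  proof (rule field_differentiable_bound[where S = ?H])
    show "convex ?H" by (intro convex_Int convex_halfspace_Re_ge convex_cball)
    fix z assume z: "z \<in> ?H"
    show "(?P N has_field_derivative
        (\<Sum>n<N. - (of_real (c (Suc n) * ln (real (Suc n))) * of_nat (Suc n) powr (-z)))) (at z within ?H)"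
      by (intro DERIV_sum has_field_derivative_at_within[OF has_field_derivative_dirichlet_term])
    have "norm (\<Sum>n<N. - (of_real (c (Suc n) * ln (real (Suc n))) * of_nat (Suc n) powr (-z)) :: complex) =
        norm (\<Sum>n<N. of_real (c (Suc n)) * ln_powr 1 z (of_nat (Suc n)))"
      by (simp add: ln_powr_of_nat sum_negf mult.assoc del: of_nat_Suc)
    also have "\<dots> \<le> D * suminf (ln_powr_variation 1) * norm z"
      using z by (intro norm_sum_ln_powr_le) auto
    also have "\<dots> \<le> D * suminf (ln_powr_variation 1) * R"
      using z by (intro mult_left_mono mult_nonneg_nonneg bound_nonneg
          suminf_ln_powr_variation_nonneg) auto
    finally show "norm (\<Sum>n<N. - (of_real (c (Suc n) * ln (real (Suc n))) *
        of_nat (Suc n) powr (-z)) :: complex) \<le> D * suminf (ln_powr_variation 1) * R" .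
  qed (use s w in auto)
  then show "\<exists>N. \<forall>n\<ge>N. norm (?P n s - ?P n w) \<le> D * suminf (ln_powr_variation 1) * R * norm (s - w)"
    by blast
qed

end

section \<open>Polynomial growth of the logarithmic derivative\<close>

definition polynomial_growth :: "(nat \<Rightarrow> real) \<Rightarrow> nat \<Rightarrow> bool" where
  "polynomial_growth a m \<longleftrightarrow> (\<exists>C r. r > 0 \<and>
     (\<forall>s. 1 < Re s \<longrightarrow> Re s \<le> 1 + r \<longrightarrow> norm (dirichlet_series a s) \<le> C * (1 + \<bar>Im s\<bar>) ^ m))"

definition near_strip :: "real \<Rightarrow> complex set" where
  "near_strip r = {s. 1 < Re s \<and> Re s \<le> 1 + r \<and> \<bar>Im s\<bar> \<le> r}"

definition far_strip :: "real \<Rightarrow> complex set" where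
  "far_strip r = {s. 1 < Re s \<and> Re s \<le> 2 \<and> r \<le> \<bar>Im s\<bar>}"

lemma near_stripD:
  assumes "s \<in> near_strip r" "r \<le> 1"
  shows "1 < Re s" "norm s \<le> 3" "norm (s - 1) \<le> 2 * r"
  using assms cmod_le[of s] cmod_le[of "s - 1"] by (auto simp: near_strip_def)

lemma polynomial_growthE:
  assumes "polynomial_growth a m"
  obtains C r where "C \<ge> 0" "0 < r" "r \<le> 1"
    "\<And>s. 1 < Re s \<Longrightarrow> Re s \<le> 1 + r \<Longrightarrow> norm (dirichlet_series a s) \<le> C * (1 + \<bar>Im s\<bar>) ^ m"
proof -
  obtain C r where r: "r > 0"
    and bound: "\<And>s. 1 < Re s \<Longrightarrow> Re s \<le> 1 + r \<Longrightarrow> norm (dirichlet_series a s) \<le> C * (1 + \<bar>Im s\<bar>) ^ m"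
    using assms unfolding polynomial_growth_def by blast
  have "norm (dirichlet_series a s) \<le> max C 0 * (1 + \<bar>Im s\<bar>) ^ m"
    if "1 < Re s" "Re s \<le> 1 + min r 1" for s
  proof -
    have "norm (dirichlet_series a s) \<le> C * (1 + \<bar>Im s\<bar>) ^ m" using that by (intro bound) auto
    also have "\<dots> \<le> max C 0 * (1 + \<bar>Im s\<bar>) ^ m" by (intro mult_right_mono) auto
    finally show ?thesis .
  qed
  then show ?thesis using that[of "max C 0" "min r 1"] r by auto
qed

lemma polynomial_growth_add:
  assumes a: "abs_conv a" "polynomial_growth a m" and b: "abs_conv b" "polynomial_growth b m"
  shows "polynomial_growth (\<lambda>n. a n + b n) m"
proof -
  obtain C r where r: "0 < r"
    and a_le: "\<And>s. 1 < Re s \<Longrightarrow> Re s \<le> 1 + r \<Longrightarrow> norm (dirichlet_series a s) \<le> C * (1 + \<bar>Im s\<bar>) ^ m"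
    using a(2) unfolding polynomial_growth_def by blast
  obtain C' r' where r': "0 < r'"
    and b_le: "\<And>s. 1 < Re s \<Longrightarrow> Re s \<le> 1 + r' \<Longrightarrow> norm (dirichlet_series b s) \<le> C' * (1 + \<bar>Im s\<bar>) ^ m"
    using b(2) unfolding polynomial_growth_def by blast
  have "norm (dirichlet_series (\<lambda>n. a n + b n) s) \<le> (C + C') * (1 + \<bar>Im s\<bar>) ^ m"
    if s: "1 < Re s" "Re s \<le> 1 + min r r'" for s
  proof -
    have "norm (dirichlet_series (\<lambda>n. a n + b n) s) \<le>
        norm (dirichlet_series a s) + norm (dirichlet_series b s)"
      unfolding dirichlet_series_add[OF a(1) b(1) s(1)] by (rule norm_triangle_ineq)
    also have "\<dots> \<le> C * (1 + \<bar>Im s\<bar>) ^ m + C' * (1 + \<bar>Im s\<bar>) ^ m"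
      using s by (intro add_mono a_le b_le) auto
    finally show ?thesis by (simp add: distrib_right)
  qed
  then show ?thesis
    unfolding polynomial_growth_def using r r'
    by (intro exI[of _ "C + C'"] exI[of _ "min r r'"]) auto
qed

lemma polynomial_growth_near_far:
  assumes r: "0 < r" "r \<le> 1"
    and near: "\<forall>s\<in>near_strip r. norm (dirichlet_series a s) \<le> C"
    and far: "\<forall>s\<in>far_strip r. norm (dirichlet_series a s) \<le> C' * (1 + \<bar>Im s\<bar>) ^ m"
  shows "polynomial_growth a m"
proof -
  have "norm (dirichlet_series a s) \<le> max C C' * (1 + \<bar>Im s\<bar>) ^ m"
    if s: "1 < Re s" "Re s \<le> 1 + r" for s
  proof (cases "r \<le> \<bar>Im s\<bar>")
    case True
    then have "norm (dirichlet_series a s) \<le> C' * (1 + \<bar>Im s\<bar>) ^ m"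
      using s r far by (auto simp: far_strip_def)
    also have "\<dots> \<le> max C C' * (1 + \<bar>Im s\<bar>) ^ m" by (intro mult_right_mono) auto
    finally show ?thesis .
  next
    case False
    then have "norm (dirichlet_series a s) \<le> C" using s near by (auto simp: near_strip_def)
    moreover from this have "0 \<le> C" using norm_ge_zero order_trans by blast
    ultimately have "norm (dirichlet_series a s) * 1 \<le> max C C' * (1 + \<bar>Im s\<bar>) ^ m"
      by (intro mult_mono one_le_power) auto
    then show ?thesis by simp
  qed
  then show ?thesis
    unfolding polynomial_growth_def using r(1) by blast
qed

lemma polynomial_growth_diff_near_far:
  assumes "abs_conv a" "abs_conv b" and r: "0 < r" "r \<le> 1"
    and near: "\<forall>s\<in>near_strip r. norm (dirichlet_series a s - dirichlet_series b s) \<le> C"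
    and far: "\<forall>s\<in>far_strip r. norm (dirichlet_series a s) \<le> A * (1 + \<bar>Im s\<bar>) ^ m"
      "\<forall>s\<in>far_strip r. norm (dirichlet_series b s) \<le> B * (1 + \<bar>Im s\<bar>) ^ m"
  shows "polynomial_growth (\<lambda>n. a n - b n) m"
proof (rule polynomial_growth_near_far[OF r])
  show "\<forall>s\<in>near_strip r. norm (dirichlet_series (\<lambda>n. a n - b n) s) \<le> C"
    using near near_stripD(1)[OF _ r(2)] by (simp add: dirichlet_series_diff assms)
  show "\<forall>s\<in>far_strip r. norm (dirichlet_series (\<lambda>n. a n - b n) s) \<le> (A + B) * (1 + \<bar>Im s\<bar>) ^ m"
  proof
    fix s assume s: "s \<in> far_strip r"
    then have "norm (dirichlet_series a s - dirichlet_series b s) \<le>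
        A * (1 + \<bar>Im s\<bar>) ^ m + B * (1 + \<bar>Im s\<bar>) ^ m"
      using far by (intro order_trans[OF norm_triangle_ineq4] add_mono) auto
    with s show "norm (dirichlet_series (\<lambda>n. a n - b n) s) \<le> (A + B) * (1 + \<bar>Im s\<bar>) ^ m"
      by (simp add: dirichlet_series_diff assms far_strip_def distrib_right)
  qed
qed

lemma norm_le_height:
  assumes "0 \<le> Re s" "Re s \<le> 2"
  shows "norm s \<le> 2 * (1 + \<bar>Im s\<bar>)"
  using cmod_le[of s] assms by simp

lemma norm_quotients_le:
  fixes f0 f1 f2 :: complex
  assumes "0 < m" "m \<le> norm f0" "norm f1 \<le> M" "norm f2 \<le> M"
  shows "norm (f1 / f0) \<le> M / m" "norm (f2 / f0 - (f1 / f0) ^ 2) \<le> M / m + (M / m) ^ 2"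
proof -
  have quotient: "norm (f / f0) \<le> M / m" if "norm f \<le> M" for f
  proof -
    have "0 \<le> M" using that norm_ge_zero order_trans by blast
    then show ?thesis unfolding norm_divide using that assms(1,2) by (intro frac_le)
  qed
  show "norm (f1 / f0) \<le> M / m" by (rule quotient) fact
  then have "norm (f2 / f0) + norm ((f1 / f0) ^ 2) \<le> M / m + (M / m) ^ 2"
    unfolding norm_power[of "f1 / f0"] by (intro add_mono power_mono quotient[OF assms(4)]) auto
  then show "norm (f2 / f0 - (f1 / f0) ^ 2) \<le> M / m + (M / m) ^ 2"
    using norm_triangle_ineq4 order_trans by blast
qed

lemma (in sign_character)
  assumes "Re s > 1"
  shows dirichlet_series_chi_mangoldt_eq: "dirichlet_series (\<lambda>n. \<chi> n * mangoldt n) s =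
      dirichlet_series (\<lambda>n. \<chi> n * ln (real n)) s / dirichlet_series \<chi> s" (is "?F = ?f1 / ?f0")
    and dirichlet_series_chi_mangoldt_ln_eq:
      "dirichlet_series (\<lambda>n. \<chi> n * mangoldt n * ln (real n)) s =
       dirichlet_series (\<lambda>n. \<chi> n * ln (real n) ^ 2) s / dirichlet_series \<chi> s -
       (dirichlet_series (\<lambda>n. \<chi> n * ln (real n)) s / dirichlet_series \<chi> s) ^ 2"
proof -
  show quotient: "?F = ?f1 / ?f0"
    using dirichlet_series_chi_ln[OF assms] dirichlet_series_chi_nonzero[OF assms] by simp
  show "dirichlet_series (\<lambda>n. \<chi> n * mangoldt n * ln (real n)) s =
       dirichlet_series (\<lambda>n. \<chi> n * ln (real n) ^ 2) s / ?f0 - (?f1 / ?f0) ^ 2"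
    unfolding dirichlet_series_chi_ln_square[OF assms] quotient
    using dirichlet_series_chi_nonzero[OF assms] by (simp add: field_simps power2_eq_square)
qed

text \<open>The series has a simple pole with residue \<open>\<kappa>\<close> at 1; in the two instances \<open>\<kappa>\<close> is 1 and 0.\<close>

locale character_with_residue = sign_character +
  fixes \<kappa> K :: real
  assumes residue: "0 \<le> \<kappa>" "\<kappa> \<le> 1"
    and approx: "\<And>k s. Re s > 1 \<Longrightarrow> k \<le> 2 \<Longrightarrow>
       norm (dirichlet_series (\<lambda>n. \<chi> n * ln (real n) ^ k) s - of_real \<kappa> * fact k / (s - 1) ^ Suc k)
         \<le> K * norm s"
begin

lemma K_nonneg: "K \<ge> 0"
proof -
  have "0 \<le> K * norm (2 :: complex)"
    by (rule order_trans[OF norm_ge_zero approx[of 2 0]]) auto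
  then show ?thesis by simp
qed

lemma norm_pole_far_le:
  assumes "0 < r" "r \<le> 1" "r \<le> \<bar>Im s\<bar>" "k \<le> 2"
  shows "norm (of_real \<kappa> * fact k / (s - 1) ^ Suc k) \<le> 2 / r ^ 3"
proof -
  have "r \<le> norm (s - 1)"
    using assms(3) abs_Im_le_cmod[of "s - 1"] by simp
  moreover have "fact k \<le> (2 :: real)"
    using assms(4) by (cases k rule: nat.exhaust) (auto simp: le_Suc_eq numeral_2_eq_2)
  ultimately have "\<kappa> * fact k / norm (s - 1) ^ Suc k \<le> 1 * 2 / r ^ Suc k"
    using residue assms by (intro frac_le mult_mono power_mono) auto
  also have "\<dots> \<le> 2 / r ^ 3"
    using assms power_decreasing[of "Suc k" 3 r] by (intro frac_le) (auto simp del: power_Suc)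
  finally show ?thesis
    using residue by (simp add: norm_mult norm_divide norm_power del: power_Suc)
qed

lemma norm_series_far_le:
  assumes r: "0 < r" "r \<le> 1" and "s \<in> far_strip r" and k: "k \<le> 2"
  shows "norm (dirichlet_series (\<lambda>n. \<chi> n * ln (real n) ^ k) s) \<le> (2 / r ^ 3 + 2 * K) * (1 + \<bar>Im s\<bar>)"
proof -
  have s: "1 < Re s" "Re s \<le> 2" "r \<le> \<bar>Im s\<bar>"
    using assms(3) by (auto simp: far_strip_def)
  let ?pole = "of_real \<kappa> * fact k / (s - 1) ^ Suc k"
  have "norm (dirichlet_series (\<lambda>n. \<chi> n * ln (real n) ^ k) s) \<le>
      norm ?pole + norm (dirichlet_series (\<lambda>n. \<chi> n * ln (real n) ^ k) s - ?pole)"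
    by (rule norm_triangle_sub)
  also have "\<dots> \<le> 2 / r ^ 3 * (1 + \<bar>Im s\<bar>) + K * (2 * (1 + \<bar>Im s\<bar>))"
  proof (rule add_mono)
    have "norm ?pole \<le> 2 / r ^ 3 * 1" using norm_pole_far_le[OF r s(3) k] by simp
    also have "\<dots> \<le> 2 / r ^ 3 * (1 + \<bar>Im s\<bar>)" using r by (intro mult_left_mono) auto
    finally show "norm ?pole \<le> 2 / r ^ 3 * (1 + \<bar>Im s\<bar>)" .
    have "norm (dirichlet_series (\<lambda>n. \<chi> n * ln (real n) ^ k) s - ?pole) \<le> K * norm s"
      using approx s k by simp
    also have "\<dots> \<le> K * (2 * (1 + \<bar>Im s\<bar>))"
      using s K_nonneg by (intro mult_left_mono norm_le_height) auto
    finally show "norm (dirichlet_series (\<lambda>n. \<chi> n * ln (real n) ^ k) s - ?pole) \<le>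
        K * (2 * (1 + \<bar>Im s\<bar>))" .
  qed
  finally show ?thesis by (simp add: algebra_simps)
qed

end

interpretation zeta: character_with_residue "\<lambda>_. 1" 1 "suminf (ln_powr_variation 2)"
proof
  fix k :: nat and s :: complex assume "Re s > 1" "k \<le> 2"
  have "norm (dirichlet_series (\<lambda>n. ln (real n) ^ k) s - fact k / (s - 1) ^ Suc k) \<le>
      suminf (ln_powr_variation k) * norm s"
    by (rule norm_zeta_ln_power_diff_le) fact
  also have "\<dots> \<le> suminf (ln_powr_variation 2) * norm s"
    using \<open>k \<le> 2\<close> by (intro mult_right_mono suminf_ln_powr_variation_mono) auto
  finally show "norm (dirichlet_series (\<lambda>n. 1 * ln (real n) ^ k) s -
      of_real 1 * fact k / (s - 1) ^ Suc k) \<le> suminf (ln_powr_variation 2) * norm s"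
    by simp
qed auto

lemma norm_zeta_series_real_le:
  assumes "1 < \<sigma>" "\<sigma> \<le> 2"
  shows "norm (zeta_series (Complex \<sigma> 0)) \<le> (1 + 2 * suminf (ln_powr_variation 2)) / (\<sigma> - 1)"
proof -
  let ?K = "suminf (ln_powr_variation 2)"
  have "Complex \<sigma> 0 = of_real \<sigma>" "Complex \<sigma> 0 - 1 = of_real (\<sigma> - 1)"
    by (simp_all add: complex_eq_iff)
  then have norms: "norm (Complex \<sigma> 0) \<le> 2" "norm (1 / (Complex \<sigma> 0 - 1)) = 1 / (\<sigma> - 1)"
    using assms by (simp_all only: norm_divide norm_of_real norm_one)
  have "norm (zeta_series (Complex \<sigma> 0)) \<le> norm (1 / (Complex \<sigma> 0 - 1)) +
      norm (zeta_series (Complex \<sigma> 0) - 1 / (Complex \<sigma> 0 - 1))"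
    by (rule norm_triangle_sub)
  also have "\<dots> \<le> 1 / (\<sigma> - 1) + ?K * norm (Complex \<sigma> 0)"
    using zeta.approx[of "Complex \<sigma> 0" 0] assms(1) norms(2) by simp
  also have "\<dots> \<le> 1 / (\<sigma> - 1) + ?K * 2"
    using norms(1) zeta.K_nonneg by (intro add_left_mono mult_left_mono)
  also have "\<dots> \<le> 1 / (\<sigma> - 1) + ?K * 2 / (\<sigma> - 1)"
    using assms zeta.K_nonneg by (intro add_left_mono) (simp add: le_divide_eq mult_left_le)
  finally show ?thesis by (simp add: add_divide_distrib mult.commute)
qed

lemma (in sign_character) fourth_power_lower_bound:
  assumes r: "0 < r" "r \<le> 1"
  obtains B where "B > 0"
    "\<forall>s\<in>far_strip r. (Re s - 1) ^ 3 / (B * (1 + \<bar>Im s\<bar>)) \<le> norm (dirichlet_series \<chi> s) ^ 4"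
proof -
  let ?K = "suminf (ln_powr_variation 2)"
  define P where "P = (1 + 2 * ?K) ^ 3"
  define Q where "Q = 2 * (2 / r ^ 3 + 2 * ?K)"
  have "P > 0" "Q > 0"
    using zeta.K_nonneg r by (auto simp: P_def Q_def intro!: zero_less_power add_pos_nonneg)
  have "(Re s - 1) ^ 3 / (P * Q * (1 + \<bar>Im s\<bar>)) \<le> norm (dirichlet_series \<chi> s) ^ 4"
    if "s \<in> far_strip r" for s
  proof -
    have s: "1 < Re s" "Re s \<le> 2" "r \<le> \<bar>Im s\<bar>"
      using that by (auto simp: far_strip_def)
    let ?\<sigma> = "Re s" and ?t = "Im s"
    have "norm (zeta_series (Complex ?\<sigma> (2 * ?t))) \<le> (2 / r ^ 3 + 2 * ?K) * (1 + \<bar>2 * ?t\<bar>)"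
      using zeta.norm_series_far_le[OF r, of "Complex ?\<sigma> (2 * ?t)" 0] s by (simp add: far_strip_def)
    also have "\<dots> \<le> (2 / r ^ 3 + 2 * ?K) * (2 * (1 + \<bar>?t\<bar>))"
      using r zeta.K_nonneg by (intro mult_left_mono) auto
    finally have double_height: "norm (zeta_series (Complex ?\<sigma> (2 * ?t))) \<le> Q * (1 + \<bar>?t\<bar>)"
      by (simp only: Q_def mult_ac)
    have "1 \<le> norm (zeta_series (Complex ?\<sigma> 0)) ^ 3 * norm (dirichlet_series \<chi> s) ^ 4 *
        norm (zeta_series (Complex ?\<sigma> (2 * ?t)))"
      using three_four_one[OF s(1), of ?t] by simp
    also have "\<dots> \<le> ((1 + 2 * ?K) / (?\<sigma> - 1)) ^ 3 * norm (dirichlet_series \<chi> s) ^ 4 * (Q * (1 + \<bar>?t\<bar>))"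
      using s zeta.K_nonneg
      by (intro mult_mono power_mono double_height norm_zeta_series_real_le) auto
    also have "\<dots> = norm (dirichlet_series \<chi> s) ^ 4 * (P * Q * (1 + \<bar>?t\<bar>)) / (?\<sigma> - 1) ^ 3"
      by (simp add: P_def power_divide mult_ac)
    finally show ?thesis
      using s \<open>P > 0\<close> \<open>Q > 0\<close> by (simp add: divide_simps split: if_splits)
  qed
  with \<open>P > 0\<close> \<open>Q > 0\<close> show ?thesis by (intro that[of "P * Q"]) auto
qed

lemma fourth_root_lower_bound:
  fixes A B V \<delta> x y :: real
  assumes "0 < B" "1 \<le> V" "0 < \<delta>" "16 * A ^ 4 * B * (\<delta> * V ^ 5) \<le> 1"
    and "\<delta> \<le> x" "x ^ 3 / (B * V) \<le> y ^ 4" "0 \<le> y"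
  shows "2 * (A * \<delta> * V) \<le> y"
proof (rule power_le_imp_le_base)
  have "(2 * (A * \<delta> * V)) ^ 4 = 16 * A ^ 4 * B * (\<delta> * V ^ 5) * (\<delta> ^ 3 / (B * V))"
    using assms by (simp add: field_simps eval_nat_numeral)
  also have "\<dots> \<le> 1 * (\<delta> ^ 3 / (B * V))"
    using assms by (intro mult_right_mono) auto
  also have "\<dots> \<le> x ^ 3 / (B * V)"
    using assms by (auto intro!: divide_right_mono power_mono)
  also have "\<dots> \<le> y ^ 4" by fact
  finally show "(2 * (A * \<delta> * V)) ^ Suc 3 \<le> y ^ Suc 3"
    by (simp add: eval_nat_numeral)
qed fact

context character_with_residue
begin

lemma norm_series_horizontal_diff_le:
  assumes r: "0 < r" "r \<le> 1" and s: "s \<in> far_strip r"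
    and w: "Re s \<le> Re w" "Re w \<le> 2" "Im w = Im s"
  shows "norm (dirichlet_series \<chi> w - dirichlet_series \<chi> s) \<le>
           (2 / r ^ 3 + 2 * K) * (1 + \<bar>Im s\<bar>) * (Re w - Re s)"
proof -
  have "norm (dirichlet_series \<chi> w - dirichlet_series \<chi> s) \<le>
      (2 / r ^ 3 + 2 * K) * (1 + \<bar>Im s\<bar>) * norm (w - s)"
  proof (rule field_differentiable_bound[where S = "closed_segment s w"])
    fix z assume "z \<in> closed_segment s w"
    then have z: "z \<in> far_strip r" "Re z > 1" "Im z = Im s"
      using s w by (auto simp: far_strip_def closed_segment_same_Im closed_segment_eq_real_ivl)
    show "(dirichlet_series \<chi> has_field_derivative - dirichlet_series (\<lambda>n. \<chi> n * ln (real n)) z)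
        (at z within closed_segment s w)"
      by (rule has_field_derivative_at_within[OF has_field_derivative_dirichlet_series[OF abs_conv_chi z(2)]])
    show "norm (- dirichlet_series (\<lambda>n. \<chi> n * ln (real n)) z) \<le> (2 / r ^ 3 + 2 * K) * (1 + \<bar>Im s\<bar>)"
      using norm_series_far_le[OF r z(1), of 1] z(3) by simp
  qed auto
  moreover have "w - s = of_real (Re w - Re s)"
    using w by (simp add: complex_eq_iff)
  ultimately show ?thesis
    using w(1) by (simp only: norm_of_real)
qed

text \<open>At distance at least \<open>\<delta> = e / (1 + \<bar>t\<bar>) ^ 5\<close> from the line \<open>Re s = 1\<close> the 3-4-1 inequality
  gives a lower bound of twice the amount by which the series can change over a length of \<open>\<delta>\<close>.\<close>

lemma series_lower_bound:
  assumes r: "0 < r" "r \<le> 1"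
  obtains m where "m > 0" "\<forall>s\<in>far_strip r. m / (1 + \<bar>Im s\<bar>) ^ 4 \<le> norm (dirichlet_series \<chi> s)"
proof -
  obtain B where "B > 0" and fourth_power:
      "\<forall>s\<in>far_strip r. (Re s - 1) ^ 3 / (B * (1 + \<bar>Im s\<bar>)) \<le> norm (dirichlet_series \<chi> s) ^ 4"
    by (rule fourth_power_lower_bound[OF r])
  define A where "A = 2 / r ^ 3 + 2 * K"
  have "A > 0" using r K_nonneg by (auto simp: A_def intro!: add_pos_nonneg)
  define e where "e = min 1 (1 / (16 * A ^ 4 * B))"
  have e: "0 < e" "e \<le> 1" "16 * A ^ 4 * B * e \<le> 1"
    using \<open>A > 0\<close> \<open>B > 0\<close> by (auto simp: e_def min_def field_simps)
  have "A * e / (1 + \<bar>Im s\<bar>) ^ 4 \<le> norm (dirichlet_series \<chi> s)"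
    if s: "s \<in> far_strip r" for s
  proof -
    define V where "V = 1 + \<bar>Im s\<bar>"
    define \<delta> where "\<delta> = e / V ^ 5"
    have "V \<ge> 1" by (simp add: V_def)
    then have "\<delta> > 0" "\<delta> \<le> e" "\<delta> * V ^ 5 = e"
      using e(1) divide_left_mono[of 1 "V ^ 5" e] by (auto simp: \<delta>_def)
    have away: "2 * (A * \<delta> * V) \<le> norm (dirichlet_series \<chi> w)"
      if w: "1 + \<delta> \<le> Re w" "Re w \<le> 2" "Im w = Im s" for w
    proof (rule fourth_root_lower_bound)
      have "w \<in> far_strip r" using w s \<open>\<delta> > 0\<close> by (simp add: far_strip_def)
      then show "(Re w - 1) ^ 3 / (B * V) \<le> norm (dirichlet_series \<chi> w) ^ 4"
        using fourth_power w(3) by (auto simp: V_def)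
    qed (use w e \<open>B > 0\<close> \<open>V \<ge> 1\<close> \<open>\<delta> > 0\<close> \<open>\<delta> * V ^ 5 = e\<close> in auto)
    define w where "w = Complex (max (Re s) (1 + \<delta>)) (Im s)"
    have w: "1 + \<delta> \<le> Re w" "Re s \<le> Re w" "Re w \<le> 2" "Im w = Im s" "Re w - Re s \<le> \<delta>"
      using s \<open>\<delta> > 0\<close> \<open>\<delta> \<le> e\<close> \<open>e \<le> 1\<close> by (auto simp: w_def far_strip_def)
    have "norm (dirichlet_series \<chi> w - dirichlet_series \<chi> s) \<le> A * V * (Re w - Re s)"
      unfolding A_def V_def by (rule norm_series_horizontal_diff_le[OF r s w(2-4)])
    also have "\<dots> \<le> A * V * \<delta>"
      using w(5) \<open>A > 0\<close> \<open>V \<ge> 1\<close> by (intro mult_left_mono) auto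
    finally have "A * \<delta> * V \<le> norm (dirichlet_series \<chi> s)"
      using away[of w] w norm_triangle_sub[of "dirichlet_series \<chi> w" "dirichlet_series \<chi> s"]
      by (simp add: mult_ac)
    moreover have "A * e / V ^ 4 = A * \<delta> * V"
      using \<open>V \<ge> 1\<close> by (simp add: \<delta>_def eval_nat_numeral field_simps)
    ultimately show ?thesis by (simp add: V_def)
  qed
  then show ?thesis using that[of "A * e"] \<open>A > 0\<close> e(1) by simp
qed

lemma log_derivative_far:
  assumes r: "0 < r" "r \<le> 1"
  obtains C where
    "\<forall>s\<in>far_strip r. norm (dirichlet_series (\<lambda>n. \<chi> n * mangoldt n) s) \<le> C * (1 + \<bar>Im s\<bar>) ^ 10"
    "\<forall>s\<in>far_strip r. norm (dirichlet_series (\<lambda>n. \<chi> n * mangoldt n * ln (real n)) s) \<le>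
       C * (1 + \<bar>Im s\<bar>) ^ 10"
proof -
  obtain m where "m > 0"
    and lower: "\<forall>s\<in>far_strip r. m / (1 + \<bar>Im s\<bar>) ^ 4 \<le> norm (dirichlet_series \<chi> s)"
    by (rule series_lower_bound[OF r])
  define A where "A = 2 / r ^ 3 + 2 * K"
  define q where "q = A / m"
  have "q \<ge> 0" using r K_nonneg \<open>m > 0\<close> by (simp add: q_def A_def)
  have bounds: "norm (dirichlet_series (\<lambda>n. \<chi> n * mangoldt n) s) \<le> (q + q ^ 2) * (1 + \<bar>Im s\<bar>) ^ 10"
    "norm (dirichlet_series (\<lambda>n. \<chi> n * mangoldt n * ln (real n)) s) \<le> (q + q ^ 2) * (1 + \<bar>Im s\<bar>) ^ 10"
    if s: "s \<in> far_strip r" for s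
  proof -
    have "Re s > 1" using s by (simp add: far_strip_def)
    define V where "V = 1 + \<bar>Im s\<bar>"
    have "V \<ge> 1" by (simp add: V_def)
    have series_le: "norm (dirichlet_series (\<lambda>n. \<chi> n * ln (real n) ^ k) s) \<le> A * V" if "k \<le> 2" for k
      using norm_series_far_le[OF r s that] by (simp add: A_def V_def)
    have "A * V / (m / V ^ 4) = q * V ^ 5"
      using \<open>m > 0\<close> \<open>V \<ge> 1\<close> by (simp add: q_def field_simps eval_nat_numeral)
    then have quotients: "norm (dirichlet_series (\<lambda>n. \<chi> n * mangoldt n) s) \<le> q * V ^ 5"
      "norm (dirichlet_series (\<lambda>n. \<chi> n * mangoldt n * ln (real n)) s) \<le> q * V ^ 5 + (q * V ^ 5) ^ 2"
      using norm_quotients_le[of "m / V ^ 4", OF _ _ series_le[of 1] series_le[of 2]]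
        bspec[OF lower s] \<open>m > 0\<close> \<open>V \<ge> 1\<close>
      by (simp_all add: dirichlet_series_chi_mangoldt_eq[OF \<open>Re s > 1\<close>]
          dirichlet_series_chi_mangoldt_ln_eq[OF \<open>Re s > 1\<close>] V_def)
    have "q * V ^ 5 + (q * V ^ 5) ^ 2 \<le> q * V ^ 10 + q ^ 2 * V ^ 10"
      using \<open>q \<ge> 0\<close> \<open>V \<ge> 1\<close>
      by (auto simp: power_mult_distrib simp flip: power_mult intro!: mult_left_mono power_increasing)
    then have sum_le: "q * V ^ 5 + (q * V ^ 5) ^ 2 \<le> (q + q ^ 2) * V ^ 10"
      by (simp add: distrib_right)
    with quotients(2) show "norm (dirichlet_series (\<lambda>n. \<chi> n * mangoldt n * ln (real n)) s) \<le>
        (q + q ^ 2) * (1 + \<bar>Im s\<bar>) ^ 10"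
      by (simp add: V_def)
    have "q * V ^ 5 \<le> q * V ^ 5 + (q * V ^ 5) ^ 2" by simp
    with quotients(1) sum_le show "norm (dirichlet_series (\<lambda>n. \<chi> n * mangoldt n) s) \<le>
        (q + q ^ 2) * (1 + \<bar>Im s\<bar>) ^ 10"
      unfolding V_def by linarith
  qed
  then show ?thesis using that by blast
qed

end

lemma norm_monomial_le:
  fixes u x :: complex
  assumes "norm u \<le> 1" "norm x \<le> X"
  shows "norm (of_nat c * (u ^ j * x)) \<le> real c * X"
  using mult_mono[of "norm u ^ j" 1 "norm x" X] assms
  by (simp add: norm_mult norm_power power_le_one mult_left_mono)

lemma simple_pole_quotients_le:
  fixes u e0 e1 e2 f0 f1 f2 :: complex
  assumes u: "u \<noteq> 0" "norm u \<le> 1" "norm u * M \<le> 1 / 2"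
    and e: "norm e0 \<le> M" "norm e1 \<le> M" "norm e2 \<le> M"
    and f: "f0 = 1 / u + e0" "f1 = 1 / u ^ 2 + e1" "f2 = 2 / u ^ 3 + e2"
  shows "norm (f1 / f0 - f0) \<le> 2 * (3 * M + M ^ 2)"
    and "norm (f2 / f0 - (f1 / f0) ^ 2 - f1) \<le> 4 * (4 * M + 5 * M ^ 2 + M ^ 3)"
proof -
  define w where "w = 1 + u * e0"
  have "norm (u * e0) \<le> norm u * M"
    unfolding norm_mult using e(1) by (intro mult_left_mono) auto
  then have w_ge: "norm w \<ge> 1 / 2"
    using u(3) norm_triangle_ineq2[of 1 "- (u * e0)"] by (simp add: w_def)
  then have "w \<noteq> 0" by auto
  have "M \<ge> 0" using e(1) norm_ge_zero order_trans by blast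
  have f0: "f0 = w / u" using u(1) by (simp add: f w_def field_simps)
  have products_le: "norm (e0 * e2) \<le> M ^ 2" "norm (e0 * e1) \<le> M ^ 2" "norm (e0 ^ 2) \<le> M ^ 2"
      "norm (e1 ^ 2) \<le> M ^ 2" "norm (e0 ^ 2 * e1) \<le> M ^ 3"
    using e \<open>M \<ge> 0\<close> by (simp_all add: norm_mult norm_power power2_eq_square power3_eq_cube mult_mono)
  note triangle = order_trans[OF norm_triangle_ineq] order_trans[OF norm_triangle_ineq4]
  define N1 where "N1 = of_nat 1 * (u ^ 1 * e1) - of_nat 2 * (u ^ 0 * e0) - of_nat 1 * (u ^ 1 * e0 ^ 2)"
  have "f1 / f0 - f0 = N1 / w"
    unfolding f0 using u(1) \<open>w \<noteq> 0\<close> unfolding f(2) N1_def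
    by (simp add: divide_simps) (simp add: w_def power2_eq_square algebra_simps)
  moreover have "norm N1 \<le> real 1 * M + real 2 * M + real 1 * M ^ 2"
    unfolding N1_def by (intro triangle add_mono norm_monomial_le u(2) e products_le)
  then have "norm N1 / norm w \<le> (real 1 * M + real 2 * M + real 1 * M ^ 2) / (1 / 2)"
    using w_ge \<open>M \<ge> 0\<close> by (intro frac_le) auto
  ultimately show "norm (f1 / f0 - f0) \<le> 2 * (3 * M + M ^ 2)" by (simp add: norm_divide)
  define N2 where "N2 = of_nat 1 * (u ^ 1 * e2) + of_nat 1 * (u ^ 2 * (e0 * e2)) -
      of_nat 3 * (u ^ 0 * e1) - of_nat 1 * (u ^ 2 * e1 ^ 2) - of_nat 1 * (u ^ 0 * e0 ^ 2) -
      of_nat 2 * (u ^ 1 * (e0 * e1)) - of_nat 1 * (u ^ 2 * (e0 ^ 2 * e1))"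
  have "f2 / f0 - (f1 / f0) ^ 2 - f1 = N2 / w ^ 2"
    unfolding f0 using u(1) \<open>w \<noteq> 0\<close> unfolding f(2,3) N2_def
    by (simp add: divide_simps) (simp add: w_def eval_nat_numeral algebra_simps)
  moreover have "norm N2 \<le> real 1 * M + real 1 * M ^ 2 + real 3 * M + real 1 * M ^ 2 + real 1 * M ^ 2 +
      real 2 * M ^ 2 + real 1 * M ^ 3"
    unfolding N2_def by (intro triangle add_mono norm_monomial_le u(2) e products_le)
  then have "norm N2 / norm w ^ 2 \<le> (4 * M + 5 * M ^ 2 + M ^ 3) / (1 / 2) ^ 2"
    using w_ge \<open>M \<ge> 0\<close> by (intro frac_le power_mono) auto
  ultimately show "norm (f2 / f0 - (f1 / f0) ^ 2 - f1) \<le> 4 * (4 * M + 5 * M ^ 2 + M ^ 3)"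
    by (simp add: norm_divide norm_power power_one_over)
qed

lemma zeta_log_derivative_near:
  obtains r C where "0 < r" "r \<le> 1"
    "\<forall>s\<in>near_strip r. norm (dirichlet_series mangoldt s - zeta_series s) \<le> C"
    "\<forall>s\<in>near_strip r. norm (dirichlet_series (\<lambda>n. mangoldt n * ln (real n)) s -
       dirichlet_series (\<lambda>n. ln (real n)) s) \<le> C"
proof -
  define K where "K = suminf (ln_powr_variation 2)"
  have "K \<ge> 0" unfolding K_def by (rule zeta.K_nonneg)
  define M r where "M = 3 * K" and "r = 1 / (12 * K + 2)"
  have r: "0 < r" "r \<le> 1 / 2" "2 * r * M \<le> 1 / 2"
    using \<open>K \<ge> 0\<close> by (auto simp: r_def M_def field_simps)
  define C where "C = 2 * (3 * M + M ^ 2) + 4 * (4 * M + 5 * M ^ 2 + M ^ 3)"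
  have bounds: "norm (dirichlet_series mangoldt s - zeta_series s) \<le> C"
      "norm (dirichlet_series (\<lambda>n. mangoldt n * ln (real n)) s -
         dirichlet_series (\<lambda>n. ln (real n)) s) \<le> C"
    if "s \<in> near_strip r" for s
  proof -
    have s: "1 < Re s" "norm s \<le> 3" "norm (s - 1) \<le> 2 * r"
      using near_stripD[OF that] r by auto
    define e where "e k = dirichlet_series (\<lambda>n. ln (real n) ^ k) s - fact k / (s - 1) ^ Suc k" for k
    have e_le: "norm (e k) \<le> M" if "k \<le> 2" for k
      using zeta.approx[OF s(1) that] mult_left_mono[of "norm s" 3 K] s r \<open>K \<ge> 0\<close>
      by (simp add: e_def K_def M_def)
    have "norm (s - 1) * M \<le> 2 * r * M"
      using s r \<open>K \<ge> 0\<close> by (intro mult_right_mono) (auto simp: M_def)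
    with r have uM: "norm (s - 1) * M \<le> 1 / 2" by simp
    have "s - 1 \<noteq> 0" "norm (s - 1) \<le> 1" using s r by auto
    note pole = simple_pole_quotients_le[OF this uM e_le[of 0] e_le[of 1] e_le[of 2] refl refl refl]
    have series: "1 / (s - 1) + e 0 = zeta_series s"
        "1 / (s - 1) ^ 2 + e 1 = dirichlet_series (\<lambda>n. ln (real n)) s"
        "2 / (s - 1) ^ 3 + e 2 = dirichlet_series (\<lambda>n. ln (real n) ^ 2) s"
      by (simp_all add: e_def eval_nat_numeral)
    have "M \<ge> 0" using \<open>K \<ge> 0\<close> by (simp add: M_def)
    then have "2 * (3 * M + M ^ 2) \<le> C" "4 * (4 * M + 5 * M ^ 2 + M ^ 3) \<le> C"
      by (simp_all add: C_def)
    then show "norm (dirichlet_series mangoldt s - zeta_series s) \<le> C"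
      "norm (dirichlet_series (\<lambda>n. mangoldt n * ln (real n)) s -
         dirichlet_series (\<lambda>n. ln (real n)) s) \<le> C"
      using pole zeta.dirichlet_series_chi_mangoldt_eq[OF s(1)]
        zeta.dirichlet_series_chi_mangoldt_ln_eq[OF s(1)]
      unfolding series by simp_all
  qed
  show ?thesis by (rule that[of r C]) (use r bounds in auto)
qed

lemma abs_conv_mangoldt_minus_one: "abs_conv (\<lambda>n. mangoldt n - 1)"
  by (intro abs_conv_diff abs_conv_mangoldt abs_conv_const)

theorem
  shows polynomial_growth_mangoldt_minus_one: "polynomial_growth (\<lambda>n. mangoldt n - 1) 10"
    and polynomial_growth_mangoldt_minus_one_ln:
      "polynomial_growth (\<lambda>n. (mangoldt n - 1) * ln (real n)) 10"
proof -
  obtain r C where r: "0 < r" "r \<le> 1"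
    and near: "\<forall>s\<in>near_strip r. norm (dirichlet_series mangoldt s - zeta_series s) \<le> C"
      "\<forall>s\<in>near_strip r. norm (dirichlet_series (\<lambda>n. mangoldt n * ln (real n)) s -
         dirichlet_series (\<lambda>n. ln (real n)) s) \<le> C"
    by (rule zeta_log_derivative_near)
  obtain C' where far:
      "\<forall>s\<in>far_strip r. norm (dirichlet_series mangoldt s) \<le> C' * (1 + \<bar>Im s\<bar>) ^ 10"
      "\<forall>s\<in>far_strip r. norm (dirichlet_series (\<lambda>n. mangoldt n * ln (real n)) s) \<le>
         C' * (1 + \<bar>Im s\<bar>) ^ 10"
    by (rule zeta.log_derivative_far[OF r, unfolded mult_1])
  define A where "A = 2 / r ^ 3 + 2 * suminf (ln_powr_variation 2)"
  have "A \<ge> 0" using r zeta.K_nonneg by (simp add: A_def)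
  have zeta_far: "\<forall>s\<in>far_strip r. norm (dirichlet_series (\<lambda>n. ln (real n) ^ k) s) \<le>
      A * (1 + \<bar>Im s\<bar>) ^ 10" if "k \<le> 2" for k
  proof
    fix s assume "s \<in> far_strip r"
    then have "norm (dirichlet_series (\<lambda>n. ln (real n) ^ k) s) \<le> A * (1 + \<bar>Im s\<bar>) ^ 1"
      using zeta.norm_series_far_le[OF r _ that] by (simp add: A_def)
    also have "\<dots> \<le> A * (1 + \<bar>Im s\<bar>) ^ 10"
      using \<open>A \<ge> 0\<close> by (intro mult_left_mono power_increasing) auto
    finally show "norm (dirichlet_series (\<lambda>n. ln (real n) ^ k) s) \<le> A * (1 + \<bar>Im s\<bar>) ^ 10" .
  qed
  show "polynomial_growth (\<lambda>n. mangoldt n - 1) 10"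
    using zeta_far[of 0]
    by (intro polynomial_growth_diff_near_far[OF abs_conv_mangoldt abs_conv_const r near(1) far(1)]) simp
  have "polynomial_growth (\<lambda>n. mangoldt n * ln (real n) - ln (real n)) 10"
    using zeta_far[of 1] abs_conv_mult_ln[OF abs_conv_const[of 1]]
    by (intro polynomial_growth_diff_near_far[OF _ _ r near(2) far(2)] abs_conv_mult_ln
        abs_conv_mangoldt) simp_all
  then show "polynomial_growth (\<lambda>n. (mangoldt n - 1) * ln (real n)) 10"
    by (simp add: left_diff_distrib)
qed

locale nonprincipal_character = sign_character \<chi> + bounded_partial_sums \<chi> D
  for \<chi> :: "nat \<Rightarrow> real" and D :: real
begin

sublocale character_with_residue \<chi> 0 "D * suminf (ln_powr_variation 2)"
proof
  fix k :: nat and s :: complex assume "Re s > 1" "k \<le> 2"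
  have "norm (dirichlet_series (\<lambda>n. \<chi> n * ln (real n) ^ k) s) \<le>
      D * suminf (ln_powr_variation k) * norm s"
    using \<open>Re s > 1\<close> by (intro norm_dirichlet_series_ln_power_le) simp
  also have "\<dots> \<le> D * suminf (ln_powr_variation 2) * norm s"
    using \<open>k \<le> 2\<close>
    by (intro mult_right_mono mult_left_mono suminf_ln_powr_variation_mono bound_nonneg) auto
  finally show "norm (dirichlet_series (\<lambda>n. \<chi> n * ln (real n) ^ k) s -
      of_real 0 * fact k / (s - 1) ^ Suc k) \<le> D * suminf (ln_powr_variation 2) * norm s"
    by simp
qed auto

lemma series_lower_bound_near_1:
  assumes "dirichlet_series \<chi> 1 \<noteq> 0"
  obtains m r where "m > 0" "0 < r" "r \<le> 1"
    "\<forall>s\<in>near_strip r. m \<le> norm (dirichlet_series \<chi> s)"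
proof -
  define l where "l = norm (dirichlet_series \<chi> 1)"
  define K where "K = D * suminf (ln_powr_variation 1) * 3"
  define r where "r = min 1 (l / (4 * K + 1))"
  have "l > 0" using assms by (simp add: l_def)
  have "K \<ge> 0" using bound_nonneg suminf_ln_powr_variation_nonneg by (simp add: K_def)
  then have r: "0 < r" "r \<le> 1" "4 * K * r \<le> l"
    using \<open>l > 0\<close> by (auto simp: r_def min_def field_simps)
  have "l / 2 \<le> norm (dirichlet_series \<chi> s)" if "s \<in> near_strip r" for s
  proof -
    note s = near_stripD[OF that r(2)]
    have "norm (dirichlet_series \<chi> s - dirichlet_series \<chi> 1) \<le> K * norm (s - 1)"
      unfolding K_def using s by (intro dirichlet_series_lipschitz) auto
    also have "\<dots> \<le> K * (2 * r)"
      using s \<open>K \<ge> 0\<close> by (intro mult_left_mono) auto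
    also have "\<dots> \<le> l / 2" using r(3) by simp
    finally show ?thesis
      using norm_triangle_ineq2[of "dirichlet_series \<chi> 1" "dirichlet_series \<chi> s"]
      by (simp add: l_def norm_minus_commute)
  qed
  then show ?thesis using that[of "l / 2" r] \<open>l > 0\<close> r by simp
qed

theorem
  assumes "dirichlet_series \<chi> 1 \<noteq> 0"
  shows polynomial_growth_chi_mangoldt: "polynomial_growth (\<lambda>n. \<chi> n * mangoldt n) 10"
    and polynomial_growth_chi_mangoldt_ln: "polynomial_growth (\<lambda>n. \<chi> n * mangoldt n * ln (real n)) 10"
proof -
  obtain m r where "m > 0" and r: "0 < r" "r \<le> 1"
    and lower: "\<forall>s\<in>near_strip r. m \<le> norm (dirichlet_series \<chi> s)"
    by (rule series_lower_bound_near_1[OF assms])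
  obtain C where far:
    "\<forall>s\<in>far_strip r. norm (dirichlet_series (\<lambda>n. \<chi> n * mangoldt n) s) \<le> C * (1 + \<bar>Im s\<bar>) ^ 10"
    "\<forall>s\<in>far_strip r. norm (dirichlet_series (\<lambda>n. \<chi> n * mangoldt n * ln (real n)) s) \<le>
       C * (1 + \<bar>Im s\<bar>) ^ 10"
    by (rule log_derivative_far[OF r])
  define M where "M = D * suminf (ln_powr_variation 2) * 3"
  have near: "norm (dirichlet_series (\<lambda>n. \<chi> n * mangoldt n) s) \<le> M / m"
    "norm (dirichlet_series (\<lambda>n. \<chi> n * mangoldt n * ln (real n)) s) \<le> M / m + (M / m) ^ 2"
    if "s \<in> near_strip r" for s
  proof -
    note s = near_stripD[OF that r(2)]
    have series_le: "norm (dirichlet_series (\<lambda>n. \<chi> n * ln (real n) ^ k) s) \<le> M" if "k \<le> 2" for k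
      using order_trans[OF approx[OF s(1) that] mult_left_mono[OF s(2) K_nonneg]] by (simp add: M_def)
    show "norm (dirichlet_series (\<lambda>n. \<chi> n * mangoldt n) s) \<le> M / m"
      "norm (dirichlet_series (\<lambda>n. \<chi> n * mangoldt n * ln (real n)) s) \<le> M / m + (M / m) ^ 2"
      using norm_quotients_le[OF \<open>m > 0\<close> bspec[OF lower that] series_le[of 1] series_le[of 2]]
      by (simp_all add: dirichlet_series_chi_mangoldt_eq[OF s(1)]
          dirichlet_series_chi_mangoldt_ln_eq[OF s(1)])
  qed
  show "polynomial_growth (\<lambda>n. \<chi> n * mangoldt n) 10"
    by (rule polynomial_growth_near_far[OF r _ far(1)]) (use near in blast)
  show "polynomial_growth (\<lambda>n. \<chi> n * mangoldt n * ln (real n)) 10"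
    by (rule polynomial_growth_near_far[OF r _ far(2)]) (use near in blast)
qed

end

section \<open>Nonvanishing at 1\<close>

definition divisor_sum :: "(nat \<Rightarrow> 'a :: comm_semiring_1) \<Rightarrow> nat \<Rightarrow> 'a" where
  "divisor_sum f n = (\<Sum>d | d dvd n. f d)"

lemma gcd_mult_coprime_divisors:
  fixes a b x y :: nat
  assumes "coprime a b" "x dvd a" "y dvd b"
  shows "gcd (x * y) a = x" "gcd (x * y) b = y"
proof -
  have "coprime y a" "coprime x b"
    using assms by (meson coprime_commute coprime_divisors dvd_refl)+
  then show "gcd (x * y) a = x" "gcd (x * y) b = y"
    using assms by (simp_all add: gcd_mult_left_right_cancel gcd_mult_left_left_cancel
        coprime_commute gcd_nat.absorb1)
qed

lemma divisor_sum_coprime_mult: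
  assumes "coprime a b" and mult: "\<And>x y. x dvd a \<Longrightarrow> y dvd b \<Longrightarrow> f (x * y) = f x * f y"
  shows "divisor_sum f (a * b) = divisor_sum f a * divisor_sum f b"
proof -
  have "divisor_sum f (a * b) = (\<Sum>(x, y) \<in> {x. x dvd a} \<times> {y. y dvd b}. f x * f y)"
    unfolding divisor_sum_def
  proof (rule sum.reindex_bij_witness[of _ "\<lambda>(x, y). x * y" "\<lambda>d. (gcd d a, gcd d b)"])
    fix d assume "d \<in> {d. d dvd a * b}"
    then obtain x y where d: "d = x * y" "x dvd a" "y dvd b"
      using division_decomp[of d a b] by auto
    note gcd = gcd_mult_coprime_divisors[OF assms(1) d(2,3)]
    show "(case (gcd d a, gcd d b) of (x, y) \<Rightarrow> x * y) = d"
      using d gcd by simp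
    show "(case (gcd d a, gcd d b) of (x, y) \<Rightarrow> f x * f y) = f d"
      using d gcd mult by simp
  qed (auto intro: mult_dvd_mono simp: gcd_mult_coprime_divisors[OF assms(1)])
  then show ?thesis
    by (simp add: divisor_sum_def sum_product sum.cartesian_product)
qed

lemma prime_power_coprime_induct [consumes 1, case_names prime_power coprime_mult]:
  fixes n :: nat
  assumes "n > 0"
    and prime_power: "\<And>p k. prime p \<Longrightarrow> P (p ^ k)"
    and coprime_mult: "\<And>a b. coprime a b \<Longrightarrow> P a \<Longrightarrow> P b \<Longrightarrow> P (a * b)"
  shows "P n"
  using \<open>n > 0\<close>
proof (induction n rule: less_induct)
  case (less n)
  show ?case
  proof (cases "n = 1")
    case True
    then show ?thesis using prime_power[of 2 0] by simp
  next
    case False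
    then obtain p where p: "prime p" "p dvd n" using prime_factor_nat[of n] by auto
    then obtain m where m: "n = p ^ multiplicity p n * m" "\<not> p dvd m"
      using multiplicity_decompose'[of n p] less.prems by (metis not_prime_unit not_gr_zero)
    have "multiplicity p n > 0" using p less.prems by (simp add: prime_multiplicity_gt_zero_iff)
    then have "p ^ multiplicity p n > 1" by (rule one_less_power[OF prime_gt_1_nat[OF p(1)]])
    moreover have "m > 0" using m(1) less.prems by (cases "m = 0") auto
    ultimately have "P m" using less.IH[of m] m(1) by (metis mult_less_cancel2 nat_mult_1)
    moreover have "coprime (p ^ multiplicity p n) m"
      using prime_imp_coprime[OF p(1) m(2)] by simp
    ultimately show ?thesis using coprime_mult prime_power[OF p(1)] m(1) by metis
  qed
qed

context sign_character
begin

lemma chi_power: "\<chi> (p ^ k) = \<chi> p ^ k"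
  by (induction k) (use chi_one chi_mult in auto)

lemma divisor_sum_chi_prime_power:
  assumes "prime p"
  shows "divisor_sum \<chi> (p ^ k) = (\<Sum>i\<le>k. \<chi> p ^ i)"
proof -
  have "{d. d dvd p ^ k} = (\<lambda>i. p ^ i) ` {..k}"
    using assms by (auto simp: divides_primepow_nat le_imp_power_dvd)
  moreover have "inj_on (\<lambda>i. p ^ i) {..k}"
    using assms prime_gt_1_nat by (auto intro!: inj_onI)
  ultimately show ?thesis by (simp add: divisor_sum_def sum.reindex chi_power)
qed

lemma divisor_sum_chi_prime_power_bounds:
  assumes "prime p"
  shows "divisor_sum \<chi> (p ^ k) \<ge> 0" "even k \<Longrightarrow> divisor_sum \<chi> (p ^ k) \<ge> 1"
proof -
  have "(\<Sum>i\<le>k. (-1 :: real) ^ i) = (if even k then 1 else 0)" "(\<Sum>i\<le>k. (0 :: real) ^ i) = 1"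
    by (induction k) auto
  then show "divisor_sum \<chi> (p ^ k) \<ge> 0" "even k \<Longrightarrow> divisor_sum \<chi> (p ^ k) \<ge> 1"
    using chi_values[of p] by (auto simp: divisor_sum_chi_prime_power[OF assms])
qed

lemma divisor_sum_chi_coprime_mult:
  "coprime a b \<Longrightarrow> divisor_sum \<chi> (a * b) = divisor_sum \<chi> a * divisor_sum \<chi> b"
  by (intro divisor_sum_coprime_mult chi_mult)

lemma divisor_sum_chi_nonneg: "n > 0 \<Longrightarrow> divisor_sum \<chi> n \<ge> 0"
  by (induction n rule: prime_power_coprime_induct)
     (auto simp: divisor_sum_chi_prime_power_bounds divisor_sum_chi_coprime_mult)

lemma divisor_sum_chi_square: "n > 0 \<Longrightarrow> divisor_sum \<chi> (n ^ 2) \<ge> 1"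
proof (induction n rule: prime_power_coprime_induct)
  case (prime_power p k)
  then show ?case
    unfolding power_mult[symmetric] by (rule divisor_sum_chi_prime_power_bounds) simp
next
  case (coprime_mult a b)
  have "1 * 1 \<le> divisor_sum \<chi> (a ^ 2) * divisor_sum \<chi> (b ^ 2)"
    using coprime_mult by (intro mult_mono) auto
  also have "\<dots> = divisor_sum \<chi> ((a * b) ^ 2)"
    using coprime_mult(1) unfolding power_mult_distrib by (intro divisor_sum_chi_coprime_mult[symmetric]) simp
  finally show ?case by simp
qed

end

definition lambert_series :: "(nat \<Rightarrow> real) \<Rightarrow> real \<Rightarrow> real" where
  "lambert_series f t = (\<Sum>n. f (Suc n) * (t ^ Suc n / (1 - t ^ Suc n)))"

lemma
  fixes f :: "nat \<Rightarrow> real"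
  assumes t: "0 < t" "t < 1" and f: "\<And>n. \<bar>f n\<bar> \<le> B"
  shows abs_summable_lambert:
      "summable (\<lambda>n. \<bar>f (Suc n)\<bar> * (t ^ Suc n / (1 - t ^ Suc n)))"
    and lambert_sums:
      "(\<lambda>n. f (Suc n) * (t ^ Suc n / (1 - t ^ Suc n))) sums lambert_series f t"
proof -
  have "B \<ge> 0" using f[of 0] by linarith
  have power_le: "t ^ Suc n \<le> t" for n
    using t power_decreasing[of 1 "Suc n" t] by simp
  have power_nonneg: "0 \<le> t ^ Suc n" for n
    using t by simp
  have terms_nonneg: "t ^ Suc n / (1 - t ^ Suc n) \<ge> 0" for n
    using power_nonneg[of n] power_le[of n] t by (intro divide_nonneg_nonneg) linarith+
  have "summable (\<lambda>n. B * (t ^ Suc n / (1 - t)))"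
    using t by (intro summable_mult summable_divide, subst summable_Suc_iff) (simp add: summable_geometric)
  then show abs_summable: "summable (\<lambda>n. \<bar>f (Suc n)\<bar> * (t ^ Suc n / (1 - t ^ Suc n)))"
  proof (rule summable_comparison_test')
    fix n :: nat
    have "t ^ Suc n / (1 - t ^ Suc n) \<le> t ^ Suc n / (1 - t)"
      using power_nonneg[of n] power_le[of n] t by (intro frac_le) linarith+
    then have "\<bar>f (Suc n)\<bar> * (t ^ Suc n / (1 - t ^ Suc n)) \<le> B * (t ^ Suc n / (1 - t))"
      by (rule mult_mono[OF f _ \<open>B \<ge> 0\<close> terms_nonneg])
    moreover have "\<bar>f (Suc n)\<bar> * (t ^ Suc n / (1 - t ^ Suc n)) \<ge> 0"
      by (intro mult_nonneg_nonneg terms_nonneg) simp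
    ultimately show "norm (\<bar>f (Suc n)\<bar> * (t ^ Suc n / (1 - t ^ Suc n))) \<le> B * (t ^ Suc n / (1 - t))"
      by (simp only: real_norm_def abs_of_nonneg)
  qed
  have "\<bar>f (Suc n) * (t ^ Suc n / (1 - t ^ Suc n))\<bar> = \<bar>f (Suc n)\<bar> * (t ^ Suc n / (1 - t ^ Suc n))" for n
    by (simp only: abs_mult abs_of_nonneg[OF terms_nonneg])
  with abs_summable have "summable (\<lambda>n. \<bar>f (Suc n) * (t ^ Suc n / (1 - t ^ Suc n))\<bar>)"
    by (simp only:)
  then show "(\<lambda>n. f (Suc n) * (t ^ Suc n / (1 - t ^ Suc n))) sums lambert_series f t"
    unfolding lambert_series_def by (rule summable_sums[OF summable_rabs_cancel])
qed

lemma has_sum_Suc_iff: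
  fixes f :: "nat \<Rightarrow> 'a :: {comm_monoid_add, topological_space}"
  shows "((\<lambda>n. f (Suc n)) has_sum S) UNIV \<longleftrightarrow> (f has_sum S) {0<..}"
  by (rule has_sum_reindex_bij_witness[of _ "\<lambda>n. n - 1" Suc]) auto

lemma lambert_has_sum:
  fixes f :: "nat \<Rightarrow> real"
  assumes t: "0 < t" "t < 1" and f: "\<And>n. \<bar>f n\<bar> \<le> B"
  shows "((\<lambda>n. divisor_sum f n * t ^ n) has_sum lambert_series f t) {0<..}"
proof -
  have geometric: "((\<lambda>k. x * t ^ (n * k)) has_sum (x * (t ^ n / (1 - t ^ n)))) {0<..}"
    if "n > 0" for n x
    using has_sum_cmult_right[OF has_sum_geometric_from_1[of "t ^ n"], of x] t that
    by (simp add: power_less_one_iff power_mult atLeast_Suc_greaterThan)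
  have terms_nonneg: "t ^ n / (1 - t ^ n) \<ge> 0" for n
    using t by (intro divide_nonneg_nonneg) (auto simp: power_le_one)
  have "(\<lambda>(n, k). \<bar>f n\<bar> * t ^ (n * k)) summable_on ({0<..} \<times> {0<..})"
  proof (rule summable_on_SigmaI)
    show "((\<lambda>k. case (n, k) of (n, k) \<Rightarrow> \<bar>f n\<bar> * t ^ (n * k)) has_sum
        \<bar>f n\<bar> * (t ^ n / (1 - t ^ n))) {0<..}"
      if "n \<in> {0<..}" for n
      using geometric that by simp
    have "((\<lambda>n. \<bar>f (Suc n)\<bar> * (t ^ Suc n / (1 - t ^ Suc n))) has_sum
        (\<Sum>n. \<bar>f (Suc n)\<bar> * (t ^ Suc n / (1 - t ^ Suc n)))) UNIV"
      by (intro sums_nonneg_imp_has_sum summable_sums abs_summable_lambert[OF t f] mult_nonneg_nonneg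
          terms_nonneg) simp
    then show "(\<lambda>n. \<bar>f n\<bar> * (t ^ n / (1 - t ^ n))) summable_on {0<..}"
      unfolding has_sum_Suc_iff[of "\<lambda>n. \<bar>f n\<bar> * (t ^ n / (1 - t ^ n))"] by (rule has_sum_imp_summable)
  qed (use t in auto)
  then have "(\<lambda>z. norm (case z of (n, k) \<Rightarrow> f n * t ^ (n * k))) summable_on ({0<..} \<times> {0<..})"
    using t by (simp add: case_prod_unfold abs_mult)
  then have abs_summable: "(\<lambda>(n, k). f n * t ^ (n * k)) summable_on ({0<..} \<times> {0<..})"
    by (rule abs_summable_summable)
  have "((\<lambda>n. f (Suc n) * (t ^ Suc n / (1 - t ^ Suc n))) has_sum lambert_series f t) UNIV"
    using abs_summable_lambert[OF t f] terms_nonneg[of "Suc _"]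
    by (intro norm_summable_imp_has_sum lambert_sums[OF t f])
       (simp only: real_norm_def abs_mult abs_of_nonneg)
  then have "((\<lambda>(n, k). f n * t ^ (n * k)) has_sum lambert_series f t) ({0<..} \<times> {0<..})"
    unfolding has_sum_Suc_iff[of "\<lambda>n. f n * (t ^ n / (1 - t ^ n))"]
    by (intro has_sum_SigmaI[OF _ _ abs_summable]) (use geometric in auto)
  then have "((\<lambda>n. \<Sum>d | d dvd n. f d * t ^ (d * (n div d))) has_sum lambert_series f t) {0<..}"
    by (rule has_sum_divisors)
  moreover have "(\<Sum>d | d dvd n. f d * t ^ (d * (n div d))) = divisor_sum f n * t ^ n" for n
    unfolding divisor_sum_def sum_distrib_right by (intro sum.cong) auto
  ultimately show ?thesis by (simp only:)
qed

lemma (in sign_character) sum_power_square_le_lambert: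
  assumes "0 < t" "t < 1"
  shows "(\<Sum>j=1..J. t ^ (j ^ 2)) \<le> lambert_series \<chi> t"
proof -
  have "(\<Sum>j=1..J. t ^ (j ^ 2)) \<le> (\<Sum>j=1..J. divisor_sum \<chi> (j ^ 2) * t ^ (j ^ 2))"
  proof (rule sum_mono)
    fix j assume "j \<in> {1..J}"
    then have "1 * t ^ (j ^ 2) \<le> divisor_sum \<chi> (j ^ 2) * t ^ (j ^ 2)"
      using assms by (intro mult_right_mono divisor_sum_chi_square) auto
    then show "t ^ (j ^ 2) \<le> divisor_sum \<chi> (j ^ 2) * t ^ (j ^ 2)" by simp
  qed
  also have "\<dots> = (\<Sum>n\<in>(\<lambda>j. j ^ 2) ` {1..J}. divisor_sum \<chi> n * t ^ n)"
    by (subst sum.reindex) (auto intro!: inj_onI simp: power2_eq_iff)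
  also have "\<dots> \<le> lambert_series \<chi> t"
    using assms
    by (intro finite_sum_le_has_sum[OF lambert_has_sum[OF assms abs_chi_le_1]]
        mult_nonneg_nonneg divisor_sum_chi_nonneg) auto
  finally show ?thesis .
qed

lemma sum_power_ge_middle:
  fixes t :: real
  assumes "0 < t"
  shows "real n * t powr ((real n - 1) / 2) \<le> (\<Sum>i<n. t ^ i)"
proof -
  have "2 * t powr ((real n - 1) / 2) \<le> t ^ i + t ^ (n - Suc i)" if "i < n" for i
  proof -
    define a b where "a = t powr (real i / 2)" and "b = t powr ((real n - 1 - real i) / 2)"
    have "a * b = t powr ((real n - 1) / 2)"
      by (simp add: a_def b_def powr_add[symmetric] add_divide_distrib[symmetric])
    moreover have "a ^ 2 = t ^ i" "b ^ 2 = t ^ (n - Suc i)"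
      using assms that
      by (simp_all add: a_def b_def power2_eq_square powr_add[symmetric] of_nat_diff
          diff_diff_eq add.commute powr_realpow[symmetric])
    ultimately show ?thesis using sum_squares_bound[of a b] by simp
  qed
  then have "(\<Sum>i<n. 2 * t powr ((real n - 1) / 2)) \<le> (\<Sum>i<n. t ^ i + t ^ (n - Suc i))"
    by (intro sum_mono) auto
  also have "\<dots> = 2 * (\<Sum>i<n. t ^ i)"
    using sum.nat_diff_reindex[of "\<lambda>i. t ^ i" n] by (simp add: sum.distrib)
  finally show ?thesis by simp
qed

definition lambert_weight :: "real \<Rightarrow> nat \<Rightarrow> real" where
  "lambert_weight t n = 1 / (real n * (1 - t)) - t ^ n / (1 - t ^ n)"

lemma lambert_term_diff_le:
  fixes t :: real
  assumes t: "0 < t" "t < 1" and n: "n \<ge> 1"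
  shows "t ^ n / (1 - t ^ n) - t ^ Suc n / (1 - t ^ Suc n) \<le> 1 / ((1 - t) * (real n * real (Suc n)))"
proof -
  define p q where "p = (\<Sum>i<n. t ^ i)" and "q = (\<Sum>i<Suc n. t ^ i)"
  have factor: "1 - t ^ n = (1 - t) * p" "1 - t ^ Suc n = (1 - t) * q"
    using one_diff_power_eq[of t n] one_diff_power_eq[of t "Suc n"] by (simp_all only: p_def q_def)
  have "real n * real (Suc n) * t ^ n \<le> real n * real (Suc n) * t powr (real n - 1 / 2)"
    using t powr_mono'[of "real n - 1/2" "real n" t] by (intro mult_left_mono) (auto simp: powr_realpow)
  also have "\<dots> = (real n * t powr ((real n - 1) / 2)) * (real (Suc n) * t powr ((real (Suc n) - 1) / 2))"
    by (simp add: powr_add[symmetric] algebra_simps flip: add_divide_distrib) (simp add: field_simps)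
  also have "\<dots> \<le> p * q"
    unfolding p_def q_def using t by (intro mult_mono sum_power_ge_middle) (auto intro!: sum_nonneg)
  finally have pq_ge: "real n * real (Suc n) * t ^ n \<le> p * q" .
  moreover have "0 < real n * real (Suc n) * t ^ n" using t n by simp
  ultimately have "p * q > 0" by linarith
  have "t ^ n / (1 - t ^ n) - t ^ Suc n / (1 - t ^ Suc n) = t ^ n / ((1 - t) * (p * q))"
  proof -
    have "p \<noteq> 0" "q \<noteq> 0" "t \<noteq> 1" using \<open>p * q > 0\<close> t by auto
    then have "t ^ n / (1 - t ^ n) - t ^ Suc n / (1 - t ^ Suc n) =
        t ^ n * (q - t * p) / ((1 - t) * (p * q))"
      unfolding factor by (simp add: divide_simps) (simp add: algebra_simps)
    moreover have "q = 1 + t * p"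
      unfolding p_def q_def sum.lessThan_Suc_shift by (simp add: sum_distrib_left)
    ultimately show ?thesis by simp
  qed
  also have "\<dots> \<le> 1 / ((1 - t) * (real n * real (Suc n)))"
    using pq_ge \<open>p * q > 0\<close> t n by (simp add: divide_simps mult_ac del: of_nat_Suc)
  finally show ?thesis .
qed

lemma lambert_weight_Suc_le:
  assumes "0 < t" "t < 1" "n \<ge> 1"
  shows "lambert_weight t (Suc n) \<le> lambert_weight t n"
proof -
  have "1 / (real n * (1 - t)) - 1 / (real (Suc n) * (1 - t)) = 1 / ((1 - t) * (real n * real (Suc n)))"
    using assms by (simp add: divide_simps)
  then show ?thesis
    using lambert_term_diff_le[OF assms] unfolding lambert_weight_def by linarith
qed

lemma lambert_weight_tendsto_0:
  assumes "0 < t" "t < 1"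
  shows "(\<lambda>n. lambert_weight t (Suc n)) \<longlonglongrightarrow> 0"
proof (rule LIMSEQ_Suc)
  show "lambert_weight t \<longlonglongrightarrow> 0"
    unfolding lambert_weight_def using assms by real_asymp
qed

context nonprincipal_character
begin

lemma abs_lambert_series_le:
  assumes zero: "dirichlet_series \<chi> 1 = 0" and t: "0 < t" "t < 1"
  shows "\<bar>lambert_series \<chi> t\<bar> \<le> D"
proof -
  have "of_real (\<chi> (Suc n)) * ln_powr 0 1 (of_nat (Suc n)) = complex_of_real (\<chi> (Suc n) / real (Suc n))" for n
    by (simp add: ln_powr_def powr_minus divide_inverse del: of_nat_Suc)
  then have "(\<lambda>n. complex_of_real (\<chi> (Suc n) / real (Suc n))) sums of_real 0"
    using dirichlet_series_ln_power_sums[of 1 0] zero by simp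
  then have "(\<lambda>n. \<chi> (Suc n) / real (Suc n)) sums 0"
    by (simp only: sums_of_real_iff)
  then have "(\<lambda>n. \<chi> (Suc n) / real (Suc n) * (1 / (1 - t)) -
      \<chi> (Suc n) * (t ^ Suc n / (1 - t ^ Suc n))) sums (0 * (1 / (1 - t)) - lambert_series \<chi> t)"
    by (intro sums_diff sums_mult2 lambert_sums[OF t abs_chi_le_1])
  then have weighted: "(\<lambda>n. \<chi> (Suc n) * lambert_weight t (Suc n)) sums (- lambert_series \<chi> t)"
    by (simp add: lambert_weight_def right_diff_distrib del: power_Suc of_nat_Suc)
  have "\<bar>\<Sum>n<N. \<chi> (Suc n) * lambert_weight t (Suc n)\<bar> \<le> D * lambert_weight t (Suc 0)" for N
    using t by (intro abs_sum_mult_decseq_le abs_partial_sum_le lambert_weight_tendsto_0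
        decseq_SucI lambert_weight_Suc_le) auto
  moreover have "lambert_weight t (Suc 0) = 1"
    using t by (simp add: lambert_weight_def field_simps)
  ultimately have "\<bar>- lambert_series \<chi> t\<bar> \<le> D"
    using weighted unfolding sums_def by (intro LIMSEQ_le_const2[OF tendsto_rabs]) auto
  then show ?thesis by simp
qed

text \<open>Monsky's argument: if \<open>L(1) = 0\<close>, the Lambert series stays bounded as \<open>t \<rightarrow> 1\<close>, but it
  dominates the theta series \<open>\<Sum> t ^ (j ^ 2)\<close>.\<close>

theorem dirichlet_series_chi_1_nonzero: "dirichlet_series \<chi> 1 \<noteq> 0"
proof
  assume zero: "dirichlet_series \<chi> 1 = 0"
  define J where "J = nat \<lceil>D\<rceil> + 1"
  have "(\<Sum>j=1..J. (1::real) ^ (j ^ 2)) \<le> D"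
  proof (rule tendsto_upperbound)
    show "((\<lambda>t::real. \<Sum>j=1..J. t ^ (j ^ 2)) \<longlongrightarrow> (\<Sum>j=1..J. 1 ^ (j ^ 2))) (at_left 1)"
      by (intro tendsto_intros)
    have "eventually (\<lambda>t::real. t \<in> {0<..<1}) (at_left 1)" by (rule eventually_at_left_real) simp
    then show "eventually (\<lambda>t::real. (\<Sum>j=1..J. t ^ (j ^ 2)) \<le> D) (at_left 1)"
    proof eventually_elim
      case (elim t)
      then show ?case
        using sum_power_square_le_lambert[of t J] abs_lambert_series_le[OF zero, of t] by simp
    qed
  qed auto
  then show False unfolding J_def by simp linarith
qed

end

section \<open>Perron's formula\<close>

lemma contour_integral_rectpath_split:
  assumes f: "continuous_on (path_image (rectpath a1 a3)) f"
  defines "a2 \<equiv> Complex (Re a3) (Im a1)" and "a4 \<equiv> Complex (Re a1) (Im a3)"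
  shows "contour_integral (rectpath a1 a3) f =
    contour_integral (linepath a1 a2) f + contour_integral (linepath a2 a3) f +
    contour_integral (linepath a3 a4) f + contour_integral (linepath a4 a1) f"
proof -
  have "path_image (rectpath a1 a3) = closed_segment a1 a2 \<union> closed_segment a2 a3 \<union>
      closed_segment a3 a4 \<union> closed_segment a4 a1"
    by (simp add: rectpath_def Let_def path_image_join Un_assoc a2_def a4_def)
  then have "f contour_integrable_on linepath a1 a2" "f contour_integrable_on linepath a2 a3"
    "f contour_integrable_on linepath a3 a4" "f contour_integrable_on linepath a4 a1"
    by (auto intro!: contour_integrable_continuous_linepath continuous_on_subset[OF f])
  then show ?thesis
    unfolding rectpath_def Let_def a2_def[symmetric] a4_def[symmetric]
    by (simp add: contour_integrable_join valid_path_join)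
qed

definition perron_integrand :: "nat \<Rightarrow> real \<Rightarrow> complex \<Rightarrow> complex" where
  "perron_integrand k y z = exp (of_real y * z) / z ^ Suc k"

definition riesz_kernel :: "nat \<Rightarrow> real \<Rightarrow> real" where
  "riesz_kernel k u = (if u \<ge> 0 then u ^ k / fact k else 0)"

lemma holomorphic_on_perron_integrand: "0 \<notin> S \<Longrightarrow> perron_integrand k y holomorphic_on S"
  unfolding perron_integrand_def[abs_def] by (intro holomorphic_intros) auto

lemma continuous_on_perron_integrand: "0 \<notin> S \<Longrightarrow> continuous_on S (perron_integrand k y)"
  by (intro holomorphic_on_imp_continuous_on holomorphic_on_perron_integrand)

lemma residue_perron_integrand: "residue (perron_integrand k y) 0 = of_real (y ^ k / fact k)"
proof -
  have "residue (\<lambda>z. exp (of_real y * z) / z ^ Suc k) 0 = fps_nth (fps_exp (of_real y :: complex)) k"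
    by (rule residue_fps_expansion_over_power_at_0) (rule has_fps_expansion_exp)
  then show ?thesis by (simp add: perron_integrand_def[abs_def] del: power_Suc)
qed

lemma norm_perron_integrand_le:
  assumes "y * Re z \<le> y * \<sigma>" "R \<le> norm z" "R \<ge> 1" "k \<ge> 1"
  shows "norm (perron_integrand k y z) \<le> exp (y * \<sigma>) / R ^ 2"
proof -
  have "R ^ 2 \<le> norm z ^ 2" using assms by (intro power_mono) auto
  also have "\<dots> \<le> norm z ^ Suc k" using assms by (intro power_increasing) auto
  finally have "R ^ 2 \<le> norm z ^ Suc k" .
  then show ?thesis
    unfolding perron_integrand_def norm_divide norm_power using assms
    by (intro frac_le) (auto simp del: power_Suc)
qed

lemma norm_contour_integral_perron_le:
  assumes "R \<ge> 1" "k \<ge> 1" "y * Re u \<le> y * \<sigma>" "y * Re v \<le> y * \<sigma>" "norm (v - u) \<le> L"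
    and away: "\<And>z. z \<in> closed_segment u v \<Longrightarrow> R \<le> norm z"
  shows "norm (contour_integral (linepath u v) (perron_integrand k y)) \<le> exp (y * \<sigma>) / R ^ 2 * L"
proof -
  have "closed_segment u v \<subseteq> {z. of_real y \<bullet> z \<le> y * \<sigma>}"
    using assms(3,4) by (intro closed_segment_subset convex_halfspace_le) (auto simp: inner_complex_def)
  then have "y * Re z \<le> y * \<sigma>" if "z \<in> closed_segment u v" for z
    using that by (auto simp: inner_complex_def)
  moreover have "0 \<notin> closed_segment u v" using away assms(1) by force
  ultimately have "norm (contour_integral (linepath u v) (perron_integrand k y)) \<le>
      exp (y * \<sigma>) / R ^ 2 * norm (v - u)"
    using assms(1,2) away
    by (intro contour_integral_bound_linepath norm_perron_integrand_le
        contour_integrable_continuous_linepath continuous_on_perron_integrand) auto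
  also have "\<dots> \<le> exp (y * \<sigma>) / R ^ 2 * L"
    using assms(5) by (intro mult_left_mono) auto
  finally show ?thesis .
qed

definition perron_detour :: "nat \<Rightarrow> real \<Rightarrow> real \<Rightarrow> real \<Rightarrow> real \<Rightarrow> complex" where
  "perron_detour k y \<sigma> R a =
     contour_integral (linepath (Complex \<sigma> R) (Complex a R)) (perron_integrand k y) +
     contour_integral (linepath (Complex a R) (Complex a (-R))) (perron_integrand k y) +
     contour_integral (linepath (Complex a (-R)) (Complex \<sigma> (-R))) (perron_integrand k y)"

lemma norm_perron_detour_le:
  assumes "R \<ge> 1" "k \<ge> 1" "y * a \<le> y * \<sigma>" "R \<le> \<bar>a\<bar>" "\<bar>a - \<sigma>\<bar> \<le> \<sigma> + R"
  shows "norm (perron_detour k y \<sigma> R a) \<le> exp (y * \<sigma>) / R ^ 2 * (2 * \<sigma> + 4 * R)"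
proof -
  have "norm (contour_integral (linepath (Complex \<sigma> R) (Complex a R)) (perron_integrand k y)) \<le>
      exp (y * \<sigma>) / R ^ 2 * (\<sigma> + R)"
  proof (rule norm_contour_integral_perron_le)
    show "R \<le> norm z" if "z \<in> closed_segment (Complex \<sigma> R) (Complex a R)" for z
      using that abs_Im_le_cmod[of z] by (simp add: closed_segment_same_Im)
  qed (use assms in \<open>auto simp: cmod_def\<close>)
  moreover have "norm (contour_integral (linepath (Complex a R) (Complex a (-R))) (perron_integrand k y)) \<le>
      exp (y * \<sigma>) / R ^ 2 * (2 * R)"
  proof (rule norm_contour_integral_perron_le)
    show "R \<le> norm z" if "z \<in> closed_segment (Complex a R) (Complex a (-R))" for z
      using that abs_Re_le_cmod[of z] assms(4) by (simp add: closed_segment_same_Re)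
  qed (use assms in \<open>auto simp: cmod_def real_sqrt_mult\<close>)
  moreover have "norm (contour_integral (linepath (Complex a (-R)) (Complex \<sigma> (-R)))
      (perron_integrand k y)) \<le>
      exp (y * \<sigma>) / R ^ 2 * (\<sigma> + R)"
  proof (rule norm_contour_integral_perron_le)
    show "R \<le> norm z" if "z \<in> closed_segment (Complex a (-R)) (Complex \<sigma> (-R))" for z
      using that abs_Im_le_cmod[of z] by (simp add: closed_segment_same_Im)
  qed (use assms in \<open>auto simp: cmod_def\<close>)
  moreover have "exp (y * \<sigma>) / R ^ 2 * (2 * \<sigma> + 4 * R) = exp (y * \<sigma>) / R ^ 2 * (\<sigma> + R) +
      exp (y * \<sigma>) / R ^ 2 * (2 * R) + exp (y * \<sigma>) / R ^ 2 * (\<sigma> + R)"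
    by (simp only: distrib_left[symmetric]) simp
  ultimately show ?thesis
    unfolding perron_detour_def
    by (simp only:) (intro order_trans[OF norm_triangle_ineq] add_mono)
qed

lemma perron_line_eq_contour_integral:
  assumes "R > 0"
  shows "\<i> * integral {-R..R} (\<lambda>t. perron_integrand k y (Complex \<sigma> t)) =
    contour_integral (linepath (Complex \<sigma> (-R)) (Complex \<sigma> R)) (perron_integrand k y)"
  by (rule contour_integral_linepath_same_Re[symmetric]) (use assms in auto)

text \<open>The rectangle is closed on the left of the line if \<open>y \<ge> 0\<close>, where it encloses the pole, and on
  the right otherwise.\<close>

lemma perron_line_eq_left_detour:
  assumes "\<sigma> > 0" "R \<ge> 1" "y \<ge> 0"
  shows "\<i> * integral {-R..R} (\<lambda>t. perron_integrand k y (Complex \<sigma> t)) -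
    2 * pi * \<i> * of_real (riesz_kernel k y) = - perron_detour k y \<sigma> R (-R)"
proof -
  let ?g = "perron_integrand k y" and ?u = "Complex (-R) (-R)" and ?v = "Complex \<sigma> R"
  have box: "0 \<in> box ?u ?v" using assms by (auto simp: in_box_complex_iff)
  then have path: "path_image (rectpath ?u ?v) \<subseteq> UNIV - {0}"
    using assms by (subst path_image_rectpath_cbox_minus_box) auto
  have "contour_integral (rectpath ?u ?v) ?g =
      2 * pi * \<i> * (\<Sum>p\<in>{0}. winding_number (rectpath ?u ?v) p * residue ?g p)"
    by (rule Residue_theorem) (use path holomorphic_on_perron_integrand in auto)
  then have "contour_integral (rectpath ?u ?v) ?g = 2 * pi * \<i> * of_real (riesz_kernel k y)"
    using winding_number_rectpath[OF box] assms(3)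
    by (simp add: residue_perron_integrand riesz_kernel_def)
  moreover have "continuous_on (path_image (rectpath ?u ?v)) ?g"
    using path by (intro continuous_on_perron_integrand) auto
  note contour_integral_rectpath_split[OF this]
  ultimately show ?thesis
    using assms(2) by (simp add: perron_line_eq_contour_integral perron_detour_def algebra_simps)
qed

lemma perron_line_eq_right_detour:
  assumes "\<sigma> > 0" "R \<ge> 1" "y < 0"
  shows "\<i> * integral {-R..R} (\<lambda>t. perron_integrand k y (Complex \<sigma> t)) -
    2 * pi * \<i> * of_real (riesz_kernel k y) = - perron_detour k y \<sigma> R (\<sigma> + R)"
proof -
  let ?g = "perron_integrand k y" and ?u = "Complex \<sigma> (-R)" and ?v = "Complex (\<sigma> + R) R"
  have path: "path_image (rectpath ?u ?v) \<subseteq> {z. Re z > 0}"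
  proof -
    have "path_image (rectpath ?u ?v) \<subseteq> cbox ?u ?v"
      using assms by (intro path_image_rectpath_subset_cbox) auto
    also have "\<dots> \<subseteq> {z. Re z > 0}" using assms by (auto simp: in_cbox_complex_iff)
    finally show ?thesis .
  qed
  have "(?g has_contour_integral 0) (rectpath ?u ?v)"
    by (rule Cauchy_theorem_convex_simple[of _ "{z. Re z > 0}"])
       (use path in \<open>auto intro!: holomorphic_on_perron_integrand convex_halfspace_Re_gt\<close>)
  then have "contour_integral (rectpath ?u ?v) ?g = 0" by (rule contour_integral_unique)
  moreover have "continuous_on (path_image (rectpath ?u ?v)) ?g"
    using path by (intro continuous_on_perron_integrand) auto
  note contour_integral_rectpath_split[OF this]
  moreover have "contour_integral (linepath w z) ?g = - contour_integral (linepath z w) ?g" for w z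
    by (metis contour_integral_reversepath reversepath_linepath valid_path_linepath)
  note this[of "Complex \<sigma> R" "Complex \<sigma> (-R)"] this[of "Complex (\<sigma> + R) (-R)" "Complex \<sigma> (-R)"]
    this[of "Complex (\<sigma> + R) R" "Complex \<sigma> R"] this[of "Complex (\<sigma> + R) R" "Complex (\<sigma> + R) (-R)"]
  ultimately show ?thesis
    using assms(2,3)
    by (simp add: perron_line_eq_contour_integral perron_detour_def riesz_kernel_def algebra_simps)
qed

lemma perron_truncated:
  assumes "\<sigma> > 0" "R \<ge> 1" "k \<ge> 1"
  shows "norm (integral {-R..R} (\<lambda>t. perron_integrand k y (Complex \<sigma> t)) -
           2 * pi * of_real (riesz_kernel k y)) \<le> exp (y * \<sigma>) / R ^ 2 * (2 * \<sigma> + 4 * R)"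
proof -
  let ?I = "integral {-R..R} (\<lambda>t. perron_integrand k y (Complex \<sigma> t))"
  have "norm (\<i> * ?I - 2 * pi * \<i> * of_real (riesz_kernel k y)) \<le>
      exp (y * \<sigma>) / R ^ 2 * (2 * \<sigma> + 4 * R)"
  proof (cases "y \<ge> 0")
    case True
    then show ?thesis
      unfolding perron_line_eq_left_detour[OF assms(1,2) True] norm_minus_cancel
      using assms mult_left_mono[of "-R" \<sigma> y] by (intro norm_perron_detour_le) auto
  next
    case False
    then show ?thesis
      unfolding perron_line_eq_right_detour[OF assms(1,2) not_le_imp_less[OF False]] norm_minus_cancel
      using assms by (intro norm_perron_detour_le mult_left_mono_neg) auto
  qed
  moreover have "\<i> * ?I - 2 * pi * \<i> * of_real (riesz_kernel k y) =
      \<i> * (?I - 2 * pi * of_real (riesz_kernel k y))"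
    by (simp add: algebra_simps)
  ultimately show ?thesis by (simp add: norm_mult)
qed

lemma integrable_inverse_1_plus_square_lborel: "integrable lborel (\<lambda>x::real. 1 / (1 + x\<^sup>2))"
  using integrable_inverse_1_plus_square by (simp add: set_integrable_def divide_inverse)

lemma height_power_div_norm_le:
  assumes "\<sigma> \<ge> 1" "k \<ge> m + 1"
  shows "(1 + \<bar>t\<bar>) ^ m * norm (1 / Complex \<sigma> t ^ Suc k) \<le> 2 ^ m * (1 / (1 + t\<^sup>2))"
proof -
  define z where "z = norm (Complex \<sigma> t)"
  have "z \<ge> 1" "\<bar>t\<bar> \<le> z"
    using abs_Re_le_cmod[of "Complex \<sigma> t"] abs_Im_le_cmod[of "Complex \<sigma> t"] assms by (auto simp: z_def)
  have "z ^ 2 = \<sigma>\<^sup>2 + t\<^sup>2" by (simp add: z_def cmod_def)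
  then have norm_square_ge: "1 + t\<^sup>2 \<le> z ^ 2" using assms by simp
  have "(1 + \<bar>t\<bar>) ^ m * (1 / z ^ Suc k) \<le> (2 * z) ^ m * (1 / z ^ (m + 2))"
    using \<open>z \<ge> 1\<close> \<open>\<bar>t\<bar> \<le> z\<close> assms
    by (intro mult_mono power_mono frac_le power_increasing) (auto simp del: power_Suc)
  also have "\<dots> = 2 ^ m * (1 / z ^ 2)"
    using \<open>z \<ge> 1\<close> by (simp add: power_mult_distrib power_add power2_eq_square)
  also have "\<dots> \<le> 2 ^ m * (1 / (1 + t\<^sup>2))"
    using norm_square_ge by (intro mult_left_mono frac_le) (auto simp: add_pos_nonneg)
  finally show ?thesis
    by (simp only: norm_divide norm_power norm_one z_def)
qed

lemma norm_perron_integrand_line_le: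
  assumes "\<sigma> \<ge> 1" "k \<ge> 1"
  shows "norm (perron_integrand k y (Complex \<sigma> t)) \<le> exp (y * \<sigma>) * (1 / (1 + t\<^sup>2))"
proof -
  have "norm (perron_integrand k y (Complex \<sigma> t)) = exp (y * \<sigma>) * norm (1 / Complex \<sigma> t ^ Suc k)"
    by (simp add: perron_integrand_def norm_divide norm_mult norm_power)
  also have "\<dots> \<le> exp (y * \<sigma>) * (1 / (1 + t\<^sup>2))"
    using height_power_div_norm_le[of \<sigma> 0 k t] assms by (intro mult_left_mono) auto
  finally show ?thesis .
qed

lemma integrable_perron_integrand:
  assumes "\<sigma> \<ge> 1" "k \<ge> 1"
  shows "integrable lborel (\<lambda>t. perron_integrand k y (Complex \<sigma> t))"
proof (rule Bochner_Integration.integrable_bound)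
  show "integrable lborel (\<lambda>t. exp (y * \<sigma>) * (1 / (1 + t\<^sup>2)))"
    by (intro integrable_mult_right integrable_inverse_1_plus_square_lborel)
  have "Complex \<sigma> t \<noteq> 0" for t using assms by (auto simp: complex_eq_iff)
  then have "continuous_on UNIV (\<lambda>t. perron_integrand k y (Complex \<sigma> t))"
    unfolding perron_integrand_def
    by (intro continuous_intros continuous_on_Complex) (auto simp del: power_Suc)
  then show "(\<lambda>t. perron_integrand k y (Complex \<sigma> t)) \<in> borel_measurable lborel"
    by (simp add: borel_measurable_continuous_onI)
  show "AE t in lborel. norm (perron_integrand k y (Complex \<sigma> t)) \<le> norm (exp (y * \<sigma>) * (1 / (1 + t\<^sup>2)))"
    using norm_perron_integrand_line_le[OF assms] by (intro AE_I2) simp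
qed

lemma integral_symmetric_tendsto_lborel:
  fixes g :: "real \<Rightarrow> 'a :: euclidean_space"
  assumes "integrable lborel g"
  shows "(\<lambda>n. integral {-real (Suc n)..real (Suc n)} g) \<longlonglongrightarrow> (\<integral>t. g t \<partial>lborel)"
proof -
  have "(\<lambda>n. \<integral>t. indicator {-real (Suc n)..real (Suc n)} t *\<^sub>R g t \<partial>lborel) \<longlonglongrightarrow> (\<integral>t. g t \<partial>lborel)"
  proof (rule integral_dominated_convergence[where w = "\<lambda>t. norm (g t)"])
    show "AE t in lborel. (\<lambda>n. indicator {-real (Suc n)..real (Suc n)} t *\<^sub>R g t) \<longlonglongrightarrow> g t"
    proof (rule AE_I2, rule tendsto_eventually)
      fix t :: real
      obtain n where n: "\<bar>t\<bar> \<le> real n" using real_arch_simple by blast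
      show "eventually (\<lambda>n. indicator {-real (Suc n)..real (Suc n)} t *\<^sub>R g t = g t) sequentially"
        using eventually_ge_at_top[of n] by eventually_elim (use n in \<open>auto simp: indicator_def abs_le_iff\<close>)
    qed
  qed (use assms in \<open>auto simp: indicator_def\<close>)
  moreover have "(\<integral>t. indicator {-real (Suc n)..real (Suc n)} t *\<^sub>R g t \<partial>lborel) =
      integral {-real (Suc n)..real (Suc n)} g" for n
  proof -
    have "set_integrable lborel {-real (Suc n)..real (Suc n)} g"
      unfolding set_integrable_def by (rule integrable_mult_indicator[OF _ assms]) auto
    then show ?thesis
      using set_borel_integral_eq_integral(2) by (simp add: set_lebesgue_integral_def)
  qed
  ultimately show ?thesis by (simp only:)
qed

theorem perron_formula:
  assumes "\<sigma> \<ge> 1" "k \<ge> 1"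
  shows "(\<integral>t. perron_integrand k y (Complex \<sigma> t) \<partial>lborel) = 2 * pi * of_real (riesz_kernel k y)"
proof (rule LIMSEQ_unique)
  let ?I = "\<lambda>n. integral {-real (Suc n)..real (Suc n)} (\<lambda>t. perron_integrand k y (Complex \<sigma> t))"
  show "?I \<longlonglongrightarrow> (\<integral>t. perron_integrand k y (Complex \<sigma> t) \<partial>lborel)"
    by (intro integral_symmetric_tendsto_lborel integrable_perron_integrand assms)
  have "(\<lambda>n. ?I n - 2 * pi * of_real (riesz_kernel k y)) \<longlonglongrightarrow> 0"
  proof (rule Lim_null_comparison)
    show "eventually (\<lambda>n. norm (?I n - 2 * pi * of_real (riesz_kernel k y)) \<le>
        exp (y * \<sigma>) / real (Suc n) ^ 2 * (2 * \<sigma> + 4 * real (Suc n))) sequentially"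
      using assms by (intro always_eventually allI perron_truncated) auto
    show "(\<lambda>n. exp (y * \<sigma>) / real (Suc n) ^ 2 * (2 * \<sigma> + 4 * real (Suc n))) \<longlonglongrightarrow> 0"
      by real_asymp
  qed
  then show "?I \<longlonglongrightarrow> 2 * pi * of_real (riesz_kernel k y)"
    by (simp add: LIM_zero_iff)
qed

section \<open>Riesz means\<close>

definition riesz_mean :: "(nat \<Rightarrow> real) \<Rightarrow> nat \<Rightarrow> real \<Rightarrow> real" where
  "riesz_mean b k y = (\<Sum>n=1..nat \<lfloor>exp y\<rfloor>. b n * riesz_kernel k (y - ln (real n)))"

abbreviation riesz_one :: "nat \<Rightarrow> real \<Rightarrow> real" where
  "riesz_one \<equiv> riesz_mean (\<lambda>_. 1)"

lemma riesz_kernel_eq_0: "u < 0 \<Longrightarrow> riesz_kernel k u = 0"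
  by (simp add: riesz_kernel_def)

lemma less_ln_of_nat_floor_exp_less:
  assumes "nat \<lfloor>exp y\<rfloor> < n"
  shows "y < ln (real n)"
proof -
  have "exp y < real n" using assms by linarith
  moreover have "n > 0" using assms by simp
  ultimately show ?thesis by (simp add: ln_less_cancel_iff[of "exp y", symmetric] del: ln_less_cancel_iff)
qed

lemma riesz_mean_eq_sum:
  assumes "nat \<lfloor>exp y\<rfloor> \<le> N"
  shows "riesz_mean b k y = (\<Sum>n=1..N. b n * riesz_kernel k (y - ln (real n)))"
  unfolding riesz_mean_def
proof (rule sum.mono_neutral_left)
  show "\<forall>n\<in>{1..N} - {1..nat \<lfloor>exp y\<rfloor>}. b n * riesz_kernel k (y - ln (real n)) = 0"
    using less_ln_of_nat_floor_exp_less[of y] by (auto intro!: riesz_kernel_eq_0 simp: not_le)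
qed (use assms in auto)

lemma riesz_mean_sums:
  "(\<lambda>n. b (Suc n) * riesz_kernel k (y - ln (real (Suc n)))) sums riesz_mean b k y"
proof -
  have "(\<lambda>n. b (Suc n) * riesz_kernel k (y - ln (real (Suc n)))) sums
      (\<Sum>n<nat \<lfloor>exp y\<rfloor>. b (Suc n) * riesz_kernel k (y - ln (real (Suc n))))"
  proof (rule sums_finite)
    fix n assume "n \<notin> {..<nat \<lfloor>exp y\<rfloor>}"
    then have "y < ln (real (Suc n))" by (intro less_ln_of_nat_floor_exp_less) simp
    then show "b (Suc n) * riesz_kernel k (y - ln (real (Suc n))) = 0"
      by (simp add: riesz_kernel_eq_0)
  qed simp
  then show ?thesis
    by (simp add: riesz_mean_def sum.atLeast1_atMost_eq)
qed

lemma
  fixes f :: "nat \<Rightarrow> 'a \<Rightarrow> 'b :: {banach, second_countable_topology}"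
  assumes f: "\<And>n. integrable M (f n)" and a: "summable a" and w: "integrable M w"
    and f_le: "\<And>n x. norm (f n x) \<le> a n * w x"
  shows integrable_suminf_dominated: "integrable M (\<lambda>x. \<Sum>n. f n x)"
    and sums_integral_dominated: "(\<lambda>n. integral\<^sup>L M (f n)) sums (\<integral>x. (\<Sum>n. f n x) \<partial>M)"
proof -
  have ae_summable: "AE x in M. summable (\<lambda>n. norm (f n x))"
  proof (rule AE_I2)
    fix x
    show "summable (\<lambda>n. norm (f n x))"
      by (rule summable_comparison_test'[OF summable_mult2[OF a, of "w x"]]) (use f_le in auto)
  qed
  have summable_integrals: "summable (\<lambda>n. \<integral>x. norm (f n x) \<partial>M)"
  proof (rule summable_comparison_test'[OF summable_mult2[OF a, of "integral\<^sup>L M w"]])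
    fix n
    have "(\<integral>x. norm (f n x) \<partial>M) \<le> (\<integral>x. a n * w x \<partial>M)"
      by (intro integral_mono integrable_norm f integrable_mult_right w f_le)
    then show "norm (\<integral>x. norm (f n x) \<partial>M) \<le> a n * integral\<^sup>L M w"
      by (simp add: integral_nonneg_AE)
  qed
  show "integrable M (\<lambda>x. \<Sum>n. f n x)"
    by (rule integrable_suminf[OF f ae_summable summable_integrals])
  show "(\<lambda>n. integral\<^sup>L M (f n)) sums (\<integral>x. (\<Sum>n. f n x) \<partial>M)"
    by (rule sums_integral[OF f ae_summable summable_integrals])
qed

lemma dirichlet_term_mult_perron_integrand:
  assumes "n > 0"
  shows "of_real (b n) * of_nat n powr (-s) * perron_integrand k y s =
    of_real (b n) * perron_integrand k (y - ln (real n)) s"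
proof -
  have "of_nat n powr (-s) = exp (- s * of_real (ln (real n)))"
    using assms by (simp add: powr_def)
  then show ?thesis
    by (simp add: perron_integrand_def algebra_simps flip: exp_add)
qed

lemma
  assumes b: "abs_conv b" and "\<sigma> > 1" "k \<ge> 1"
  shows integrable_dirichlet_series_perron:
      "integrable lborel (\<lambda>t. dirichlet_series b (Complex \<sigma> t) * perron_integrand k y (Complex \<sigma> t))"
    and riesz_mean_perron: "2 * pi * of_real (riesz_mean b k y) =
      (\<integral>t. dirichlet_series b (Complex \<sigma> t) * perron_integrand k y (Complex \<sigma> t) \<partial>lborel)"
proof -
  define f where "f n t = of_real (b (Suc n)) * of_nat (Suc n) powr (- Complex \<sigma> t) *
      perron_integrand k y (Complex \<sigma> t)" for n t
  have f_eq: "f n t = of_real (b (Suc n)) * perron_integrand k (y - ln (real (Suc n))) (Complex \<sigma> t)" for n t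
    unfolding f_def by (rule dirichlet_term_mult_perron_integrand) simp
  have integrable: "integrable lborel (f n)" for n
    unfolding f_eq using assms by (intro integrable_mult_right integrable_perron_integrand) auto
  have "summable (\<lambda>n. \<bar>b n\<bar> * real n powr (-\<sigma>))"
    using b \<open>\<sigma> > 1\<close> by (simp add: abs_conv_def)
  then have coeffs: "summable (\<lambda>n. \<bar>b (Suc n)\<bar> * real (Suc n) powr (-\<sigma>))"
    by (subst summable_Suc_iff)
  have weight: "integrable lborel (\<lambda>t. exp (y * \<sigma>) * (1 / (1 + t\<^sup>2)))"
    by (intro integrable_mult_right integrable_inverse_1_plus_square_lborel)
  have f_le: "norm (f n t) \<le> \<bar>b (Suc n)\<bar> * real (Suc n) powr (-\<sigma>) * (exp (y * \<sigma>) * (1 / (1 + t\<^sup>2)))"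
    for n t
    unfolding f_def norm_mult[of "_ * _"] norm_dirichlet_term complex.sel using assms
    by (intro mult_left_mono norm_perron_integrand_line_le) auto
  note dominated = integrable_suminf_dominated[OF integrable coeffs weight f_le]
    sums_integral_dominated[OF integrable coeffs weight f_le]
  have suminf: "(\<Sum>n. f n t) = dirichlet_series b (Complex \<sigma> t) * perron_integrand k y (Complex \<sigma> t)" for t
    unfolding f_def using dirichlet_series_sums_Suc[OF b, of "Complex \<sigma> t"] \<open>\<sigma> > 1\<close>
    by (intro sums_unique[symmetric] sums_mult2) simp
  show "integrable lborel (\<lambda>t. dirichlet_series b (Complex \<sigma> t) * perron_integrand k y (Complex \<sigma> t))"
    using dominated(1) unfolding suminf .
  have "integral\<^sup>L lborel (f n) =
      of_real (2 * pi * (b (Suc n) * riesz_kernel k (y - ln (real (Suc n)))))" for n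
    unfolding f_eq using assms by (simp add: perron_formula del: of_nat_Suc)
  then have "(\<lambda>n. integral\<^sup>L lborel (f n)) sums of_real (2 * pi * riesz_mean b k y)"
    by (simp only:) (intro sums_of_real sums_mult riesz_mean_sums)
  then show "2 * pi * of_real (riesz_mean b k y) =
      (\<integral>t. dirichlet_series b (Complex \<sigma> t) * perron_integrand k y (Complex \<sigma> t) \<partial>lborel)"
    using dominated(2) unfolding suminf by (simp add: sums_iff)
qed

lemma abs_riesz_mean_le:
  assumes "abs_conv b" "\<sigma> > 1" "k \<ge> m + 1" "C \<ge> 0"
    and growth: "\<And>t. norm (dirichlet_series b (Complex \<sigma> t)) \<le> C * (1 + \<bar>t\<bar>) ^ m"
  shows "\<bar>riesz_mean b k y\<bar> \<le> C * exp (y * \<sigma>) * 2 ^ m * (\<integral>t. 1 / (1 + t\<^sup>2) \<partial>lborel)"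
proof -
  let ?g = "\<lambda>t. dirichlet_series b (Complex \<sigma> t) * perron_integrand k y (Complex \<sigma> t)"
  have g_le: "norm (?g t) \<le> C * exp (y * \<sigma>) * 2 ^ m * (1 / (1 + t\<^sup>2))" for t
  proof -
    have "norm (?g t) = norm (dirichlet_series b (Complex \<sigma> t)) * exp (y * \<sigma>) *
        norm (1 / Complex \<sigma> t ^ Suc k)"
      by (simp add: perron_integrand_def norm_mult norm_divide norm_power)
    also have "\<dots> \<le> C * (1 + \<bar>t\<bar>) ^ m * exp (y * \<sigma>) * norm (1 / Complex \<sigma> t ^ Suc k)"
      by (intro mult_right_mono growth) auto
    also have "\<dots> = C * exp (y * \<sigma>) * ((1 + \<bar>t\<bar>) ^ m * norm (1 / Complex \<sigma> t ^ Suc k))"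
      by simp
    also have "\<dots> \<le> C * exp (y * \<sigma>) * (2 ^ m * (1 / (1 + t\<^sup>2)))"
      using assms by (intro mult_left_mono height_power_div_norm_le) auto
    finally show ?thesis by simp
  qed
  have "1 * \<bar>riesz_mean b k y\<bar> \<le> 2 * pi * \<bar>riesz_mean b k y\<bar>"
    using pi_gt3 by (intro mult_right_mono) auto
  also have "\<dots> = norm (\<integral>t. ?g t \<partial>lborel)"
    using assms by (simp add: norm_mult flip: riesz_mean_perron)
  also have "\<dots> \<le> (\<integral>t. norm (?g t) \<partial>lborel)" by (rule integral_norm_bound)
  also have "\<dots> \<le> (\<integral>t. C * exp (y * \<sigma>) * 2 ^ m * (1 / (1 + t\<^sup>2)) \<partial>lborel)"
    using assms
    by (intro integral_mono integrable_norm integrable_dirichlet_series_perron g_le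
        integrable_mult_right integrable_inverse_1_plus_square_lborel) auto
  finally show ?thesis by (simp only: integral_mult_right_zero mult_1)
qed

lemma riesz_mean_bigo_exp:
  assumes "abs_conv b" "polynomial_growth b m" "k \<ge> m + 1"
  shows "riesz_mean b k \<in> O(exp)"
proof -
  obtain C r where "C \<ge> 0" "0 < r" and growth: "\<And>s. 1 < Re s \<Longrightarrow> Re s \<le> 1 + r \<Longrightarrow>
      norm (dirichlet_series b s) \<le> C * (1 + \<bar>Im s\<bar>) ^ m"
    using polynomial_growthE[OF assms(2)] by metis
  let ?J = "\<integral>t. 1 / (1 + t\<^sup>2) \<partial>lborel :: real"
  have "\<bar>riesz_mean b k y\<bar> \<le> C * exp 1 * 2 ^ m * ?J * exp y" if y: "y \<ge> 1 / r" for y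
  proof -
    have "y > 0" using y \<open>0 < r\<close> by (meson less_le_trans zero_less_divide_1_iff)
    then have \<sigma>: "1 + 1 / y \<le> 1 + r" "y * (1 + 1 / y) = 1 + y"
      using y \<open>0 < r\<close> by (auto simp: field_simps)
    have "\<bar>riesz_mean b k y\<bar> \<le> C * exp (y * (1 + 1 / y)) * 2 ^ m * ?J"
      using assms \<open>C \<ge> 0\<close> \<open>y > 0\<close> growth[of "Complex (1 + 1 / y) _"] \<sigma>(1)
      by (intro abs_riesz_mean_le) auto
    then show ?thesis by (simp add: \<sigma>(2) exp_add mult_ac)
  qed
  then show ?thesis
    by (intro bigoI[where c = "C * exp 1 * 2 ^ m * ?J"]
        eventually_mono[OF eventually_ge_at_top[of "1 / r"]]) simp
qed

lemma riesz_kernel_mult: "u * riesz_kernel k u = real (Suc k) * riesz_kernel (Suc k) u"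
  by (simp add: riesz_kernel_def divide_simps)

text \<open>Splitting \<open>y = ln n + (y - ln n)\<close> gains a factor \<open>y\<close> without integrating by parts.\<close>

lemma riesz_mean_mult:
  "y * riesz_mean b k y = riesz_mean (\<lambda>n. b n * ln (real n)) k y + real (Suc k) * riesz_mean b (Suc k) y"
proof -
  have "y * (b n * riesz_kernel k (y - ln (real n))) =
      b n * ln (real n) * riesz_kernel k (y - ln (real n)) +
      b n * ((y - ln (real n)) * riesz_kernel k (y - ln (real n)))" for n
    by (simp add: algebra_simps)
  then have "y * (b n * riesz_kernel k (y - ln (real n))) =
      b n * ln (real n) * riesz_kernel k (y - ln (real n)) +
      real (Suc k) * (b n * riesz_kernel (Suc k) (y - ln (real n)))" for n
    unfolding riesz_kernel_mult by (simp only: mult_ac)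
  then show ?thesis
    unfolding riesz_mean_def sum_distrib_left sum.distrib[symmetric] by (intro sum.cong refl)
qed

lemma riesz_mean_bigo:
  assumes "abs_conv b" "polynomial_growth b m" "polynomial_growth (\<lambda>n. b n * ln (real n)) m"
    and "k \<ge> m + 1"
  shows "riesz_mean b k \<in> O(\<lambda>y. exp y / y)"
proof -
  have "riesz_mean (\<lambda>n. b n * ln (real n)) k \<in> O(exp)" "riesz_mean b (Suc k) \<in> O(exp)"
    using assms by (auto intro!: riesz_mean_bigo_exp[where m = m] abs_conv_mult_ln)
  then have "(\<lambda>y. riesz_mean (\<lambda>n. b n * ln (real n)) k y + real (Suc k) * riesz_mean b (Suc k) y) \<in> O(exp)"
    by (intro sum_in_bigo) (simp_all del: of_nat_Suc)
  then have "(\<lambda>y. y * riesz_mean b k y) \<in> O(exp)"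
    unfolding riesz_mean_mult .
  moreover have "eventually (\<lambda>y::real. y \<noteq> 0) at_top"
    using eventually_gt_at_top[of 0] by eventually_elim simp
  ultimately have "(\<lambda>y. y * riesz_mean b k y / y) \<in> O(\<lambda>y. exp y / y)"
    by (rule landau_o.big.divide_right[rotated])
  moreover have "eventually (\<lambda>y. y * riesz_mean b k y / y = riesz_mean b k y) at_top"
    using eventually_gt_at_top[of 0] by eventually_elim simp
  note landau_o.big.in_cong[OF this]
  ultimately show ?thesis by blast
qed

lemma riesz_kernel_difference:
  assumes "\<delta> > 0"
  shows "\<delta> * riesz_kernel k u \<le> riesz_kernel (Suc k) (u + \<delta>) - riesz_kernel (Suc k) u"
    and "riesz_kernel (Suc k) (u + \<delta>) - riesz_kernel (Suc k) u \<le> \<delta> * riesz_kernel k (u + \<delta>)"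
proof -
  consider (nonneg) "u \<ge> 0" | (straddling) "u < 0" "u + \<delta> \<ge> 0" | (neg) "u + \<delta> < 0" using assms by linarith
  then have "\<delta> * riesz_kernel k u \<le> riesz_kernel (Suc k) (u + \<delta>) - riesz_kernel (Suc k) u \<and>
    riesz_kernel (Suc k) (u + \<delta>) - riesz_kernel (Suc k) u \<le> \<delta> * riesz_kernel k (u + \<delta>)"
  proof cases
    case nonneg
    have "\<exists>z>u. z < u + \<delta> \<and> (u + \<delta>) ^ Suc k / fact (Suc k) - u ^ Suc k / fact (Suc k) =
        (u + \<delta> - u) * (z ^ k / fact k)"
    proof (rule MVT2)
      show "((\<lambda>x. x ^ Suc k / fact (Suc k)) has_real_derivative x ^ k / fact k) (at x)" for x :: real
        by (auto intro!: derivative_eq_intros simp: divide_simps simp del: power_Suc)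
    qed (use assms in auto)
    then obtain z where z: "z > u" "z < u + \<delta>"
      "(u + \<delta>) ^ Suc k / fact (Suc k) - u ^ Suc k / fact (Suc k) = \<delta> * (z ^ k / fact k)" by auto
    have "\<delta> * (u ^ k / fact k) \<le> \<delta> * (z ^ k / fact k)"
      "\<delta> * (z ^ k / fact k) \<le> \<delta> * ((u + \<delta>) ^ k / fact k)"
      using z nonneg assms by (auto intro!: mult_left_mono divide_right_mono power_mono)
    then show ?thesis
      using nonneg assms z(3) by (simp add: riesz_kernel_def del: power_Suc fact_Suc)
  next
    case straddling
    have "(u + \<delta>) ^ Suc k / fact (Suc k) = (u + \<delta>) / real (Suc k) * ((u + \<delta>) ^ k / fact k)" by simp
    also have "\<dots> \<le> \<delta> * ((u + \<delta>) ^ k / fact k)"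
    proof (rule mult_right_mono)
      have "(u + \<delta>) / real (Suc k) \<le> (u + \<delta>) / 1" using straddling by (intro divide_left_mono) auto
      then show "(u + \<delta>) / real (Suc k) \<le> \<delta>" using straddling by simp
    qed (use straddling in auto)
    finally show ?thesis using straddling by (simp add: riesz_kernel_def del: power_Suc fact_Suc)
  qed (use assms in \<open>simp add: riesz_kernel_def\<close>)
  then show "\<delta> * riesz_kernel k u \<le> riesz_kernel (Suc k) (u + \<delta>) - riesz_kernel (Suc k) u"
    and "riesz_kernel (Suc k) (u + \<delta>) - riesz_kernel (Suc k) u \<le> \<delta> * riesz_kernel k (u + \<delta>)" by auto
qed

lemma riesz_mean_difference:
  assumes b_ge: "\<And>n. n \<ge> 1 \<Longrightarrow> b n \<ge> -1" and "\<delta> > 0"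
  shows "\<delta> * riesz_mean b k y \<le> riesz_mean b (Suc k) (y + \<delta>) - riesz_mean b (Suc k) y +
           \<delta> * (riesz_one k (y + \<delta>) - riesz_one k y)"
    and "riesz_mean b (Suc k) (y + \<delta>) - riesz_mean b (Suc k) y -
           \<delta> * (riesz_one k (y + \<delta>) - riesz_one k y) \<le> \<delta> * riesz_mean b k (y + \<delta>)"
proof -
  define N where "N = nat \<lfloor>exp (y + \<delta>)\<rfloor>"
  have N: "nat \<lfloor>exp y\<rfloor> \<le> N" "nat \<lfloor>exp (y + \<delta>)\<rfloor> \<le> N"
    unfolding N_def using \<open>\<delta> > 0\<close> by (auto intro!: nat_mono floor_mono)
  define low high diff where "low n = riesz_kernel k (y - ln (real n))"
    and "high n = riesz_kernel k (y + \<delta> - ln (real n))"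
    and "diff n = riesz_kernel (Suc k) (y + \<delta> - ln (real n)) - riesz_kernel (Suc k) (y - ln (real n))" for n
  have diff: "\<delta> * low n \<le> diff n" "diff n \<le> \<delta> * high n" for n
    using riesz_kernel_difference[OF \<open>\<delta> > 0\<close>, of k "y - ln (real n)"]
    by (simp_all add: low_def high_def diff_def algebra_simps)
  have "0 \<le> (b n + 1) * (diff n - \<delta> * low n)" "0 \<le> (b n + 1) * (\<delta> * high n - diff n)" if "n \<ge> 1" for n
    using b_ge[OF that] diff[of n] by simp_all
  then have termwise: "\<delta> * low n * b n \<le> b n * diff n + \<delta> * (high n - low n)"
      "b n * diff n - \<delta> * (high n - low n) \<le> \<delta> * high n * b n" if "n \<ge> 1" for n
    using diff[of n] that by (auto simp: algebra_simps) (smt (verit))+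
  have "(\<Sum>n=1..N. \<delta> * low n * b n) \<le> (\<Sum>n=1..N. b n * diff n + \<delta> * (high n - low n))"
    by (intro sum_mono termwise) simp
  then show "\<delta> * riesz_mean b k y \<le> riesz_mean b (Suc k) (y + \<delta>) - riesz_mean b (Suc k) y +
           \<delta> * (riesz_one k (y + \<delta>) - riesz_one k y)"
    unfolding riesz_mean_eq_sum[OF N(1)] riesz_mean_eq_sum[OF N(2)] low_def high_def diff_def
    by (simp add: sum_distrib_left sum.distrib sum_subtractf algebra_simps)
  have "(\<Sum>n=1..N. b n * diff n - \<delta> * (high n - low n)) \<le> (\<Sum>n=1..N. \<delta> * high n * b n)"
    by (intro sum_mono termwise) simp
  then show "riesz_mean b (Suc k) (y + \<delta>) - riesz_mean b (Suc k) y -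
           \<delta> * (riesz_one k (y + \<delta>) - riesz_one k y) \<le> \<delta> * riesz_mean b k (y + \<delta>)"
    unfolding riesz_mean_eq_sum[OF N(1)] riesz_mean_eq_sum[OF N(2)] low_def high_def diff_def
    by (simp add: sum_distrib_left sum.distrib sum_subtractf algebra_simps)
qed

lemma sum_inverse_sqrt_le: "(\<Sum>n=1..N. 1 / sqrt (real n)) \<le> 2 * sqrt (real N)"
proof (induction N)
  case (Suc N)
  define p q where "p = sqrt (real (Suc N))" and "q = sqrt (real N)"
  have p: "p > 0" "p\<^sup>2 = q\<^sup>2 + 1" by (auto simp: p_def q_def)
  have "0 \<le> (p - q)\<^sup>2" by simp
  then have "1 \<le> 2 * (p - q) * p" using p(2) by (simp add: power2_eq_square algebra_simps)
  then have "1 / p \<le> 2 * (p - q)" using p(1) by (simp add: field_simps)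
  with Suc show ?case by (simp add: p_def q_def)
qed simp

lemma riesz_kernel_le_exp: "riesz_kernel k u \<le> 2 ^ k * exp (u / 2)"
proof (cases "u \<ge> 0")
  case True
  have exp_sums: "(\<lambda>n. (u / 2) ^ n /\<^sub>R fact n) sums exp (u / 2)" by (rule exp_converges)
  have "(\<Sum>n\<in>{k}. (u / 2) ^ n /\<^sub>R fact n) \<le> (\<Sum>n. (u / 2) ^ n /\<^sub>R fact n)"
    using True by (intro sum_le_suminf sums_summable[OF exp_sums]) auto
  then have "(u / 2) ^ k / fact k \<le> exp (u / 2)"
    using sums_unique[OF exp_sums] by (simp add: inverse_eq_divide)
  then have "2 ^ k * ((u / 2) ^ k / fact k) \<le> 2 ^ k * exp (u / 2)" by (intro mult_left_mono) auto
  then show ?thesis using True by (simp add: riesz_kernel_def power_divide)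
qed (simp add: riesz_kernel_def)

lemma riesz_one_le: "riesz_one k y \<le> 2 ^ Suc k * exp y"
proof -
  define N where "N = nat \<lfloor>exp y\<rfloor>"
  have "riesz_kernel k (y - ln (real n)) \<le> 2 ^ k * exp (y / 2) * (1 / sqrt (real n))" if "n \<in> {1..N}" for n
  proof -
    have "exp (ln (real n) / 2) = sqrt (real n)"
      using that by (simp add: ln_sqrt[symmetric])
    then show ?thesis
      using riesz_kernel_le_exp[of k "y - ln (real n)"] by (simp add: diff_divide_distrib exp_diff)
  qed
  then have "riesz_one k y \<le> (\<Sum>n=1..N. 2 ^ k * exp (y / 2) * (1 / sqrt (real n)))"
    unfolding riesz_mean_def N_def mult_1 by (rule sum_mono)
  also have "\<dots> \<le> 2 ^ k * exp (y / 2) * (2 * sqrt (real N))"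
    unfolding sum_distrib_left[symmetric] by (intro mult_left_mono sum_inverse_sqrt_le) auto
  also have "\<dots> \<le> 2 ^ k * exp (y / 2) * (2 * sqrt (exp y))"
    by (intro mult_left_mono) (auto simp: N_def)
  also have "sqrt (exp y) = exp (y / 2)"
    by (rule real_sqrt_unique) (auto simp: exp_double[symmetric])
  also have "2 ^ k * exp (y / 2) * (2 * exp (y / 2)) = 2 ^ Suc k * exp y"
    by (simp add: exp_add[symmetric])
  finally show ?thesis .
qed

lemma riesz_mean_0: "riesz_mean b 0 y = (\<Sum>n=1..nat \<lfloor>exp y\<rfloor>. b n)"
  unfolding riesz_mean_def
proof (rule sum.cong)
  fix n assume "n \<in> {1..nat \<lfloor>exp y\<rfloor>}"
  then have "real n \<le> exp y" "real n > 0" by (auto simp: le_nat_floor le_floor_iff nat_le_iff) linarith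
  then have "ln (real n) \<le> y" by (metis ln_exp ln_le_cancel_iff exp_gt_zero)
  then show "b n * riesz_kernel 0 (y - ln (real n)) = b n" by (simp add: riesz_kernel_def)
qed simp

lemma riesz_one_Suc_difference_le:
  assumes "\<delta> > 0"
  shows "riesz_one (Suc k) (y + \<delta>) - riesz_one (Suc k) y \<le> \<delta> * riesz_one k (y + \<delta>)"
proof -
  define N where "N = nat \<lfloor>exp (y + \<delta>)\<rfloor>"
  have N: "nat \<lfloor>exp y\<rfloor> \<le> N" "nat \<lfloor>exp (y + \<delta>)\<rfloor> \<le> N"
    unfolding N_def using assms by (auto intro!: nat_mono floor_mono)
  have "riesz_kernel (Suc k) (y + \<delta> - ln (real n)) - riesz_kernel (Suc k) (y - ln (real n)) \<le>
      \<delta> * riesz_kernel k (y + \<delta> - ln (real n))" for n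
    using riesz_kernel_difference(2)[OF assms, of k "y - ln (real n)"] by (simp add: algebra_simps)
  then show ?thesis
    unfolding riesz_mean_eq_sum[OF N(1)] riesz_mean_eq_sum[OF N(2)] sum_subtractf[symmetric]
      sum_distrib_left by (intro sum_mono) simp
qed

lemma riesz_one_difference_le:
  assumes \<delta>: "0 < \<delta>" "\<delta> \<le> 1"
  shows "riesz_one k (y + \<delta>) - riesz_one k y \<le> 2 ^ (k + 2) * (\<delta> * exp y) + 1"
proof (cases k)
  case 0
  have "exp \<delta> \<le> 1 + \<delta> + \<delta>\<^sup>2" using \<delta> by (intro exp_bound) auto
  also have "\<delta>\<^sup>2 \<le> \<delta>" using \<delta> by (simp add: power2_eq_square mult_left_le)
  finally have "exp y * exp \<delta> \<le> exp y * (1 + 2 * \<delta>)" by (intro mult_left_mono) auto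
  then have "exp (y + \<delta>) \<le> exp y + 2 * (\<delta> * exp y)" by (simp add: exp_add algebra_simps)
  moreover have "real (nat \<lfloor>exp (y + \<delta>)\<rfloor>) \<le> exp (y + \<delta>)" by simp
  moreover have "real (nat \<lfloor>exp y\<rfloor>) > exp y - 1" by linarith
  moreover have "\<delta> * exp y \<ge> 0" using \<delta> by simp
  ultimately have "real (nat \<lfloor>exp (y + \<delta>)\<rfloor>) - real (nat \<lfloor>exp y\<rfloor>) \<le> 4 * (\<delta> * exp y) + 1" by linarith
  then show ?thesis by (simp add: 0 riesz_mean_0)
next
  case (Suc j)
  have "exp \<delta> \<le> exp 1" using \<delta> by simp
  also have "\<dots> \<le> 4" using exp_le by simp
  finally have "exp (y + \<delta>) \<le> exp y * 4" by (simp add: exp_add)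
  then have "riesz_one j (y + \<delta>) \<le> 2 ^ Suc j * (exp y * 4)"
    by (intro order_trans[OF riesz_one_le] mult_left_mono) auto
  then have "\<delta> * riesz_one j (y + \<delta>) \<le> \<delta> * (2 ^ Suc j * (exp y * 4))"
    using \<delta> by (intro mult_left_mono) auto
  then show ?thesis
    using riesz_one_Suc_difference_le[OF \<delta>(1), of j y] by (simp add: Suc mult_ac)
qed

definition riesz_saving :: "(nat \<Rightarrow> real) \<Rightarrow> nat \<Rightarrow> bool" where
  "riesz_saving b k \<longleftrightarrow> (\<exists>\<epsilon>. 0 < \<epsilon> \<and> \<epsilon> \<le> 1 \<and> riesz_mean b k \<in> O(\<lambda>y. exp y / y powr \<epsilon>))"

lemma abs_riesz_mean_le_differences:
  assumes b_ge: "\<And>n. n \<ge> 1 \<Longrightarrow> b n \<ge> -1" and \<delta>: "0 < \<delta>" "\<delta> \<le> 1"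
  shows "\<bar>riesz_mean b k y\<bar> \<le>
    (\<bar>riesz_mean b (Suc k) (y + \<delta>)\<bar> + \<bar>riesz_mean b (Suc k) y\<bar> +
      \<bar>riesz_mean b (Suc k) (y - \<delta>)\<bar>) * (1 / \<delta>) +
    2 ^ (k + 2) * (\<delta> * exp y) + 1"
proof -
  define B where "B = 2 ^ (k + 2) * (\<delta> * exp y) + 1"
  have "riesz_one k (y + \<delta>) - riesz_one k y \<le> B"
    unfolding B_def by (rule riesz_one_difference_le[OF \<delta>])
  then have upper: "\<delta> * riesz_mean b k y \<le>
      riesz_mean b (Suc k) (y + \<delta>) - riesz_mean b (Suc k) y + \<delta> * B"
    using \<delta> by (intro order_trans[OF riesz_mean_difference(1)[where b = b, OF b_ge]]
        add_left_mono mult_left_mono) auto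
  have "riesz_one k (y - \<delta> + \<delta>) - riesz_one k (y - \<delta>) \<le> 2 ^ (k + 2) * (\<delta> * exp (y - \<delta>)) + 1"
    by (rule riesz_one_difference_le[OF \<delta>])
  also have "\<dots> \<le> B"
    unfolding B_def using \<delta> by (intro add_right_mono mult_left_mono) auto
  finally have "\<delta> * (riesz_one k (y - \<delta> + \<delta>) - riesz_one k (y - \<delta>)) \<le> \<delta> * B"
    using \<delta> by (intro mult_left_mono) auto
  with riesz_mean_difference(2)[where b = b and k = k and y = "y - \<delta>", OF b_ge \<delta>(1)]
  have lower: "riesz_mean b (Suc k) y - riesz_mean b (Suc k) (y - \<delta>) - \<delta> * B \<le> \<delta> * riesz_mean b k y"
    by simp
  let ?S = "\<bar>riesz_mean b (Suc k) (y + \<delta>)\<bar> + \<bar>riesz_mean b (Suc k) y\<bar> + \<bar>riesz_mean b (Suc k) (y - \<delta>)\<bar>"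
  have "\<delta> * \<bar>riesz_mean b k y\<bar> = \<bar>\<delta> * riesz_mean b k y\<bar>"
    using \<delta> by (simp add: abs_mult)
  also have "\<dots> \<le> ?S + \<delta> * B"
    using upper lower by linarith
  finally have "\<bar>riesz_mean b k y\<bar> \<le> ?S * (1 / \<delta>) + B"
    using \<delta> by (simp add: field_simps)
  then show ?thesis by (simp add: B_def add.assoc)
qed

lemma bigo_exp_div_powr_compose:
  fixes f \<phi> :: "real \<Rightarrow> real"
  assumes "f \<in> O(\<lambda>y. exp y / y powr \<epsilon>)" "filterlim \<phi> at_top at_top"
    and "(\<lambda>y. exp (\<phi> y) / \<phi> y powr \<epsilon>) \<in> O(\<lambda>y. exp y / y powr \<epsilon>)"
  shows "(\<lambda>y. \<bar>f (\<phi> y)\<bar> * (1 / y powr (- \<epsilon> / 2))) \<in> O(\<lambda>y. exp y / y powr (\<epsilon> / 2))"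
proof -
  have "(\<lambda>y. f (\<phi> y)) \<in> O(\<lambda>y. exp y / y powr \<epsilon>)"
    using landau_o.big.compose[OF assms(1,2)] assms(3) by (rule landau_o.big_trans)
  then have "(\<lambda>y. \<bar>f (\<phi> y)\<bar> * (1 / y powr (- \<epsilon> / 2))) \<in>
      O(\<lambda>y. exp y / y powr \<epsilon> * (1 / y powr (- \<epsilon> / 2)))"
    by (intro landau_o.big.mult_right) simp
  also have "(\<lambda>y::real. exp y / y powr \<epsilon> * (1 / y powr (- \<epsilon> / 2))) \<in> O(\<lambda>y. exp y / y powr (\<epsilon> / 2))"
    by real_asymp
  finally show ?thesis .
qed

lemma riesz_saving_Suc:
  assumes b_ge: "\<And>n. n \<ge> 1 \<Longrightarrow> b n \<ge> -1" and "riesz_saving b (Suc k)"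
  shows "riesz_saving b k"
proof -
  obtain \<epsilon> where \<epsilon>: "0 < \<epsilon>" "\<epsilon> \<le> 1" and saving: "riesz_mean b (Suc k) \<in> O(\<lambda>y. exp y / y powr \<epsilon>)"
    using assms(2) unfolding riesz_saving_def by blast
  define \<delta> where "\<delta> y = y powr (- \<epsilon> / 2)" for y :: real
  let ?g = "\<lambda>y. exp y / y powr \<epsilon>" and ?h = "\<lambda>y. exp y / y powr (\<epsilon> / 2)"
  define G where "G y = (\<bar>riesz_mean b (Suc k) (y + \<delta> y)\<bar> + \<bar>riesz_mean b (Suc k) y\<bar> +
      \<bar>riesz_mean b (Suc k) (y - \<delta> y)\<bar>) * (1 / \<delta> y) + 2 ^ (k + 2) * (\<delta> y * exp y) + 1" for y
  have "riesz_mean b k \<in> O(G)"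
  proof (rule bigoI[where c = 1])
    show "eventually (\<lambda>y. norm (riesz_mean b k y) \<le> 1 * norm (G y)) at_top"
      using eventually_ge_at_top[of 1]
    proof eventually_elim
      case (elim y)
      have "y powr (- \<epsilon> / 2) \<le> y powr 0" using elim \<epsilon> by (intro powr_mono) auto
      then have "0 < \<delta> y" "\<delta> y \<le> 1" using elim by (auto simp: \<delta>_def)
      then have "\<bar>riesz_mean b k y\<bar> \<le> G y"
        unfolding G_def by (intro abs_riesz_mean_le_differences b_ge)
      then show ?case by simp
    qed
  qed
  also have "G \<in> O(?h)"
    unfolding G_def distrib_right
  proof (intro sum_in_bigo bigo_exp_div_powr_compose[OF saving, folded \<delta>_def])
    show "filterlim (\<lambda>y. y + \<delta> y) at_top at_top" "filterlim (\<lambda>y. y - \<delta> y) at_top at_top"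
      unfolding \<delta>_def using \<epsilon> by real_asymp+
    show "filterlim (\<lambda>y. y) at_top at_top" by (rule filterlim_ident)
    show "(\<lambda>y. ?g (y + \<delta> y)) \<in> O(?g)" "(\<lambda>y. ?g (y - \<delta> y)) \<in> O(?g)"
      unfolding \<delta>_def using \<epsilon> by real_asymp+
    show "(\<lambda>y. 2 ^ (k + 2) * (\<delta> y * exp y)) \<in> O(?h)" "(\<lambda>_. 1) \<in> O(?h)"
      unfolding \<delta>_def using \<epsilon> by real_asymp+
  qed simp
  finally show ?thesis
    unfolding riesz_saving_def using \<epsilon> by (intro exI[of _ "\<epsilon> / 2"]) auto
qed

theorem riesz_saving_0:
  assumes "abs_conv b" "\<And>n. n \<ge> 1 \<Longrightarrow> b n \<ge> -1"
    and "polynomial_growth b m" "polynomial_growth (\<lambda>n. b n * ln (real n)) m"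
  shows "riesz_saving b 0"
proof -
  have "riesz_mean b (m + 1) \<in> O(\<lambda>y. exp y / y)"
    by (rule riesz_mean_bigo) (use assms in auto)
  also have "(\<lambda>y::real. exp y / y) \<in> O(\<lambda>y. exp y / y powr 1)"
    by real_asymp
  finally have "riesz_saving b (m + 1)"
    unfolding riesz_saving_def by (intro exI[of _ 1]) auto
  moreover have "riesz_saving b k \<Longrightarrow> riesz_saving b 0" for k
  proof (induction k)
    case (Suc k)
    from riesz_saving_Suc[OF assms(2) Suc.prems] show ?case by (rule Suc.IH)
  qed
  ultimately show ?thesis by blast
qed

section \<open>Savings of a power of the logarithm\<close>

lemma sum_ivl_bigo_telescope:
  fixes f :: "nat \<Rightarrow> real" and g :: "real \<Rightarrow> real"
  assumes f: "f \<in> O(\<lambda>n. g (real n) - g (real n - 1))"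
    and g: "eventually (\<lambda>n. g (real n - 1) \<le> g (real n)) sequentially"
      "(\<lambda>_. 1) \<in> O(\<lambda>N. g (real N))"
  shows "(\<lambda>N. \<Sum>n=m..N. f n) \<in> O(\<lambda>N. g (real N))"
proof -
  obtain c where "c > 0" "eventually (\<lambda>n. norm (f n) \<le> c * norm (g (real n) - g (real n - 1))) sequentially"
    using f by (elim landau_o.bigE)
  with g(1) have "eventually (\<lambda>n. \<bar>f n\<bar> \<le> c * (g (real n) - g (real n - 1))) sequentially"
    by (auto elim: eventually_elim2)
  then obtain M where M: "\<And>n. n \<ge> M \<Longrightarrow> \<bar>f n\<bar> \<le> c * (g (real n) - g (real n - 1))"
    by (auto simp: eventually_sequentially)
  define S where "S N = \<bar>\<Sum>n=m..M. f n\<bar> + c * (g (real N) - g (real M))" for N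
  have "\<bar>\<Sum>n=m..N. f n\<bar> \<le> S N" if "N \<ge> M" for N
    using that
  proof (induction N rule: dec_induct)
    case (step N)
    then have "\<bar>\<Sum>n=m..Suc N. f n\<bar> \<le> S N + \<bar>f (Suc N)\<bar>"
      using \<open>c > 0\<close> by (auto simp: S_def)
    also have "\<dots> \<le> S N + c * (g (real (Suc N)) - g (real N))"
      using M[of "Suc N"] step.hyps by simp
    also have "\<dots> = S (Suc N)" by (simp add: S_def algebra_simps)
    finally show ?case .
  qed (simp add: S_def)
  then have "(\<lambda>N. \<Sum>n=m..N. f n) \<in> O(S)"
    by (intro bigoI[where c = 1] eventually_mono[OF eventually_ge_at_top[of M]]) force
  also have "S \<in> O(\<lambda>N. g (real N))"
  proof -
    have const: "(\<lambda>_. K) \<in> O(\<lambda>N. g (real N))" for K :: real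
      using landau_o.big.mult_left[OF g(2), of "\<lambda>_. K"] by (cases "K = 0") simp_all
    show ?thesis
      unfolding S_def right_diff_distrib by (intro sum_in_bigo const) simp_all
  qed
  finally show ?thesis .
qed

text \<open>Sums start at 2 so that \<open>ln n\<close> never vanishes.\<close>

definition log_saving :: "(nat \<Rightarrow> real) \<Rightarrow> real \<Rightarrow> bool" where
  "log_saving f \<epsilon> \<longleftrightarrow> (\<lambda>N. \<Sum>n=2..N. f n) \<in> O(\<lambda>N. real N / ln (real N) powr \<epsilon>)"

lemma log_saving_mono:
  assumes "log_saving f \<epsilon>" "\<epsilon>' \<le> \<epsilon>"
  shows "log_saving f \<epsilon>'"
proof -
  have "eventually (\<lambda>N::nat. ln (real N) \<ge> 1) sequentially" by real_asymp
  then have "eventually (\<lambda>N. norm (real N / ln (real N) powr \<epsilon>) \<le>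
      1 * norm (real N / ln (real N) powr \<epsilon>')) sequentially"
  proof eventually_elim
    case (elim N)
    have "ln (real N) powr \<epsilon>' \<le> ln (real N) powr \<epsilon>"
      using elim assms(2) by (intro powr_mono)
    then show ?case using elim by (auto intro!: divide_left_mono)
  qed
  then have "(\<lambda>N. real N / ln (real N) powr \<epsilon>) \<in> O(\<lambda>N. real N / ln (real N) powr \<epsilon>')"
    by (rule bigoI)
  with assms(1) show ?thesis
    unfolding log_saving_def by (rule landau_o.big_trans)
qed

lemma log_saving_add: "log_saving f \<epsilon> \<Longrightarrow> log_saving g \<epsilon> \<Longrightarrow> log_saving (\<lambda>n. f n + g n) \<epsilon>"
  unfolding log_saving_def sum.distrib by (rule sum_in_bigo)

lemma log_saving_diff: "log_saving f \<epsilon> \<Longrightarrow> log_saving g \<epsilon> \<Longrightarrow> log_saving (\<lambda>n. f n - g n) \<epsilon>"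
  unfolding log_saving_def sum_subtractf by (rule sum_in_bigo)

lemma log_saving_cong:
  assumes "\<And>n. n \<ge> 2 \<Longrightarrow> f n = g n"
  shows "log_saving f \<epsilon> \<longleftrightarrow> log_saving g \<epsilon>"
proof -
  have "(\<Sum>n=2..N. f n) = (\<Sum>n=2..N. g n)" for N using assms by (intro sum.cong) auto
  then show ?thesis by (simp add: log_saving_def)
qed

lemma log_saving_finite_support:
  assumes "\<And>n. n > d \<Longrightarrow> f n = 0"
  shows "log_saving f \<epsilon>"
proof -
  have "eventually (\<lambda>N. (\<Sum>n=2..N. f n) = (\<Sum>n=2..d. f n)) sequentially"
    using eventually_ge_at_top[of d]
  proof eventually_elim
    case (elim N)
    then show ?case by (intro sum.mono_neutral_right) (use assms in auto)
  qed
  then have "(\<lambda>N. \<Sum>n=2..N. f n) \<in> O(\<lambda>_. \<Sum>n=2..d. f n)"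
    by (intro bigoI[where c = 1]) (auto elim: eventually_mono)
  also have "(\<lambda>_. \<Sum>n=2..d. f n) \<in> O(\<lambda>_. 1)" by simp
  also have "(\<lambda>_. 1) \<in> O(\<lambda>N::nat. real N / ln (real N) powr \<epsilon>)"
    by real_asymp
  finally show ?thesis unfolding log_saving_def .
qed

lemma riesz_saving_0_imp_log_saving:
  assumes "riesz_saving b 0"
  obtains \<epsilon> where "0 < \<epsilon>" "\<epsilon> \<le> 1" "log_saving b \<epsilon>"
proof -
  obtain \<epsilon> where \<epsilon>: "0 < \<epsilon>" "\<epsilon> \<le> 1" and saving: "riesz_mean b 0 \<in> O(\<lambda>y. exp y / y powr \<epsilon>)"
    using assms unfolding riesz_saving_def by blast
  have "filterlim (\<lambda>N. ln (real N)) at_top sequentially" by real_asymp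
  from landau_o.big.compose[OF saving this]
  have "(\<lambda>N. riesz_mean b 0 (ln (real N))) \<in> O(\<lambda>N. exp (ln (real N)) / ln (real N) powr \<epsilon>)" .
  also have "(\<lambda>N. exp (ln (real N)) / ln (real N) powr \<epsilon>) \<in> O(\<lambda>N. real N / ln (real N) powr \<epsilon>)"
    by real_asymp
  finally have "(\<lambda>N. riesz_mean b 0 (ln (real N)) - b 1) \<in> O(\<lambda>N. real N / ln (real N) powr \<epsilon>)"
  proof (rule sum_in_bigo)
    have "(\<lambda>_. b 1) \<in> O(\<lambda>_. 1)" by simp
    also have "(\<lambda>_. 1) \<in> O(\<lambda>N::nat. real N / ln (real N) powr \<epsilon>)" by real_asymp
    finally show "(\<lambda>_. b 1) \<in> O(\<lambda>N::nat. real N / ln (real N) powr \<epsilon>)" .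
  qed
  moreover have "eventually (\<lambda>N. riesz_mean b 0 (ln (real N)) - b 1 = (\<Sum>n=2..N. b n)) sequentially"
    using eventually_ge_at_top[of 1]
    by eventually_elim (simp add: riesz_mean_0 sum.atLeast_Suc_atMost numeral_2_eq_2)
  note landau_o.big.in_cong[OF this]
  ultimately have "log_saving b \<epsilon>"
    unfolding log_saving_def by blast
  with \<epsilon> that show ?thesis by blast
qed

theorem log_saving_divide_ln:
  assumes "log_saving f \<epsilon>" "\<epsilon> \<ge> 0"
  shows "log_saving (\<lambda>n. f n / ln (real n)) (1 + \<epsilon>)"
proof -
  define F where "F N = (\<Sum>n=2..N. f n)" for N
  let ?g = "\<lambda>x. x / ln x powr (1 + \<epsilon>)"
  have F_bigo: "F \<in> O(\<lambda>N. real N / ln (real N) powr \<epsilon>)"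
    using assms(1) by (simp add: log_saving_def F_def[abs_def])
  have "(\<lambda>N. F N * (1 / ln (real (Suc N)))) \<in>
      O(\<lambda>N. real N / ln (real N) powr \<epsilon> * (1 / ln (real (Suc N))))"
    by (intro landau_o.big.mult_right F_bigo)
  also have "(\<lambda>N::nat. real N / ln (real N) powr \<epsilon> * (1 / ln (real (Suc N)))) \<in> O(\<lambda>N. ?g (real N))"
    by real_asymp
  finally have boundary: "(\<lambda>N. F N * (1 / ln (real (Suc N)))) \<in> O(\<lambda>N. ?g (real N))" .
  have "(\<lambda>n. F n * (1 / ln (real n) - 1 / ln (real (Suc n)))) \<in>
      O(\<lambda>n. real n / ln (real n) powr \<epsilon> * (1 / ln (real n) - 1 / ln (real (Suc n))))"
    by (intro landau_o.big.mult_right F_bigo)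
  also have "(\<lambda>n::nat. real n / ln (real n) powr \<epsilon> * (1 / ln (real n) - 1 / ln (real (Suc n)))) \<in>
      O(\<lambda>n. ?g (real n) - ?g (real n - 1))"
    using assms(2) by real_asymp
  finally have "(\<lambda>N. \<Sum>n=2..N. F n * (1 / ln (real n) - 1 / ln (real (Suc n)))) \<in> O(\<lambda>N. ?g (real N))"
    by (rule sum_ivl_bigo_telescope) (use assms(2) in real_asymp)+
  from sum_in_bigo(1)[OF boundary this] show ?thesis
    using sum_mult_by_parts_ivl[of f "\<lambda>n. 1 / ln (real n)" 2]
    by (simp add: log_saving_def F_def)
qed

theorem log_saving_summable:
  assumes "log_saving f (1 + \<epsilon>)" "\<epsilon> > 0"
  shows "summable (\<lambda>n. f n / real n)"
proof -
  define a where "a n = (if n < 2 then 0 else f n)" for n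
  define F where "F N = (\<Sum>k<Suc N. a k)" for N
  have "F = (\<lambda>N. \<Sum>n=2..N. f n)"
    unfolding F_def by (intro ext sum.mono_neutral_cong_right) (auto simp: a_def)
  then have F_bigo: "F \<in> O(\<lambda>N. real N / ln (real N) powr (1 + \<epsilon>))"
    using assms(1) by (simp add: log_saving_def)
  have "summable (\<lambda>n. a n * (1 / real n))"
  proof (rule summable_mult_by_parts)
    have "(\<lambda>N. F N * (1 / real (Suc N))) \<in> O(\<lambda>N. real N / ln (real N) powr (1 + \<epsilon>) * (1 / real (Suc N)))"
      by (intro landau_o.big.mult_right F_bigo)
    also have "(\<lambda>N::nat. real N / ln (real N) powr (1 + \<epsilon>) * (1 / real (Suc N))) \<in> o(\<lambda>_. 1)"
      using assms(2) by real_asymp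
    finally have "(\<lambda>N. F N * (1 / real (Suc N))) \<longlonglongrightarrow> 0"
      by (auto dest: smalloD_tendsto)
    then have "(\<lambda>N. (\<Sum>n<N. a n) * (1 / real N)) \<longlonglongrightarrow> 0"
      unfolding F_def by (rule LIMSEQ_imp_Suc)
    then show "convergent (\<lambda>N. (\<Sum>n<N. a n) * (1 / real N))" by (rule convergentI)
    let ?w = "\<lambda>n::nat. ln (real n + 1) powr (-\<epsilon>)"
    have "summable (\<lambda>n. ?w n - ?w (Suc n))"
      by (rule telescope_summable'[where c = 0]) (use assms(2) in real_asymp)
    moreover have "eventually (\<lambda>n. ?w n - ?w (Suc n) \<ge> 0) sequentially"
      using assms(2) by real_asymp
    then have "eventually (\<lambda>n. norm (?w n - ?w (Suc n)) = ?w n - ?w (Suc n)) sequentially"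
      by eventually_elim (rule real_norm_def[THEN trans, OF abs_of_nonneg])
    note summable_cong[OF this]
    ultimately have "summable (\<lambda>n. norm (?w n - ?w (Suc n)))" by blast
    moreover have "(\<lambda>n. F n * (1 / real n - 1 / real (Suc n))) \<in>
        O(\<lambda>n. real n / ln (real n) powr (1 + \<epsilon>) * (1 / real n - 1 / real (Suc n)))"
      by (intro landau_o.big.mult_right F_bigo)
    then have "(\<lambda>n. F n * (1 / real n - 1 / real (Suc n))) \<in> O(\<lambda>n. ?w n - ?w (Suc n))"
      by (rule landau_o.big_trans) (use assms(2) in real_asymp)
    ultimately show "summable (\<lambda>n. (\<Sum>k<Suc n. a k) * (1 / real n - 1 / real (Suc n)))"
      unfolding F_def by (rule summable_comparison_test_bigo)
  qed
  moreover have "eventually (\<lambda>n. a n * (1 / real n) = f n / real n) sequentially"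
    using eventually_ge_at_top[of 2] by eventually_elim (simp add: a_def)
  note summable_cong[OF this]
  ultimately show ?thesis by blast
qed

section \<open>Sums over primes\<close>

lemma log_saving_mangoldt:
  obtains \<epsilon> where "0 < \<epsilon>" "\<epsilon> \<le> 1" "log_saving (\<lambda>n. mangoldt n - 1) \<epsilon>"
proof -
  have "riesz_saving (\<lambda>n. mangoldt n - 1) 0"
    by (intro riesz_saving_0[where m = 10] abs_conv_mangoldt_minus_one polynomial_growth_mangoldt_minus_one
        polynomial_growth_mangoldt_minus_one_ln) (simp add: mangoldt_nonneg)
  then show ?thesis using that by (rule riesz_saving_0_imp_log_saving)
qed

text \<open>The descent in the order needs coefficients bounded below, hence the detour through
  \<open>(1 + \<chi>) \<Lambda> - 1\<close>.\<close>

lemma (in nonprincipal_character) log_saving_chi_mangoldt: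
  obtains \<epsilon> where "0 < \<epsilon>" "\<epsilon> \<le> 1" "log_saving (\<lambda>n. \<chi> n * mangoldt n) \<epsilon>"
proof -
  define b where "b n = (mangoldt n - 1) + \<chi> n * mangoldt n" for n
  note growth = dirichlet_series_chi_1_nonzero[THEN polynomial_growth_chi_mangoldt]
    dirichlet_series_chi_1_nonzero[THEN polynomial_growth_chi_mangoldt_ln]
  have "riesz_saving b 0"
  proof (rule riesz_saving_0)
    show "abs_conv b" "polynomial_growth b 10"
      unfolding b_def by (intro abs_conv_add polynomial_growth_add abs_conv_mangoldt_minus_one
          abs_conv_chi_mangoldt polynomial_growth_mangoldt_minus_one growth)+
    show "polynomial_growth (\<lambda>n. b n * ln (real n)) 10"
      unfolding b_def distrib_right
      by (intro polynomial_growth_add abs_conv_mult_ln abs_conv_mangoldt_minus_one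
          abs_conv_chi_mangoldt polynomial_growth_mangoldt_minus_one_ln growth)
    fix n
    have "\<bar>\<chi> n * mangoldt n\<bar> \<le> 1 * mangoldt n"
      unfolding abs_mult using abs_chi_le_1 mangoldt_nonneg by (intro mult_mono) auto
    then show "b n \<ge> -1" by (simp add: b_def abs_le_iff)
  qed
  then obtain \<epsilon> where \<epsilon>: "0 < \<epsilon>" "\<epsilon> \<le> 1" "log_saving b \<epsilon>"
    by (rule riesz_saving_0_imp_log_saving)
  obtain \<epsilon>' where \<epsilon>': "0 < \<epsilon>'" "\<epsilon>' \<le> 1" "log_saving (\<lambda>n. mangoldt n - 1) \<epsilon>'"
    by (rule log_saving_mangoldt)
  have "log_saving (\<lambda>n. b n - (mangoldt n - 1)) (min \<epsilon> \<epsilon>')"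
    by (intro log_saving_diff log_saving_mono[OF \<epsilon>(3)] log_saving_mono[OF \<epsilon>'(3)]) auto
  then show ?thesis
    using that[of "min \<epsilon> \<epsilon>'"] \<epsilon> \<epsilon>' by (simp add: b_def)
qed

lemma card_proper_prime_powers_le:
  assumes "N \<ge> 2"
  shows "real (card {n\<in>{2..N}. primepow n \<and> \<not> prime n}) \<le> (sqrt (real N) + 1) * (log 2 (real N) + 1)"
proof -
  let ?A = "{0..nat \<lfloor>sqrt (real N)\<rfloor>} \<times> {0..nat \<lfloor>log 2 (real N)\<rfloor>}"
  have "{n\<in>{2..N}. primepow n \<and> \<not> prime n} \<subseteq> (\<lambda>(p, k). p ^ k) ` ?A"
  proof
    fix n assume n: "n \<in> {n\<in>{2..N}. primepow n \<and> \<not> prime n}"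
    then obtain p k where pk: "prime p" "k > 0" "n = p ^ k" by (auto simp: primepow_def)
    with n have "k \<noteq> 1" by auto
    then have "k \<ge> 2" using pk by simp
    have "p \<ge> 2" using pk prime_ge_2_nat by blast
    have "p ^ 2 \<le> p ^ k" "2 ^ k \<le> p ^ k"
      using \<open>k \<ge> 2\<close> \<open>p \<ge> 2\<close> by (auto intro: power_increasing power_mono)
    moreover have "p ^ k \<le> N" using n pk by simp
    ultimately have "p ^ 2 \<le> N" "2 ^ k \<le> N" by (meson le_trans)+
    then have "real p ^ 2 \<le> real N" "2 ^ k \<le> real N"
      by (metis of_nat_le_iff of_nat_power, metis of_nat_le_iff of_nat_numeral of_nat_power)
    then have "real p \<le> sqrt (real N)" "real k \<le> log 2 (real N)"
      using assms by (auto intro: real_le_rsqrt simp: le_log_iff powr_realpow)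
    then have "(p, k) \<in> ?A" by (simp add: le_nat_floor)
    then show "n \<in> (\<lambda>(p, k). p ^ k) ` ?A" by (rule rev_image_eqI) (simp add: pk(3))
  qed
  then have "card {n\<in>{2..N}. primepow n \<and> \<not> prime n} \<le> card ?A"
    by (rule surj_card_le[rotated]) auto
  then have "real (card {n\<in>{2..N}. primepow n \<and> \<not> prime n}) \<le> real (card ?A)"
    by (rule of_nat_mono)
  also have "\<dots> = (real (nat \<lfloor>sqrt (real N)\<rfloor>) + 1) * (real (nat \<lfloor>log 2 (real N)\<rfloor>) + 1)"
    by (simp add: algebra_simps)
  also have "\<dots> \<le> (sqrt (real N) + 1) * (log 2 (real N) + 1)"
    using assms by (intro mult_mono add_mono) (auto simp: of_nat_floor)
  finally show ?thesis .
qed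

lemma log_saving_prime_powers:
  assumes "\<And>n. \<bar>c n\<bar> \<le> 1"
  shows "log_saving (\<lambda>n. if prime n then 0 else c n * mangoldt n) 1"
proof -
  have "eventually (\<lambda>N. norm (\<Sum>n=2..N. if prime n then 0 else c n * mangoldt n) \<le>
      1 * norm ((sqrt (real N) + 1) * (log 2 (real N) + 1) * ln (real N))) sequentially"
    using eventually_ge_at_top[of 2]
  proof eventually_elim
    case (elim N)
    have "norm (\<Sum>n=2..N. if prime n then 0 else c n * mangoldt n) \<le>
        (\<Sum>n=2..N. if primepow n \<and> \<not> prime n then ln (real N) else 0)"
    proof (rule sum_norm_le)
      fix n assume n: "n \<in> {2..N}"
      have "\<bar>c n * mangoldt n\<bar> \<le> 1 * mangoldt n"
        unfolding abs_mult using assms mangoldt_nonneg by (intro mult_mono) auto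
      also have "\<dots> \<le> ln (real n)" by (simp add: mangoldt_le_ln)
      also have "\<dots> \<le> ln (real N)" using n by simp
      finally show "norm (if prime n then 0 else c n * mangoldt n) \<le>
          (if primepow n \<and> \<not> prime n then ln (real N) else 0)"
        by (auto simp: mangoldt_def)
    qed
    also have "\<dots> = real (card {n\<in>{2..N}. primepow n \<and> \<not> prime n}) * ln (real N)"
      by (subst sum.inter_filter[symmetric]) auto
    also have "\<dots> \<le> (sqrt (real N) + 1) * (log 2 (real N) + 1) * ln (real N)"
      using elim by (intro mult_right_mono card_proper_prime_powers_le) auto
    finally show ?case by simp
  qed
  then have "(\<lambda>N. \<Sum>n=2..N. if prime n then 0 else c n * mangoldt n) \<in>
      O(\<lambda>N. (sqrt (real N) + 1) * (log 2 (real N) + 1) * ln (real N))" by (rule bigoI)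
  also have "(\<lambda>N::nat. (sqrt (real N) + 1) * (log 2 (real N) + 1) * ln (real N)) \<in>
      O(\<lambda>N. real N / ln (real N) powr 1)"
    by real_asymp
  finally show ?thesis by (simp add: log_saving_def)
qed

lemma log_saving_primes:
  assumes "log_saving (\<lambda>n. c n * mangoldt n - r n) \<epsilon>" "0 \<le> \<epsilon>" "\<epsilon> \<le> 1" "\<And>n. \<bar>c n\<bar> \<le> 1"
  shows "log_saving (\<lambda>n. (if prime n then c n else 0) - r n / ln (real n)) (1 + \<epsilon>)"
proof -
  have "log_saving (\<lambda>n. if prime n then 0 else c n * mangoldt n) \<epsilon>"
    using log_saving_prime_powers[OF assms(4)] assms(3) by (rule log_saving_mono)
  with assms(1) have "log_saving (\<lambda>n. c n * mangoldt n - r n - (if prime n then 0 else c n * mangoldt n)) \<epsilon>"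
    by (rule log_saving_diff)
  then have "log_saving (\<lambda>n. (c n * mangoldt n - r n - (if prime n then 0 else c n * mangoldt n)) /
      ln (real n)) (1 + \<epsilon>)"
    using assms(2) by (rule log_saving_divide_ln)
  then show ?thesis
    by (rule log_saving_cong[THEN iffD1, rotated]) (auto simp: diff_divide_distrib)
qed

section \<open>The hyperbola method\<close>

definition psum :: "(nat \<Rightarrow> real) \<Rightarrow> real \<Rightarrow> real" where
  "psum f y = (\<Sum>n=2..nat \<lfloor>y\<rfloor>. f n)"

definition pair_sum :: "(nat \<Rightarrow> real) \<Rightarrow> (nat \<Rightarrow> real) \<Rightarrow> real \<Rightarrow> real" where
  "pair_sum f g x = (\<Sum>(p, q) | 2 \<le> p \<and> 2 \<le> q \<and> real (p * q) \<le> x. f p * g q)"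

definition half_sum :: "(nat \<Rightarrow> real) \<Rightarrow> (real \<Rightarrow> real) \<Rightarrow> real \<Rightarrow> real" where
  "half_sum f F x = (\<Sum>n=2..nat \<lfloor>sqrt x\<rfloor>. f n * F (x / real n))"

lemma le_nat_floor_iff: "y \<ge> 0 \<Longrightarrow> n \<le> nat \<lfloor>y\<rfloor> \<longleftrightarrow> real n \<le> y"
  by (simp add: le_nat_iff le_floor_iff)

lemma finite_pairs: "finite {(p, q). 2 \<le> p \<and> 2 \<le> q \<and> real (p * q) \<le> x}"
proof (rule finite_subset)
  show "{(p, q). 2 \<le> p \<and> 2 \<le> q \<and> real (p * q) \<le> x} \<subseteq> {0..nat \<lfloor>x\<rfloor>} \<times> {0..nat \<lfloor>x\<rfloor>}"
  proof clarify
    fix p q :: nat assume pq: "2 \<le> p" "2 \<le> q" "real (p * q) \<le> x"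
    have "p * q \<le> nat \<lfloor>x\<rfloor>" using pq(3) by (rule le_nat_floor)
    moreover have "p \<le> p * q" "q \<le> p * q" using pq by auto
    ultimately have "p \<le> nat \<lfloor>x\<rfloor>" "q \<le> nat \<lfloor>x\<rfloor>" by linarith+
    then show "p \<in> {0..nat \<lfloor>x\<rfloor>} \<and> q \<in> {0..nat \<lfloor>x\<rfloor>}" by simp
  qed
qed auto

lemma half_sum_psum_eq:
  assumes "x \<ge> 0"
  shows "half_sum f (psum g) x =
    (\<Sum>(p, q) | 2 \<le> p \<and> 2 \<le> q \<and> real (p * q) \<le> x \<and> real p \<le> sqrt x. f p * g q)"
proof -
  have "{(p, q). 2 \<le> p \<and> 2 \<le> q \<and> real (p * q) \<le> x \<and> real p \<le> sqrt x} =
      (SIGMA p:{2..nat \<lfloor>sqrt x\<rfloor>}. {2..nat \<lfloor>x / real p\<rfloor>})"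
    using assms by (auto simp: le_nat_floor_iff field_simps)
  then show ?thesis
    by (simp add: half_sum_def psum_def sum_distrib_left sum.Sigma)
qed

theorem hyperbola_method:
  assumes "x \<ge> 0"
  shows "pair_sum f g x =
    half_sum f (psum g) x + half_sum g (psum f) x - psum f (sqrt x) * psum g (sqrt x)"
proof -
  let ?h = "\<lambda>(p, q). f p * g q"
  let ?A = "{(p, q). 2 \<le> p \<and> 2 \<le> q \<and> real (p * q) \<le> x}"
  let ?P = "{(p, q). 2 \<le> p \<and> 2 \<le> q \<and> real (p * q) \<le> x \<and> real p \<le> sqrt x}"
  let ?Q = "{(p, q). 2 \<le> p \<and> 2 \<le> q \<and> real (p * q) \<le> x \<and> real q \<le> sqrt x}"
  have finite: "finite ?P" "finite ?Q" by (auto intro: finite_subset[OF _ finite_pairs[of x]])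
  have "real p \<le> sqrt x \<or> real q \<le> sqrt x" if "real (p * q) \<le> x" for p q
  proof (rule ccontr)
    assume "\<not> (real p \<le> sqrt x \<or> real q \<le> sqrt x)"
    then have "sqrt x * sqrt x < real p * real q" using assms by (intro mult_strict_mono') auto
    with that assms show False by simp
  qed
  then have union: "?A = ?P \<union> ?Q" by auto
  have "real (p * q) \<le> x" if "real p \<le> sqrt x" "real q \<le> sqrt x" for p q
  proof -
    have "real p * real q \<le> sqrt x * sqrt x" using that assms by (intro mult_mono) auto
    then show ?thesis using assms by simp
  qed
  then have inter: "?P \<inter> ?Q = {2..nat \<lfloor>sqrt x\<rfloor>} \<times> {2..nat \<lfloor>sqrt x\<rfloor>}"
    using assms by (auto simp: le_nat_floor_iff)
  have "pair_sum f g x + sum ?h (?P \<inter> ?Q) = sum ?h ?P + sum ?h ?Q"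
    unfolding pair_sum_def union using sum.union_inter[OF finite, of ?h] by simp
  moreover have "sum ?h ?Q = half_sum g (psum f) x"
    unfolding half_sum_psum_eq[OF assms]
    by (rule sum.reindex_bij_witness[of _ "\<lambda>(p, q). (q, p)" "\<lambda>(p, q). (q, p)"]) (auto simp: mult.commute)
  moreover have "sum ?h (?P \<inter> ?Q) = psum f (sqrt x) * psum g (sqrt x)"
    unfolding inter psum_def sum_product by (simp add: sum.cartesian_product)
  ultimately show ?thesis unfolding half_sum_psum_eq[OF assms, of f] by linarith
qed

lemma filterlim_nat_floor: "filterlim (\<lambda>y. nat \<lfloor>y\<rfloor>) at_top (at_top :: real filter)"
  by (intro filterlim_compose[OF filterlim_nat_sequentially filterlim_floor_sequentially])

lemma psum_bigo_log_saving:
  assumes "log_saving f \<epsilon>" "\<epsilon> > 0"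
  shows "psum f \<in> O(\<lambda>y. y / ln y powr \<epsilon>)"
proof -
  from landau_o.big.compose[OF assms(1)[unfolded log_saving_def] filterlim_nat_floor]
  have "psum f \<in> O(\<lambda>y. real (nat \<lfloor>y\<rfloor>) / ln (real (nat \<lfloor>y\<rfloor>)) powr \<epsilon>)"
    unfolding psum_def .
  also have "(\<lambda>y. real (nat \<lfloor>y\<rfloor>) / ln (real (nat \<lfloor>y\<rfloor>)) powr \<epsilon>) \<in> O(\<lambda>y. y / ln y powr \<epsilon>)"
    using assms(2) by real_asymp
  finally show ?thesis .
qed

lemma psum_tendsto_suminf:
  assumes "summable f" "f 0 = 0" "f 1 = 0"
  shows "(psum f \<longlongrightarrow> suminf f) at_top"
proof -
  have "(\<Sum>n<Suc N. f n) = (\<Sum>n=2..N. f n)" for N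
  proof (rule sum.mono_neutral_right)
    have "{..<Suc N} - {2..N} \<subseteq> {0, 1}" by auto
    with assms(2,3) show "\<forall>n\<in>{..<Suc N} - {2..N}. f n = 0" by auto
  qed auto
  then have "(\<lambda>N. \<Sum>n=2..N. f n) \<longlonglongrightarrow> suminf f"
    using LIMSEQ_Suc[OF summable_LIMSEQ[OF assms(1)]] by simp
  from filterlim_compose[OF this filterlim_nat_floor] show ?thesis by (simp add: psum_def[abs_def])
qed

lemma psum_telescope:
  fixes v :: "nat \<Rightarrow> real"
  assumes "v 1 = 0" "y \<ge> 1"
  shows "psum (\<lambda>n. v n - v (n - 1)) y = v (nat \<lfloor>y\<rfloor>)"
proof -
  have "1 \<le> nat \<lfloor>y\<rfloor>" using assms(2) by (intro le_nat_floor) simp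
  then show ?thesis
    using sum_telescope''[of 1 "nat \<lfloor>y\<rfloor>" v] assms(1) by (simp add: psum_def numeral_2_eq_2)
qed

text \<open>The value at 1 is \<open>1 / ln 1 = 1 / 0 = 0\<close>, so that \<open>psum_telescope\<close> applies.\<close>

lemma log_saving_inverse_ln:
  "log_saving (\<lambda>n. 1 / ln (real n) - (real n / ln (real n) - real (n - 1) / ln (real (n - 1)))) 2"
  unfolding log_saving_def
proof (rule sum_ivl_bigo_telescope)
  show "(\<lambda>n. 1 / ln (real n) - (real n / ln (real n) - real (n - 1) / ln (real (n - 1)))) \<in>
      O(\<lambda>n. real n / ln (real n) powr 2 - (real n - 1) / ln (real n - 1) powr 2)"
    by real_asymp
qed real_asymp+

lemma psum_bigo_inverse_ln:
  assumes "log_saving (\<lambda>n. f n - 1 / ln (real n)) (1 + \<epsilon>)" "0 \<le> \<epsilon>" "\<epsilon> \<le> 1"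
  shows "(\<lambda>y. psum f y - y / ln y) \<in> O(\<lambda>y. y / ln y powr (1 + \<epsilon>))"
proof -
  define v where "v n = real n / ln (real n)" for n
  have "log_saving (\<lambda>n. (f n - 1 / ln (real n)) + (1 / ln (real n) - (v n - v (n - 1)))) (1 + \<epsilon>)"
    unfolding v_def using assms(3)
    by (intro log_saving_add assms(1) log_saving_mono[OF log_saving_inverse_ln]) auto
  then have "log_saving (\<lambda>n. f n - (v n - v (n - 1))) (1 + \<epsilon>)"
    by (simp add: algebra_simps)
  then have "psum (\<lambda>n. f n - (v n - v (n - 1))) \<in> O(\<lambda>y. y / ln y powr (1 + \<epsilon>))"
    using assms(2) by (intro psum_bigo_log_saving) auto
  moreover have "(\<lambda>y. v (nat \<lfloor>y\<rfloor>) - y / ln y) \<in> O(\<lambda>y. y / ln y powr (1 + \<epsilon>))"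
  proof -
    have "(\<lambda>y. v (nat \<lfloor>y\<rfloor>) - y / ln y) \<in> O(\<lambda>_. 1)" unfolding v_def by real_asymp
    also have "(\<lambda>_. 1) \<in> O(\<lambda>y::real. y / ln y powr (1 + \<epsilon>))" by real_asymp
    finally show ?thesis .
  qed
  ultimately have "(\<lambda>y. psum (\<lambda>n. f n - (v n - v (n - 1))) y + (v (nat \<lfloor>y\<rfloor>) - y / ln y)) \<in>
      O(\<lambda>y. y / ln y powr (1 + \<epsilon>))"
    by (rule sum_in_bigo)
  moreover have "eventually (\<lambda>y. psum (\<lambda>n. f n - (v n - v (n - 1))) y + (v (nat \<lfloor>y\<rfloor>) - y / ln y) =
      psum f y - y / ln y) at_top"
    using eventually_ge_at_top[of 1]
  proof eventually_elim
    case (elim y)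
    have "psum (\<lambda>n. f n - (v n - v (n - 1))) y = psum f y - psum (\<lambda>n. v n - v (n - 1)) y"
      by (simp only: psum_def sum_subtractf)
    also have "psum (\<lambda>n. v n - v (n - 1)) y = v (nat \<lfloor>y\<rfloor>)"
      using elim by (intro psum_telescope) (simp_all add: v_def)
    finally show ?case by simp
  qed
  note landau_o.big.in_cong[OF this]
  ultimately show ?thesis by blast
qed

text \<open>Each weight tends to 0, and the weights are increasing in \<open>n\<close> and at most 1, so by partial
  summation only the tail of the convergent series could contribute.\<close>

theorem weighted_sum_tendsto_0:
  fixes r :: "nat \<Rightarrow> real" and V :: "'a \<Rightarrow> nat \<Rightarrow> real"
  assumes r: "summable r" and N: "filterlim N at_top F" and pointwise: "\<And>n. ((\<lambda>x. V x n) \<longlongrightarrow> 0) F"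
    and V: "eventually (\<lambda>x. (\<forall>n\<in>{m..N x}. 0 \<le> V x n \<and> V x n \<le> 1) \<and>
      (\<forall>n\<in>{m..<N x}. V x n \<le> V x (Suc n))) F"
  shows "((\<lambda>x. \<Sum>n=m..N x. r n * V x n) \<longlongrightarrow> 0) F"
proof (rule tendstoI)
  fix e :: real assume e: "e > 0"
  obtain M' where M': "\<And>k n. k \<ge> M' \<Longrightarrow> norm (\<Sum>i=k..n. r i) < e / 4"
    using summable_partial_sum_bound[OF r, of "e / 4"] e by auto
  define M where "M = max M' m"
  have "((\<lambda>x. \<Sum>n=m..<M. r n * V x n) \<longlongrightarrow> 0) F"
    by (intro tendsto_null_sum tendsto_mult_right_zero pointwise)
  then have "eventually (\<lambda>x. dist (\<Sum>n=m..<M. r n * V x n) 0 < e / 2) F"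
    using e by (intro tendstoD) auto
  moreover have "eventually (\<lambda>x. M \<le> N x) F"
    using N by (simp add: filterlim_at_top)
  ultimately show "eventually (\<lambda>x. dist (\<Sum>n=m..N x. r n * V x n) 0 < e) F"
    using V
  proof eventually_elim
    case (elim x)
    have "\<bar>\<Sum>n=M..N x. r n * V x n\<bar> \<le> 2 * (e / 4) * V x (N x)"
    proof (rule abs_sum_mult_incseq_le)
      show "\<bar>\<Sum>n=M..k. r n\<bar> \<le> e / 4" for k using M'[of M k] by (simp add: M_def less_imp_le)
    qed (use elim in \<open>auto simp: M_def\<close>)
    also have "\<dots> \<le> 2 * (e / 4) * 1"
      using elim e by (intro mult_left_mono) (auto simp: M_def)
    finally have "\<bar>\<Sum>n=M..N x. r n * V x n\<bar> \<le> e / 2" by simp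
    moreover have "(\<Sum>n=m..N x. r n * V x n) = (\<Sum>n=m..<M. r n * V x n) + (\<Sum>n=M..N x. r n * V x n)"
      unfolding atLeastLessThanSuc_atLeastAtMost[symmetric]
      using elim by (intro sum.atLeastLessThan_concat[symmetric]) (auto simp: M_def)
    ultimately show ?case using elim(1) by (simp add: dist_norm)
  qed
qed

definition log_weight :: "real \<Rightarrow> nat \<Rightarrow> real" where
  "log_weight x n = ln (real n) / (ln x - ln (real n))"

definition log_weighted_sum :: "(nat \<Rightarrow> real) \<Rightarrow> real \<Rightarrow> real" where
  "log_weighted_sum r x = (\<Sum>n=2..nat \<lfloor>sqrt x\<rfloor>. r n * log_weight x n)"

lemma ln_le_half_ln:
  assumes "x > 0" "1 \<le> n" "real n \<le> sqrt x"
  shows "ln (real n) \<le> ln x / 2"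
proof -
  have "ln (real n) \<le> ln (sqrt x)" using assms by simp
  then show ?thesis using assms(1) by (simp add: ln_sqrt)
qed

lemma
  assumes "x > 1" "1 \<le> n" "real n \<le> sqrt x"
  shows sqrt_le_divide_of_nat: "sqrt x \<le> x / real n"
    and half_ln_le_ln_divide_of_nat: "ln x / 2 \<le> ln (x / real n)"
proof -
  have "real n * sqrt x \<le> sqrt x * sqrt x" using assms by (intro mult_right_mono) auto
  then show "sqrt x \<le> x / real n" using assms by (simp add: field_simps)
  show "ln x / 2 \<le> ln (x / real n)"
    using ln_le_half_ln[of x n] assms by (simp add: ln_div)
qed

lemma log_weight_bounds:
  assumes "x > 1" "1 \<le> n" "real n \<le> sqrt x"
  shows "0 \<le> log_weight x n" "log_weight x n \<le> 1"
proof -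
  have "0 \<le> ln (real n)" "ln (real n) \<le> ln x / 2" "ln x > 0"
    using ln_le_half_ln[of x n] assms by auto
  then have "0 \<le> ln (real n)" "ln (real n) \<le> ln x - ln (real n)" "ln x - ln (real n) > 0"
    by linarith+
  then show "0 \<le> log_weight x n" "log_weight x n \<le> 1"
    by (auto simp only: log_weight_def divide_le_eq_1_pos intro: divide_nonneg_pos)
qed

lemma log_weight_mono:
  assumes "x > 1" "1 \<le> m" "m \<le> n" "real n \<le> sqrt x"
  shows "log_weight x m \<le> log_weight x n"
proof -
  have "0 \<le> ln (real m)" "ln (real m) \<le> ln (real n)" "ln (real n) \<le> ln x / 2" "ln x > 0"
    using assms ln_le_half_ln[of x n] by auto
  then show ?thesis unfolding log_weight_def by (intro frac_le) auto
qed

lemma filterlim_nat_floor_sqrt: "filterlim (\<lambda>x. nat \<lfloor>sqrt x\<rfloor>) at_top at_top"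
  by (intro filterlim_compose[OF filterlim_nat_floor] sqrt_at_top)

lemma log_weighted_sum_tendsto_0:
  assumes "summable r"
  shows "(log_weighted_sum r \<longlongrightarrow> 0) at_top"
  unfolding log_weighted_sum_def[abs_def]
proof (rule weighted_sum_tendsto_0[OF assms filterlim_nat_floor_sqrt])
  show "((\<lambda>x. log_weight x n) \<longlongrightarrow> 0) at_top" for n
    unfolding log_weight_def by real_asymp
  show "eventually (\<lambda>x. (\<forall>n\<in>{2..nat \<lfloor>sqrt x\<rfloor>}. 0 \<le> log_weight x n \<and> log_weight x n \<le> 1) \<and>
      (\<forall>n\<in>{2..<nat \<lfloor>sqrt x\<rfloor>}. log_weight x n \<le> log_weight x (Suc n))) at_top"
    using eventually_gt_at_top[of 1]
  proof eventually_elim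
    case (elim x)
    then have "real n \<le> sqrt x" if "n \<le> nat \<lfloor>sqrt x\<rfloor>" for n
      using that by (simp add: le_nat_floor_iff)
    with elim show ?case
      by (auto intro!: log_weight_bounds log_weight_mono simp del: of_nat_Suc)
  qed
qed

lemma half_sum_div_ln:
  assumes "x > 1"
  shows "half_sum f (\<lambda>y. y / ln y) x * ln x / x =
    psum (\<lambda>n. f n / real n) (sqrt x) + log_weighted_sum (\<lambda>n. f n / real n) x"
proof -
  have "f n * (x / real n / ln (x / real n)) * ln x / x = f n / real n + f n / real n * log_weight x n"
    if "n \<in> {2..nat \<lfloor>sqrt x\<rfloor>}" for n
  proof -
    define u where "u = ln x - ln (real n)"
    have n: "real n \<le> sqrt x" "1 \<le> n" using that assms by (auto simp: le_nat_floor_iff)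
    then have "u > 0"
      using ln_le_half_ln[of x n] ln_gt_zero[OF assms] assms unfolding u_def by linarith
    have "ln (x / real n) = u" using n assms by (simp add: ln_div u_def)
    then have "f n * (x / real n / ln (x / real n)) * ln x / x = f n / real n * (ln x / u)"
      using assms by simp
    also have "ln x / u = 1 + log_weight x n"
      using \<open>u > 0\<close> by (simp add: u_def log_weight_def field_simps)
    finally show ?thesis by (simp add: distrib_left)
  qed
  then show ?thesis
    unfolding half_sum_def psum_def log_weighted_sum_def
      sum.distrib[symmetric] sum_distrib_right sum_divide_distrib
    by (intro sum.cong refl) auto
qed

lemma half_sum_diff: "half_sum f (\<lambda>y. F y - G y) x = half_sum f F x - half_sum f G x"
  by (simp add: half_sum_def right_diff_distrib sum_subtractf)

lemma abs_half_sum_le: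
  assumes "x > 1" "a \<ge> 0" "C \<ge> 0" and f: "\<And>n. \<bar>f n\<bar> \<le> g n"
    and F: "\<And>y. y \<ge> sqrt x \<Longrightarrow> \<bar>F y\<bar> \<le> C * (y / ln y powr a)"
  shows "\<bar>half_sum f F x\<bar> \<le> C * x / (ln x / 2) powr a * psum (\<lambda>n. g n / real n) (sqrt x)"
proof -
  have "\<bar>f n * F (x / real n)\<bar> \<le> C * x / (ln x / 2) powr a * (g n / real n)"
    if "n \<in> {2..nat \<lfloor>sqrt x\<rfloor>}" for n
  proof -
    have n: "1 \<le> n" "real n \<le> sqrt x" using that assms(1) by (auto simp: le_nat_floor_iff)
    have "ln x / 2 \<le> ln (x / real n)" "ln x > 0"
      using half_ln_le_ln_divide_of_nat[OF assms(1) n] assms(1) by auto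
    then have "x / real n / ln (x / real n) powr a \<le> x / real n / (ln x / 2) powr a"
      using assms(1,2) n(1) by (intro frac_le powr_mono2) auto
    then have "C * (x / real n / ln (x / real n) powr a) \<le> C * (x / real n / (ln x / 2) powr a)"
      using assms(3) by (rule mult_left_mono)
    moreover have "\<bar>F (x / real n)\<bar> \<le> C * (x / real n / ln (x / real n) powr a)"
      by (rule F[OF sqrt_le_divide_of_nat[OF assms(1) n]])
    ultimately have "\<bar>f n * F (x / real n)\<bar> \<le> g n * (C * (x / real n / (ln x / 2) powr a))"
      unfolding abs_mult using f[of n] by (intro mult_mono) auto
    then show ?thesis by (simp add: mult_ac)
  qed
  then have "\<bar>half_sum f F x\<bar> \<le> (\<Sum>n=2..nat \<lfloor>sqrt x\<rfloor>. C * x / (ln x / 2) powr a * (g n / real n))"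
    unfolding half_sum_def by (intro order_trans[OF sum_abs] sum_mono)
  then show ?thesis by (simp add: psum_def sum_distrib_left)
qed

lemma psum_inverse_bigo: "(\<lambda>x. psum (\<lambda>n. 1 / real n) (sqrt x)) \<in> O(\<lambda>x. ln x)"
proof -
  have "(\<lambda>N. \<Sum>n=2..N. 1 / real n) \<in> O(\<lambda>N. ln (real N))"
    by (rule sum_ivl_bigo_telescope) real_asymp+
  from landau_o.big.compose[OF this filterlim_nat_floor_sqrt]
  have "(\<lambda>x. psum (\<lambda>n. 1 / real n) (sqrt x)) \<in> O(\<lambda>x. ln (real (nat \<lfloor>sqrt x\<rfloor>)))"
    unfolding psum_def .
  also have "(\<lambda>x. ln (real (nat \<lfloor>sqrt x\<rfloor>))) \<in> O(\<lambda>x. ln x)" by real_asymp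
  finally show ?thesis .
qed

lemma log_weighted_inverse_n_ln_bigo:
  "log_weighted_sum (\<lambda>n. 1 / (real n * ln (real n))) \<in> O(\<lambda>_. 1)"
proof -
  have "eventually (\<lambda>x. norm (log_weighted_sum (\<lambda>n. 1 / (real n * ln (real n))) x) \<le>
      1 * norm (2 / ln x * psum (\<lambda>n. 1 / real n) (sqrt x))) at_top"
    using eventually_gt_at_top[of 1]
  proof eventually_elim
    case (elim x)
    have "norm (1 / (real n * ln (real n)) * log_weight x n) \<le> 2 / ln x * (1 / real n)"
      if "n \<in> {2..nat \<lfloor>sqrt x\<rfloor>}" for n
    proof -
      have n: "real n \<le> sqrt x" "2 \<le> n" using that elim by (auto simp: le_nat_floor_iff)
      then have "ln x / 2 \<le> ln x - ln (real n)" "ln x > 0"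
        using ln_le_half_ln[of x n] elim by auto
      then have "ln x - ln (real n) > 0" "1 / (ln x - ln (real n)) \<le> 1 / (ln x / 2)"
        by (linarith, intro frac_le) auto
      then have "1 / (ln x - ln (real n)) * (1 / real n) \<le> 2 / ln x * (1 / real n)"
        by (intro mult_right_mono) auto
      with n \<open>ln x - ln (real n) > 0\<close> show ?thesis by (simp add: log_weight_def mult.commute)
    qed
    then have "norm (log_weighted_sum (\<lambda>n. 1 / (real n * ln (real n))) x) \<le>
        (\<Sum>n=2..nat \<lfloor>sqrt x\<rfloor>. 2 / ln x * (1 / real n))"
      unfolding log_weighted_sum_def by (rule sum_norm_le)
    also have "\<dots> = 2 / ln x * psum (\<lambda>n. 1 / real n) (sqrt x)"
      by (simp add: psum_def sum_distrib_left)
    finally show ?case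
      unfolding mult_1 real_norm_def[of "2 / ln x * _"] by (rule order_trans[OF _ abs_ge_self])
  qed
  then have "log_weighted_sum (\<lambda>n. 1 / (real n * ln (real n))) \<in>
      O(\<lambda>x. 2 / ln x * psum (\<lambda>n. 1 / real n) (sqrt x))"
    by (rule bigoI)
  also have "(\<lambda>x. 2 / ln x * psum (\<lambda>n. 1 / real n) (sqrt x)) \<in> O(\<lambda>x. 2 / ln x * ln x)"
    by (intro landau_o.big.mult_left psum_inverse_bigo)
  also have "(\<lambda>x::real. 2 / ln x * ln x) \<in> O(\<lambda>_. 1)" by real_asymp
  finally show ?thesis .
qed

lemma pair_sum_minus_half_sums:
  assumes "psum f \<in> O(\<lambda>y. y / ln y)" "psum g \<in> O(\<lambda>y. y / ln y)"
  shows "((\<lambda>x. pair_sum f g x * ln x / x -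
    (half_sum f (psum g) x * ln x / x + half_sum g (psum f) x * ln x / x)) \<longlongrightarrow> 0) at_top"
proof -
  have "(\<lambda>x. psum f (sqrt x) * psum g (sqrt x) * (ln x / x)) \<in>
      O(\<lambda>x. sqrt x / ln (sqrt x) * (sqrt x / ln (sqrt x)) * (ln x / x))"
    by (intro landau_o.big.mult landau_o.big_refl
        assms[THEN landau_o.big.compose, OF sqrt_at_top])
  also have "(\<lambda>x. sqrt x / ln (sqrt x) * (sqrt x / ln (sqrt x)) * (ln x / x)) \<in> o(\<lambda>_. 1)"
    by real_asymp
  finally have "((\<lambda>x. psum f (sqrt x) * psum g (sqrt x) * (ln x / x)) \<longlongrightarrow> 0) at_top"
    by (auto dest: smalloD_tendsto)
  from tendsto_minus[OF this]
  have "((\<lambda>x. - (psum f (sqrt x) * psum g (sqrt x) * (ln x / x))) \<longlongrightarrow> 0) at_top" by simp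
  moreover have "eventually (\<lambda>x. - (psum f (sqrt x) * psum g (sqrt x) * (ln x / x)) =
      pair_sum f g x * ln x / x -
      (half_sum f (psum g) x * ln x / x + half_sum g (psum f) x * ln x / x)) at_top"
    using eventually_ge_at_top[of 0]
    by eventually_elim (simp add: hyperbola_method left_diff_distrib distrib_right
        diff_divide_distrib add_divide_distrib)
  ultimately show ?thesis by (rule Lim_transform_eventually)
qed

text \<open>\<open>\<kappa>\<close> is a sequence of density \<open>1 / ln n\<close>, as the indicator of the primes, and \<open>\<rho>\<close> is a
  sequence dominated by it that cancels.\<close>

locale log_density_pair =
  fixes \<kappa> \<rho> :: "nat \<Rightarrow> real" and \<epsilon> :: real
  assumes \<epsilon>: "0 < \<epsilon>" "\<epsilon> \<le> 1"
    and abs_\<rho>_le: "\<And>n. \<bar>\<rho> n\<bar> \<le> \<kappa> n"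
    and \<kappa>_1: "\<kappa> 1 = 0"
    and saving_\<kappa>: "log_saving (\<lambda>n. \<kappa> n - 1 / ln (real n)) (1 + \<epsilon>)"
    and saving_\<rho>: "log_saving \<rho> (1 + \<epsilon>)"
begin

lemma \<kappa>_nonneg: "\<kappa> n \<ge> 0"
  using abs_\<rho>_le[of n] by linarith

lemma summable_\<rho>: "summable (\<lambda>n. \<rho> n / real n)"
  by (rule log_saving_summable[OF saving_\<rho> \<epsilon>(1)])

lemma psum_\<rho>_bigo: "psum \<rho> \<in> O(\<lambda>y. y / ln y powr (1 + \<epsilon>))"
  by (rule psum_bigo_log_saving[OF saving_\<rho>]) (use \<epsilon> in simp)

lemma psum_\<kappa>_bigo: "(\<lambda>y. psum \<kappa> y - y / ln y) \<in> O(\<lambda>y. y / ln y powr (1 + \<epsilon>))"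
  by (rule psum_bigo_inverse_ln[OF saving_\<kappa>]) (use \<epsilon> in auto)

lemma
  shows psum_\<kappa>_bigo_div_ln: "psum \<kappa> \<in> O(\<lambda>y. y / ln y)"
    and psum_\<rho>_bigo_div_ln: "psum \<rho> \<in> O(\<lambda>y. y / ln y)"
proof -
  have weaken: "(\<lambda>y. y / ln y powr (1 + \<epsilon>)) \<in> O(\<lambda>y. y / ln y)" using \<epsilon> by real_asymp
  show "psum \<rho> \<in> O(\<lambda>y. y / ln y)" by (rule landau_o.big_trans[OF psum_\<rho>_bigo weaken])
  have "(\<lambda>y. psum \<kappa> y - y / ln y + y / ln y) \<in> O(\<lambda>y. y / ln y)"
    by (intro sum_in_bigo landau_o.big_trans[OF psum_\<kappa>_bigo weaken]) simp
  then show "psum \<kappa> \<in> O(\<lambda>y. y / ln y)" by simp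
qed

lemma summable_\<kappa>_minus_inverse_ln: "summable (\<lambda>n. (\<kappa> n - 1 / ln (real n)) / real n)"
  by (rule log_saving_summable[OF saving_\<kappa> \<epsilon>(1)])

lemma psum_\<kappa>_reciprocals:
  "((\<lambda>x. psum (\<lambda>n. \<kappa> n / real n) (sqrt x) / ln (ln x)) \<longlongrightarrow> 1) at_top"
proof -
  define L where "L n = ln (ln (real n))" for n
  define r where "r n = (\<kappa> n - 1 / ln (real n)) / real n +
      (1 / (real n * ln (real n)) - (L n - L (n - 1)))" for n
  have "(\<lambda>n. 1 / (real n * ln (real n)) - (L n - L (n - 1))) \<in> O(\<lambda>n. 1 / real n ^ 2)"
    unfolding L_def by real_asymp
  then have "summable (\<lambda>n. 1 / (real n * ln (real n)) - (L n - L (n - 1)))"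
    by (rule summable_comparison_test_bigo[rotated]) (simp add: inverse_power_summable flip: inverse_eq_divide)
  then have "summable r"
    unfolding r_def by (intro summable_add summable_\<kappa>_minus_inverse_ln)
  then have "(psum r \<longlongrightarrow> suminf r) at_top"
    by (rule psum_tendsto_suminf) (simp_all add: r_def L_def \<kappa>_1[simplified])
  then have "((\<lambda>x. psum r (sqrt x)) \<longlongrightarrow> suminf r) at_top"
    by (rule filterlim_compose[OF _ sqrt_at_top])
  moreover have "((\<lambda>x::real. 1 / ln (ln x)) \<longlongrightarrow> 0) at_top"
    and "((\<lambda>x. L (nat \<lfloor>sqrt x\<rfloor>) / ln (ln x)) \<longlongrightarrow> 1) at_top"
    unfolding L_def by real_asymp+
  ultimately have "((\<lambda>x. psum r (sqrt x) * (1 / ln (ln x)) + L (nat \<lfloor>sqrt x\<rfloor>) / ln (ln x)) \<longlongrightarrow>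
      suminf r * 0 + 1) at_top"
    by (intro tendsto_intros)
  moreover have "eventually (\<lambda>x. psum r (sqrt x) * (1 / ln (ln x)) + L (nat \<lfloor>sqrt x\<rfloor>) / ln (ln x) =
      psum (\<lambda>n. \<kappa> n / real n) (sqrt x) / ln (ln x)) at_top"
    using eventually_ge_at_top[of 1]
  proof eventually_elim
    case (elim x)
    have "psum r (sqrt x) = psum (\<lambda>n. \<kappa> n / real n - (L n - L (n - 1))) (sqrt x)"
      unfolding psum_def by (intro sum.cong) (auto simp: r_def diff_divide_distrib)
    also have "\<dots> = psum (\<lambda>n. \<kappa> n / real n) (sqrt x) - psum (\<lambda>n. L n - L (n - 1)) (sqrt x)"
      by (simp only: psum_def sum_subtractf)
    also have "psum (\<lambda>n. L n - L (n - 1)) (sqrt x) = L (nat \<lfloor>sqrt x\<rfloor>)"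
      using elim by (intro psum_telescope) (simp_all add: L_def)
    finally show ?case by (simp add: diff_divide_distrib)
  qed
  ultimately show ?thesis by (simp add: Lim_transform_eventually)
qed

lemma half_sum_error_tendsto_0:
  assumes f: "\<And>n. \<bar>f n\<bar> \<le> \<kappa> n" and F: "F \<in> O(\<lambda>y. y / ln y powr (1 + \<epsilon>))"
  shows "((\<lambda>x. half_sum f F x * ln x / x) \<longlongrightarrow> 0) at_top"
proof -
  obtain C where "C > 0" "eventually (\<lambda>y. norm (F y) \<le> C * norm (y / ln y powr (1 + \<epsilon>))) at_top"
    using F by (elim landau_o.bigE)
  then obtain Y where Y: "\<And>y. y \<ge> Y \<Longrightarrow> norm (F y) \<le> C * norm (y / ln y powr (1 + \<epsilon>))"
    by (auto simp: eventually_at_top_linorder)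
  let ?B = "\<lambda>x. C * (ln x * ln (ln x) / (ln x / 2) powr (1 + \<epsilon>)) *
      (psum (\<lambda>n. \<kappa> n / real n) (sqrt x) / ln (ln x))"
  have "((\<lambda>x. ln x * ln (ln x) / (ln x / 2) powr (1 + \<epsilon>)) \<longlongrightarrow> 0) at_top"
    using \<epsilon> by real_asymp
  then have "(?B \<longlongrightarrow> C * 0 * 1) at_top" by (intro tendsto_intros psum_\<kappa>_reciprocals)
  then have "(?B \<longlongrightarrow> 0) at_top" by simp
  moreover have "eventually (\<lambda>x. sqrt x \<ge> Y) at_top" "eventually (\<lambda>x::real. ln (ln x) > 0) at_top"
    by real_asymp+
  then have "eventually (\<lambda>x. norm (half_sum f F x * ln x / x) \<le> ?B x) at_top"
    using eventually_gt_at_top[of 1]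
  proof eventually_elim
    case (elim x)
    have "\<bar>half_sum f F x\<bar> \<le> C * x / (ln x / 2) powr (1 + \<epsilon>) * psum (\<lambda>n. \<kappa> n / real n) (sqrt x)"
    proof (rule abs_half_sum_le)
      show "\<bar>F y\<bar> \<le> C * (y / ln y powr (1 + \<epsilon>))" if "y \<ge> sqrt x" for y
      proof -
        have "0 < sqrt x" using elim(3) by simp
        then have "0 < y" using that by (rule less_le_trans)
        then show ?thesis using Y[of y] that elim(1) by simp
      qed
    qed (use \<epsilon> f \<open>C > 0\<close> elim in auto)
    then have "\<bar>half_sum f F x\<bar> * (ln x / x) \<le>
        C * x / (ln x / 2) powr (1 + \<epsilon>) * psum (\<lambda>n. \<kappa> n / real n) (sqrt x) * (ln x / x)"
      using elim by (intro mult_right_mono) auto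
    then show ?case using elim by (simp add: abs_mult field_simps)
  qed
  ultimately show ?thesis by (rule Lim_null_comparison[rotated])
qed

lemma half_sum_psum_\<kappa>:
  assumes "\<And>n. \<bar>f n\<bar> \<le> \<kappa> n"
  shows "((\<lambda>x. half_sum f (psum \<kappa>) x * ln x / x - (psum (\<lambda>n. f n / real n) (sqrt x) +
    log_weighted_sum (\<lambda>n. f n / real n) x)) \<longlongrightarrow> 0) at_top"
proof -
  have "((\<lambda>x. half_sum f (\<lambda>y. psum \<kappa> y - y / ln y) x * ln x / x) \<longlongrightarrow> 0) at_top"
    by (rule half_sum_error_tendsto_0[OF assms psum_\<kappa>_bigo])
  moreover have "eventually (\<lambda>x. half_sum f (\<lambda>y. psum \<kappa> y - y / ln y) x * ln x / x =
      half_sum f (psum \<kappa>) x * ln x / x - (psum (\<lambda>n. f n / real n) (sqrt x) +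
      log_weighted_sum (\<lambda>n. f n / real n) x)) at_top"
    using eventually_gt_at_top[of 1]
    by eventually_elim (simp add: half_sum_diff left_diff_distrib diff_divide_distrib half_sum_div_ln)
  ultimately show ?thesis by (rule Lim_transform_eventually)
qed

lemma log_weighted_\<kappa>_tendsto_0:
  "((\<lambda>x. log_weighted_sum (\<lambda>n. \<kappa> n / real n) x / ln (ln x)) \<longlongrightarrow> 0) at_top"
proof -
  let ?r = "\<lambda>n. (\<kappa> n - 1 / ln (real n)) / real n" and ?q = "\<lambda>n. 1 / (real n * ln (real n))"
  have "(log_weighted_sum ?r \<longlongrightarrow> 0) at_top"
    by (rule log_weighted_sum_tendsto_0[OF summable_\<kappa>_minus_inverse_ln])
  then have "log_weighted_sum ?r \<in> O(\<lambda>_. 1)"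
    by (intro bigoI_tendsto[where c = 0]) auto
  then have "(\<lambda>x. log_weighted_sum ?r x + log_weighted_sum ?q x) \<in> O(\<lambda>_. 1)"
    by (intro sum_in_bigo log_weighted_inverse_n_ln_bigo)
  moreover have "log_weighted_sum ?r x + log_weighted_sum ?q x = log_weighted_sum (\<lambda>n. \<kappa> n / real n) x" for x
    unfolding log_weighted_sum_def sum.distrib[symmetric]
    by (intro sum.cong refl) (simp add: diff_divide_distrib algebra_simps)
  ultimately have "log_weighted_sum (\<lambda>n. \<kappa> n / real n) \<in> O(\<lambda>_. 1)" by simp
  then have "(\<lambda>x. log_weighted_sum (\<lambda>n. \<kappa> n / real n) x * (1 / ln (ln x))) \<in> O(\<lambda>x. 1 * (1 / ln (ln x)))"
    by (rule landau_o.big.mult_right)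
  also have "(\<lambda>x::real. 1 * (1 / ln (ln x))) \<in> o(\<lambda>_. 1)" by real_asymp
  finally show ?thesis by (auto dest: smalloD_tendsto)
qed

theorem pair_sum_\<rho>_\<kappa>: "((\<lambda>x. pair_sum \<rho> \<kappa> x * ln x / x) \<longlongrightarrow> (\<Sum>n. \<rho> n / real n)) at_top"
proof -
  have "\<rho> 1 = 0" using abs_\<rho>_le[of 1] \<kappa>_1 by simp
  then have "((\<lambda>x. psum (\<lambda>n. \<rho> n / real n) (sqrt x)) \<longlongrightarrow> (\<Sum>n. \<rho> n / real n)) at_top"
    by (intro filterlim_compose[OF psum_tendsto_suminf sqrt_at_top] summable_\<rho>) simp_all
  then have "((\<lambda>x. psum (\<lambda>n. \<rho> n / real n) (sqrt x) + log_weighted_sum (\<lambda>n. \<rho> n / real n) x) \<longlongrightarrow>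
      (\<Sum>n. \<rho> n / real n) + 0) at_top"
    by (intro tendsto_add log_weighted_sum_tendsto_0 summable_\<rho>)
  then have "((\<lambda>x. half_sum \<rho> (psum \<kappa>) x * ln x / x) \<longlongrightarrow> (\<Sum>n. \<rho> n / real n) + 0) at_top"
    using half_sum_psum_\<kappa>[OF abs_\<rho>_le] by (rule Lim_transform)
  then have "((\<lambda>x. half_sum \<rho> (psum \<kappa>) x * ln x / x + half_sum \<kappa> (psum \<rho>) x * ln x / x) \<longlongrightarrow>
      (\<Sum>n. \<rho> n / real n) + 0 + 0) at_top"
    using \<kappa>_nonneg by (intro tendsto_add half_sum_error_tendsto_0 psum_\<rho>_bigo) auto
  then have "((\<lambda>x. pair_sum \<rho> \<kappa> x * ln x / x) \<longlongrightarrow> (\<Sum>n. \<rho> n / real n) + 0 + 0) at_top"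
    using pair_sum_minus_half_sums[OF psum_\<rho>_bigo_div_ln psum_\<kappa>_bigo_div_ln] by (rule Lim_transform)
  then show ?thesis by simp
qed

theorem pair_sum_\<rho>_\<rho>: "((\<lambda>x. pair_sum \<rho> \<rho> x * ln x / x) \<longlongrightarrow> 0) at_top"
proof -
  have "((\<lambda>x. half_sum \<rho> (psum \<rho>) x * ln x / x + half_sum \<rho> (psum \<rho>) x * ln x / x) \<longlongrightarrow> 0 + 0) at_top"
    by (intro tendsto_add half_sum_error_tendsto_0 abs_\<rho>_le psum_\<rho>_bigo)
  then have "((\<lambda>x. pair_sum \<rho> \<rho> x * ln x / x) \<longlongrightarrow> 0 + 0) at_top"
    using pair_sum_minus_half_sums[OF psum_\<rho>_bigo_div_ln psum_\<rho>_bigo_div_ln] by (rule Lim_transform)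
  then show ?thesis by simp
qed

theorem pair_sum_\<kappa>_\<kappa>: "((\<lambda>x. pair_sum \<kappa> \<kappa> x * ln x / x / ln (ln x)) \<longlongrightarrow> 2) at_top"
proof -
  let ?half = "\<lambda>x. half_sum \<kappa> (psum \<kappa>) x * ln x / x"
  let ?S = "\<lambda>x. psum (\<lambda>n. \<kappa> n / real n) (sqrt x)" and ?W = "log_weighted_sum (\<lambda>n. \<kappa> n / real n)"
  have lnln: "((\<lambda>x::real. 1 / ln (ln x)) \<longlongrightarrow> 0) at_top" by real_asymp
  have "((\<lambda>x. (?half x - (?S x + ?W x)) * (1 / ln (ln x)) + (?S x / ln (ln x) + ?W x / ln (ln x))) \<longlongrightarrow>
      0 * 0 + (1 + 0)) at_top"
    using \<kappa>_nonneg
    by (intro tendsto_add tendsto_mult half_sum_psum_\<kappa> psum_\<kappa>_reciprocals log_weighted_\<kappa>_tendsto_0 lnln) auto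
  then have "((\<lambda>x. ?half x / ln (ln x)) \<longlongrightarrow> 1) at_top"
    by (simp add: diff_divide_distrib add_divide_distrib)
  then have "((\<lambda>x. (pair_sum \<kappa> \<kappa> x * ln x / x - (?half x + ?half x)) * (1 / ln (ln x)) +
      2 * (?half x / ln (ln x))) \<longlongrightarrow> 0 * 0 + 2 * 1) at_top"
    by (intro tendsto_intros pair_sum_minus_half_sums psum_\<kappa>_bigo_div_ln lnln)
  then show ?thesis
    by (simp add: diff_divide_distrib add_divide_distrib)
qed

end

section \<open>Counting products of two primes\<close>

lemma prime_mult_eq_ordered:
  fixes p q p' q' :: nat
  assumes "prime p" "prime q" "prime p'" "prime q'" "p * q = p' * q'" "p \<le> q" "p' \<le> q'"
  shows "p = p' \<and> q = q'"
proof -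
  have "p dvd p' * q'" using assms(5) by (metis dvd_triv_left)
  then consider "p = p'" | "p = q'"
    using assms by (metis prime_dvd_mult_iff primes_dvd_imp_eq)
  then show ?thesis
  proof cases
    assume "p = p'"
    then show ?thesis using assms prime_gt_0_nat[of p] by auto
  next
    assume "p = q'"
    then have "q = p'" using assms prime_gt_0_nat[of p] by (auto simp: mult.commute)
    with \<open>p = q'\<close> show ?thesis using assms by auto
  qed
qed

lemma card_symmetric_pairs:
  fixes A :: "('a :: linorder \<times> 'a) set"
  assumes "finite A" "\<And>a b. (a, b) \<in> A \<Longrightarrow> (b, a) \<in> A"
  shows "2 * card {(a, b) \<in> A. a \<le> b} = card A + card {a. (a, a) \<in> A}"
proof -
  let ?L = "{(a, b) \<in> A. a \<le> b}" and ?G = "{(a, b) \<in> A. b \<le> a}"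
  have "bij_betw (\<lambda>(a, b). (b, a)) ?L ?G"
    by (rule bij_betwI[of _ _ _ "\<lambda>(a, b). (b, a)"]) (use assms(2) in auto)
  then have "card ?G = card ?L" by (rule bij_betw_same_card[symmetric])
  moreover have "?L \<union> ?G = A" by auto
  moreover have "finite ?L" "finite ?G" by (auto intro: finite_subset[OF _ assms(1)])
  moreover have "bij_betw (\<lambda>a. (a, a)) {a. (a, a) \<in> A} (?L \<inter> ?G)"
    by (auto simp: bij_betw_def inj_on_def)
  then have "card {a. (a, a) \<in> A} = card (?L \<inter> ?G)" by (rule bij_betw_same_card)
  ultimately show ?thesis using card_Un_Int[of ?L ?G] by simp
qed

lemma card_ordered_prime_pairs:
  "card {(p, q). prime p \<and> Q p \<and> prime q \<and> Q q \<and> real (p * q) \<le> x \<and> p \<le> q} =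
    count_pq x (\<lambda>p q. Q p \<and> Q q)"
proof -
  let ?L = "{(p, q). prime p \<and> Q p \<and> prime q \<and> Q q \<and> real (p * q) \<le> x \<and> p \<le> q}"
  let ?S = "{n. real n \<le> x \<and> (\<exists>p q. prime p \<and> prime q \<and> n = p * q \<and> Q p \<and> Q q)}"
  have "inj_on (\<lambda>(p, q). p * q) ?L"
    by (intro inj_onI) (clarsimp simp only: mem_Collect_eq case_prod_conv prod.inject prime_mult_eq_ordered)
  moreover have "(\<lambda>(p, q). p * q) ` ?L = ?S"
  proof (intro equalityI subsetI)
    fix n assume "n \<in> ?S"
    then obtain p q where pq: "prime p" "Q p" "prime q" "Q q" "n = p * q" "real n \<le> x" by auto
    then have "(min p q, max p q) \<in> ?L" "n = min p q * max p q"
      by (auto simp: min_def max_def mult.commute)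
    then show "n \<in> (\<lambda>(p, q). p * q) ` ?L" by (intro image_eqI[of _ _ "(min p q, max p q)"]) simp_all
  qed auto
  ultimately have "bij_betw (\<lambda>(p, q). p * q) ?L ?S" by (simp add: bij_betw_def)
  then show ?thesis unfolding count_pq_def by (rule bij_betw_same_card)
qed

lemma count_pq_pair_sum:
  fixes Q :: "nat \<Rightarrow> bool" and x :: real
  defines "u \<equiv> (\<lambda>n. of_bool (prime n \<and> Q n))"
  assumes "x \<ge> 0"
  shows "\<bar>2 * real (count_pq x (\<lambda>p q. Q p \<and> Q q)) - pair_sum u u x\<bar> \<le> sqrt x"
proof -
  let ?A = "{(p, q). prime p \<and> Q p \<and> prime q \<and> Q q \<and> real (p * q) \<le> x}"
  have "finite ?A"
    by (rule finite_subset[OF _ finite_pairs[of x]]) (auto dest: prime_ge_2_nat)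
  then have "2 * card {(p, q) \<in> ?A. p \<le> q} = card ?A + card {p. (p, p) \<in> ?A}"
    by (rule card_symmetric_pairs) (auto simp: mult.commute)
  moreover have "{(p, q) \<in> ?A. p \<le> q} =
      {(p, q). prime p \<and> Q p \<and> prime q \<and> Q q \<and> real (p * q) \<le> x \<and> p \<le> q}"
    by auto
  ultimately have "2 * count_pq x (\<lambda>p q. Q p \<and> Q q) = card ?A + card {p. (p, p) \<in> ?A}"
    by (simp only: card_ordered_prime_pairs)
  then have count: "2 * real (count_pq x (\<lambda>p q. Q p \<and> Q q)) =
      real (card ?A) + real (card {p. (p, p) \<in> ?A})"
    by linarith
  have "pair_sum u u x = (\<Sum>(p, q)\<in>?A. 1)"
    unfolding pair_sum_def
    by (intro sum.mono_neutral_cong_right finite_pairs) (auto simp: u_def dest: prime_ge_2_nat)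
  then have "pair_sum u u x = real (card ?A)" by simp
  moreover have "real (card {p. (p, p) \<in> ?A}) \<le> sqrt x"
  proof -
    have "p \<le> nat \<lfloor>sqrt x\<rfloor>" if "(p, p) \<in> ?A" for p
      using that by (intro le_nat_floor real_le_rsqrt) (simp add: power2_eq_square)
    then have "{p. (p, p) \<in> ?A} \<subseteq> {1..nat \<lfloor>sqrt x\<rfloor>}" by (auto dest: prime_gt_0_nat)
    then have "card {p. (p, p) \<in> ?A} \<le> card {1..nat \<lfloor>sqrt x\<rfloor>}" by (intro card_mono) auto
    then have "real (card {p. (p, p) \<in> ?A}) \<le> real (nat \<lfloor>sqrt x\<rfloor>)" by simp
    also have "\<dots> \<le> sqrt x" using assms(2) by simp
    finally show ?thesis .
  qed
  ultimately show ?thesis using count by simp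
qed

lemma count_pq_asymptotic:
  fixes Q :: "nat \<Rightarrow> bool"
  defines "u \<equiv> (\<lambda>n. of_bool (prime n \<and> Q n))"
  shows "((\<lambda>x. (2 * real (count_pq x (\<lambda>p q. Q p \<and> Q q)) - pair_sum u u x) * ln x / x) \<longlongrightarrow> 0) at_top"
proof (rule Lim_null_comparison)
  show "((\<lambda>x::real. sqrt x * ln x / x) \<longlongrightarrow> 0) at_top" by real_asymp
  show "eventually (\<lambda>x. norm ((2 * real (count_pq x (\<lambda>p q. Q p \<and> Q q)) - pair_sum u u x) * ln x / x) \<le>
      sqrt x * ln x / x) at_top"
    using eventually_ge_at_top[of 1]
  proof eventually_elim
    case (elim x)
    then have "\<bar>2 * real (count_pq x (\<lambda>p q. Q p \<and> Q q)) - pair_sum u u x\<bar> * (ln x / x) \<le>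
        sqrt x * (ln x / x)"
      unfolding u_def by (intro mult_right_mono count_pq_pair_sum) auto
    then show ?case using elim by (simp add: abs_mult)
  qed
qed

lemma pair_sum_commute: "pair_sum f g x = pair_sum g f x"
  unfolding pair_sum_def
  by (rule sum.reindex_bij_witness[of _ "\<lambda>(p, q). (q, p)" "\<lambda>(p, q). (q, p)"]) (auto simp: mult.commute)

lemma pair_sum_square:
  assumes "\<eta> ^ 2 = 1" "\<And>n. u n = (\<kappa> n + \<eta> * \<rho> n) / 2"
  shows "4 * pair_sum u u x = pair_sum \<kappa> \<kappa> x + 2 * \<eta> * pair_sum \<rho> \<kappa> x + pair_sum \<rho> \<rho> x"
proof -
  have "4 * pair_sum u u x =
      pair_sum \<kappa> \<kappa> x + \<eta> * pair_sum \<rho> \<kappa> x + \<eta> * pair_sum \<kappa> \<rho> x + \<eta> ^ 2 * pair_sum \<rho> \<rho> x"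
    unfolding pair_sum_def sum_distrib_left sum.distrib[symmetric]
    by (intro sum.cong refl) (auto simp: assms(2) field_simps power2_eq_square)
  then show ?thesis using assms(1) pair_sum_commute[where f = \<kappa> and g = \<rho> and x = x] by simp
qed

context log_density_pair
begin

context
  fixes u :: "nat \<Rightarrow> real" and A B :: "real \<Rightarrow> real" and \<eta> :: real
  assumes \<eta>: "\<eta> ^ 2 = 1" and u: "\<And>n. u n = (\<kappa> n + \<eta> * \<rho> n) / 2"
    and A_tendsto: "((\<lambda>x. (2 * A x - pair_sum u u x) * ln x / x) \<longlongrightarrow> 0) at_top"
    and B_tendsto: "((\<lambda>x. (2 * B x - pair_sum \<kappa> \<kappa> x) * ln x / x) \<longlongrightarrow> 0) at_top"
begin

lemma count_difference_tendsto:
  "((\<lambda>x. (4 * A x - B x) * ln x / x) \<longlongrightarrow> \<eta> * (\<Sum>n. \<rho> n / real n)) at_top"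
proof -
  let ?a = "\<lambda>x. (2 * A x - pair_sum u u x) * ln x / x" and ?b = "\<lambda>x. (2 * B x - pair_sum \<kappa> \<kappa> x) * ln x / x"
  have "((\<lambda>x. \<eta> * (pair_sum \<rho> \<kappa> x * ln x / x) + 1 / 2 * (pair_sum \<rho> \<rho> x * ln x / x) +
      2 * ?a x - 1 / 2 * ?b x) \<longlongrightarrow> \<eta> * (\<Sum>n. \<rho> n / real n) + 1 / 2 * 0 + 2 * 0 - 1 / 2 * 0) at_top"
    by (intro tendsto_intros pair_sum_\<rho>_\<kappa> pair_sum_\<rho>_\<rho> A_tendsto B_tendsto)
  moreover have "\<eta> * (pair_sum \<rho> \<kappa> x * ln x / x) + 1 / 2 * (pair_sum \<rho> \<rho> x * ln x / x) +
      2 * ?a x - 1 / 2 * ?b x = (4 * A x - B x) * ln x / x" for x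
  proof -
    have "4 * A x - B x = \<eta> * pair_sum \<rho> \<kappa> x + 1 / 2 * pair_sum \<rho> \<rho> x +
        2 * (2 * A x - pair_sum u u x) - 1 / 2 * (2 * B x - pair_sum \<kappa> \<kappa> x)"
      using pair_sum_square[where u = u and \<kappa> = \<kappa> and \<rho> = \<rho> and x = x, OF \<eta> u]
      by (simp add: field_simps)
    then show ?thesis by (simp only: divide_inverse ring_distribs mult_ac)
  qed
  ultimately show ?thesis by simp
qed

lemma total_count_tendsto: "((\<lambda>x. B x * ln x / x / ln (ln x)) \<longlongrightarrow> 1) at_top"
proof -
  let ?b = "\<lambda>x. (2 * B x - pair_sum \<kappa> \<kappa> x) * ln x / x"
  have "((\<lambda>x::real. 1 / ln (ln x)) \<longlongrightarrow> 0) at_top" by real_asymp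
  then have "((\<lambda>x. 1 / 2 * (pair_sum \<kappa> \<kappa> x * ln x / x / ln (ln x)) + 1 / 2 * (?b x * (1 / ln (ln x)))) \<longlongrightarrow>
      1 / 2 * 2 + 1 / 2 * (0 * 0)) at_top"
    by (intro tendsto_intros pair_sum_\<kappa>_\<kappa> B_tendsto)
  moreover have "1 / 2 * (pair_sum \<kappa> \<kappa> x * ln x / x / ln (ln x)) + 1 / 2 * (?b x * (1 / ln (ln x))) =
      B x * ln x / x / ln (ln x)" for x
    by (simp add: left_diff_distrib diff_divide_distrib)
  ultimately show ?thesis by simp
qed

theorem count_ratio_tendsto:
  "((\<lambda>x. \<eta> * (A x / (1 / 4 * B x) - 1) * ln (ln x)) \<longlongrightarrow> (\<Sum>n. \<rho> n / real n)) at_top"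
proof -
  have "((\<lambda>x. \<eta> * (((4 * A x - B x) * ln x / x) / (B x * ln x / x / ln (ln x)))) \<longlongrightarrow>
      \<eta> * (\<eta> * (\<Sum>n. \<rho> n / real n) / 1)) at_top"
    by (intro tendsto_intros count_difference_tendsto total_count_tendsto) auto
  moreover have "\<eta> * (\<eta> * (\<Sum>n. \<rho> n / real n) / 1) = (\<Sum>n. \<rho> n / real n)"
    using \<eta> by (simp add: power2_eq_square flip: mult.assoc)
  moreover have "eventually (\<lambda>x. B x * ln x / x / ln (ln x) > 0) at_top"
    using order_tendstoD(1)[OF total_count_tendsto, of 0] by simp
  then have "eventually (\<lambda>x. \<eta> * (((4 * A x - B x) * ln x / x) / (B x * ln x / x / ln (ln x))) =
      \<eta> * (A x / (1 / 4 * B x) - 1) * ln (ln x)) at_top"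
  proof eventually_elim
    case (elim x)
    then have "B x \<noteq> 0" "ln x \<noteq> 0" "x \<noteq> 0" "ln (ln x) \<noteq> 0" by auto
    then show ?case by (simp add: divide_simps)
  qed
  ultimately show ?thesis by (simp only: Lim_transform_eventually)
qed

end

end

section \<open>Quadratic characters\<close>

locale dirichlet_char =
  fixes m :: nat and \<chi> :: "int \<Rightarrow> complex"
  assumes dirichlet_character: "dirichlet_character m \<chi>"
begin

lemma modulus_pos: "m > 0"
  and character_mult: "\<chi> (a * b) = \<chi> a * \<chi> b"
  and character_periodic: "\<chi> (a + int m) = \<chi> a"
  and character_nonzero_iff: "\<chi> a \<noteq> 0 \<longleftrightarrow> coprime a (int m)"
  using dirichlet_character by (auto simp: dirichlet_character_def)

lemma character_1: "\<chi> 1 = 1"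
  using character_mult[of 1 1] character_nonzero_iff[of 1] by simp

lemma character_mod: "\<chi> (a mod int m) = \<chi> a"
proof -
  have "\<chi> (b + k * int m) = \<chi> b" for b k
  proof (induction k rule: int_induct[where k = 0])
    case (step1 k)
    then show ?case using character_periodic[of "b + k * int m"] by (simp add: algebra_simps)
  next
    case (step2 k)
    then show ?case using character_periodic[of "b + (k - 1) * int m"] by (simp add: algebra_simps)
  qed simp
  from this[of "a mod int m" "a div int m"] show ?thesis by simp
qed

lemma bij_betw_mult_mod:
  assumes "coprime b (int m)"
  shows "bij_betw (\<lambda>a. (b * a) mod int m) {0..<int m} {0..<int m}"
proof -
  let ?f = "\<lambda>a. (b * a) mod int m"
  have inj: "inj_on ?f {0..<int m}"
  proof (rule inj_onI)
    fix a a' assume a: "a \<in> {0..<int m}" "a' \<in> {0..<int m}" "?f a = ?f a'"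
    then have "int m dvd b * (a - a')" by (simp add: mod_eq_dvd_iff right_diff_distrib)
    then have "int m dvd a - a'"
      using assms by (simp add: coprime_dvd_mult_right_iff coprime_commute)
    then have "a mod int m = a' mod int m" by (simp add: mod_eq_dvd_iff)
    then show "a = a'" using a by simp
  qed
  moreover have "?f ` {0..<int m} \<subseteq> {0..<int m}" using modulus_pos by auto
  ultimately show ?thesis
    unfolding bij_betw_def by (intro conjI card_subset_eq) (auto simp: card_image)
qed

lemma sum_character_period:
  assumes "\<chi> \<noteq> principal_character m"
  shows "(\<Sum>a\<in>{0..<int m}. \<chi> a) = 0"
proof -
  obtain b where "\<chi> b \<noteq> principal_character m b" using assms by auto
  then have b: "coprime b (int m)" "\<chi> b \<noteq> 1"
    using character_nonzero_iff[of b] by (auto simp: principal_character_def split: if_splits)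
  have "\<chi> b * (\<Sum>a\<in>{0..<int m}. \<chi> a) = (\<Sum>a\<in>{0..<int m}. \<chi> ((b * a) mod int m))"
    by (simp add: sum_distrib_left character_mult character_mod)
  also have "\<dots> = (\<Sum>a\<in>{0..<int m}. \<chi> a)"
    by (rule sum.reindex_bij_betw[OF bij_betw_mult_mod[OF b(1)]])
  finally have "(\<chi> b - 1) * (\<Sum>a\<in>{0..<int m}. \<chi> a) = 0" by (simp add: left_diff_distrib)
  then show ?thesis using b(2) by simp
qed

end

locale quadratic_dirichlet_char =
  fixes d :: nat and \<chi> :: "int \<Rightarrow> complex"
  assumes quadratic_character: "quadratic_character d \<chi>"
begin

sublocale dirichlet_char d \<chi>
  using quadratic_character by unfold_locales (simp add: quadratic_character_def)

definition real_char :: "nat \<Rightarrow> real" where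
  "real_char n = Re (\<chi> (int n))"

lemma character_values: "\<chi> a \<in> {-1, 0, 1}"
proof (cases "coprime a (int d)")
  case True
  have "(\<chi> a)\<^sup>2 = principal_character d a"
    using quadratic_character by (auto simp: quadratic_character_def dest: fun_cong)
  then have "(\<chi> a)\<^sup>2 = 1" using True by (simp add: principal_character_def)
  then show ?thesis by (simp add: power2_eq_1_iff) blast
next
  case False
  then show ?thesis using character_nonzero_iff by auto
qed

lemma of_real_real_char: "complex_of_real (real_char n) = \<chi> (int n)"
  using character_values[of "int n"] by (auto simp: real_char_def)

lemma character_eq_of_real_iff: "\<chi> (int n) = of_real t \<longleftrightarrow> real_char n = t"
  unfolding of_real_real_char[symmetric] by simp

lemma real_char_nonzero_iff: "real_char n \<noteq> 0 \<longleftrightarrow> coprime n d"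
  using character_eq_of_real_iff[of n 0] character_nonzero_iff[of "int n"] by simp

sublocale sign_character real_char
proof
  show "real_char (m * n) = real_char m * real_char n" for m n
  proof -
    have "complex_of_real (real_char (m * n)) = complex_of_real (real_char m * real_char n)"
      by (simp add: of_real_real_char character_mult)
    then show ?thesis by (simp only: of_real_eq_iff)
  qed
  show "real_char 1 = 1" by (simp add: real_char_def character_1)
  show "real_char n \<in> {-1, 0, 1}" for n
    using character_values[of "int n"] by (auto simp: real_char_def)
qed

lemma real_char_periodic: "real_char (n + d) = real_char n"
  using character_periodic[of "int n"] by (simp add: real_char_def)

lemma sum_real_char_period: "(\<Sum>n<d. real_char (Suc n)) = 0"
proof -
  have "complex_of_real (\<Sum>n<d. real_char n) = (\<Sum>n<d. \<chi> (int n))" by (simp add: of_real_real_char)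
  also have "\<dots> = (\<Sum>a\<in>{0..<int d}. \<chi> a)"
    by (rule sum.reindex_bij_witness[of _ nat int]) auto
  also have "\<dots> = of_real 0"
    using quadratic_character by (simp add: sum_character_period quadratic_character_def)
  finally have "(\<Sum>n<d. real_char n) = 0" by (simp only: of_real_eq_iff)
  then show ?thesis
    using sum.lessThan_Suc_shift[of real_char d] real_char_periodic[of 0] by simp
qed

lemma abs_partial_sum_real_char_le: "\<bar>\<Sum>n<N. real_char (Suc n)\<bar> \<le> real d"
proof (induction N rule: less_induct)
  case (less N)
  show ?case
  proof (cases "N < d")
    case True
    have "\<bar>\<Sum>n<N. real_char (Suc n)\<bar> \<le> (\<Sum>n<N. 1)"
      by (intro order_trans[OF sum_abs sum_mono] abs_chi_le_1)
    then show ?thesis using True by simp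
  next
    case False
    define k where "k = N - d"
    have "(\<Sum>n<d + k. real_char (Suc n)) = (\<Sum>n<d. real_char (Suc n)) + (\<Sum>n<k. real_char (Suc n))"
    proof (induction k)
      case (Suc k)
      then show ?case using real_char_periodic[of "Suc k"] by (simp add: add.commute)
    qed simp
    then show ?thesis
      using less[of k] False modulus_pos by (simp add: k_def sum_real_char_period)
  qed
qed

sublocale nonprincipal_character real_char "real d"
  by unfold_locales (rule abs_partial_sum_real_char_le)

definition prime_char :: "nat \<Rightarrow> real" where
  "prime_char n = (if prime n then real_char n else 0)"

definition coprime_prime :: "nat \<Rightarrow> real" where
  "coprime_prime n = of_bool (prime n \<and> coprime n d)"

lemma log_saving_coprime_prime:
  assumes "log_saving (\<lambda>n. (if prime n then 1 else 0) - 1 / ln (real n)) \<epsilon>"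
  shows "log_saving (\<lambda>n. coprime_prime n - 1 / ln (real n)) \<epsilon>"
proof -
  have "log_saving (\<lambda>n. (if prime n then 1 else 0) - coprime_prime n) \<epsilon>"
  proof (rule log_saving_finite_support)
    fix n assume "n > d"
    then have "coprime n d" if "prime n"
      using that modulus_pos by (intro prime_imp_coprime) (auto dest: dvd_imp_le)
    then show "(if prime n then 1 else 0) - coprime_prime n = 0" by (simp add: coprime_prime_def)
  qed
  from log_saving_diff[OF assms this] show ?thesis by simp
qed

lemma log_density_pair_exists:
  obtains \<epsilon> where "log_density_pair coprime_prime prime_char \<epsilon>"
proof -
  obtain \<epsilon>\<^sub>1 where \<epsilon>\<^sub>1: "0 < \<epsilon>\<^sub>1" "\<epsilon>\<^sub>1 \<le> 1" "log_saving (\<lambda>n. mangoldt n - 1) \<epsilon>\<^sub>1"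
    by (rule log_saving_mangoldt)
  obtain \<epsilon>\<^sub>2 where \<epsilon>\<^sub>2: "0 < \<epsilon>\<^sub>2" "\<epsilon>\<^sub>2 \<le> 1" "log_saving (\<lambda>n. real_char n * mangoldt n) \<epsilon>\<^sub>2"
    by (rule log_saving_chi_mangoldt)
  define \<epsilon> where "\<epsilon> = min \<epsilon>\<^sub>1 \<epsilon>\<^sub>2"
  have \<epsilon>: "0 < \<epsilon>" "\<epsilon> \<le> 1" "\<epsilon> \<le> \<epsilon>\<^sub>1" "\<epsilon> \<le> \<epsilon>\<^sub>2" using \<epsilon>\<^sub>1 \<epsilon>\<^sub>2 by (auto simp: \<epsilon>_def)
  have "log_density_pair coprime_prime prime_char \<epsilon>"
  proof
    show "log_saving (\<lambda>n. coprime_prime n - 1 / ln (real n)) (1 + \<epsilon>)"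
      using log_saving_primes[of "\<lambda>_. 1" "\<lambda>_. 1"] log_saving_mono[OF \<epsilon>\<^sub>1(3) \<epsilon>(3)] \<epsilon>
      by (intro log_saving_coprime_prime) simp
    show "log_saving prime_char (1 + \<epsilon>)"
      using log_saving_primes[of real_char "\<lambda>_. 0"] log_saving_mono[OF \<epsilon>\<^sub>2(3) \<epsilon>(4)] \<epsilon> abs_chi_le_1
      by (simp add: prime_char_def[abs_def])
    show "\<bar>prime_char n\<bar> \<le> coprime_prime n" for n
      using abs_chi_le_1[of n] real_char_nonzero_iff[of n] by (auto simp: prime_char_def coprime_prime_def)
  qed (use \<epsilon> in \<open>auto simp: coprime_prime_def\<close>)
  then show ?thesis by (rule that)
qed

lemma of_bool_real_char_eq:
  assumes "\<eta> \<in> {-1, 1}"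
  shows "of_bool (prime n \<and> real_char n = \<eta>) = (coprime_prime n + \<eta> * prime_char n) / 2"
proof -
  have "coprime_prime n = (prime_char n)\<^sup>2"
    using chi_values[of n] real_char_nonzero_iff[of n]
    by (cases "coprime n d") (auto simp: coprime_prime_def prime_char_def)
  then show ?thesis
    using assms chi_values[of n] by (elim insertE) (auto simp: prime_char_def)
qed

lemma prime_sum_eq:
  assumes "summable (\<lambda>n. prime_char n / real n)"
  shows "prime_sum \<chi> = of_real (\<Sum>n. prime_char n / real n)"
proof -
  have "prime_sum \<chi> = (\<Sum>n. of_real (prime_char n / real n))"
    unfolding prime_sum_def
    by (intro arg_cong[where f = suminf] ext) (simp add: prime_char_def of_real_real_char)
  then show ?thesis using suminf_of_real[OF assms, where ?'a = complex] by simp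
qed

end

lemma ratio_expansion:
  fixes \<eta> :: int and R :: "real \<Rightarrow> real"
  assumes "\<eta> \<in> {-1, 1}" "((\<lambda>x. of_int \<eta> * (R x - 1) * ln (ln x)) \<longlongrightarrow> l) at_top"
  shows "\<exists>\<epsilon> :: real \<Rightarrow> complex. (\<epsilon> \<longlongrightarrow> 0) at_top \<and> (\<forall>\<^sub>F x in at_top.
    complex_of_real (R x) = 1 + of_int \<eta> * ((of_real l + \<epsilon> x) / complex_of_real (ln (ln x))))"
proof (intro exI conjI)
  let ?\<epsilon> = "\<lambda>x. complex_of_real (of_int \<eta> * (R x - 1) * ln (ln x) - l)"
  have "((\<lambda>x. of_int \<eta> * (R x - 1) * ln (ln x) - l) \<longlongrightarrow> 0) at_top"
    using assms(2) by (rule LIM_zero)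
  from tendsto_of_real[OF this] show "(?\<epsilon> \<longlongrightarrow> 0) at_top" by simp
  have "eventually (\<lambda>x::real. ln (ln x) > 0) at_top" by real_asymp
  then show "\<forall>\<^sub>F x in at_top. complex_of_real (R x) =
      1 + of_int \<eta> * ((of_real l + ?\<epsilon> x) / complex_of_real (ln (ln x)))"
  proof eventually_elim
    case (elim x)
    then have "(of_real l + ?\<epsilon> x) / complex_of_real (ln (ln x)) = of_int \<eta> * (of_real (R x) - 1)"
      by simp
    then show ?case using assms(1) by auto
  qed
qed

theorem mainTheorem1:
  fixes \<chi> :: "int \<Rightarrow> complex" and d :: nat and \<eta> :: int
  assumes "quadratic_character d \<chi>"
    and "conductor d \<chi> = d"
    and "\<eta> \<in> {-1, 1}"
  shows "\<exists>\<epsilon> :: real \<Rightarrow> complex. (\<epsilon> \<longlongrightarrow> 0) at_top \<and>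
    (\<forall>\<^sub>F x in at_top.
       complex_of_real
         (real (count_pq x (\<lambda>p q. \<chi> (int p) = of_int \<eta> \<and> \<chi> (int q) = of_int \<eta>)) /
          (1 / 4 * real (count_pq x (\<lambda>p q. coprime (p * q) d)))) =
       1 + of_int \<eta> * ((prime_sum \<chi> + \<epsilon> x) / complex_of_real (ln (ln x))))"
proof -
  interpret quadratic_dirichlet_char d \<chi> by unfold_locales (rule assms(1))
  obtain \<epsilon> where "log_density_pair coprime_prime prime_char \<epsilon>" by (rule log_density_pair_exists)
  then interpret log_density_pair coprime_prime prime_char \<epsilon> .
  let ?u = "\<lambda>n. of_bool (prime n \<and> real_char n = of_int \<eta>) :: real"
  have char_eq: "\<chi> (int n) = of_int \<eta> \<longleftrightarrow> real_char n = of_int \<eta>" for n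
    using character_eq_of_real_iff[of n "of_int \<eta>"] by simp
  have u: "?u n = (coprime_prime n + of_int \<eta> * prime_char n) / 2" for n
    using assms(3) by (intro of_bool_real_char_eq) auto
  have "((\<lambda>x. of_int \<eta> * (real (count_pq x (\<lambda>p q. \<chi> (int p) = of_int \<eta> \<and> \<chi> (int q) = of_int \<eta>)) /
      (1 / 4 * real (count_pq x (\<lambda>p q. coprime (p * q) d))) - 1) * ln (ln x)) \<longlongrightarrow>
      (\<Sum>n. prime_char n / real n)) at_top"
    unfolding char_eq coprime_mult_left_iff
    using assms(3) count_pq_asymptotic[of "\<lambda>n. real_char n = of_int \<eta>"]
      count_pq_asymptotic[of "\<lambda>n. coprime n d", folded coprime_prime_def[abs_def]]
    by (intro count_ratio_tendsto[OF _ u]) auto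
  from ratio_expansion[OF assms(3) this] show ?thesis
    unfolding prime_sum_eq[OF summable_\<rho>] .
qed

end
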